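(* Let $n\ge3$ and $2\le k\le n$. The composite homomorphism $H(n,k)\xrightarrow{\Theta(n,k)}P\Sigma_n^+\hookrightarrow IA_n$ induces a morphism of Lie algebras $$gr_*^{DCS}(H(n,k))\to gr_*^{DCS}(P\Sigma_n^+)\to gr_*^J(IA_n)\to Der(L[V_n]),$$ and this composite is a monomorphism of Lie algebras which is a split monomorphism of abelian groups.
   Context: $F_n$ is free on $x_1,\dots,x_n$; $\Gamma^1G=G$, $\Gamma^pG=[G,\Gamma^{p-1}G]$, $gr_*^{DCS}G=\bigoplus_{p\ge1}\Gamma^pG/\Gamma^{p+1}G$ with bracket from commutators. $\alpha_{ij}\in\mathrm{Aut}(F_n)$ ($i\ne j$): $\alpha_{ij}(x_i)=x_jx_ix_j^{-1}$, $\alpha_{ij}(x_r)=x_r$ ($r\ne i$); $P\Sigma_n^+=\langle\alpha_{ij}:1\le j<i\le n\rangle$. For $2\le k\le m\le n$, $G(n,m,k-1)$ is the free subgroup generated by $\alpha_{m,1},\dots,\alpha_{m,k-1}$; $H(n,k)=G(n,k,k-1)\times\cdots\times G(n,n,k-1)$, and $\Theta(n,k):H(n,k)\to P\Sigma_n^+$ is the inclusion on each factor. $J_n^s=\ker(\mathrm{Aut}(F_n)\to\mathrm{Aut}(F_n/\Gamma^{s+1}F_n))$, $IA_n=J_n^1$, $gr_*^J(IA_n)=\bigoplus_s J_n^s/J_n^{s+1}$. $Der(L[V_n])=\bigoplus_{s\ge1}\mathrm{Hom}(V_n,L_{s+1}[V_n])$ where $L[V_n]$ is the free Lie algebra on $V_n=H_1(F_n)$;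 the map $gr_*^J(IA_n)\to Der(L[V_n])$ is induced by the Johnson homomorphisms $\tau_s(\phi)(x)=$ class of $\phi(\tilde x)\tilde x^{-1}$ in $L_{s+1}[V_n]\cong\Gamma^{s+1}F_n/\Gamma^{s+2}F_n$; the map $gr_*^{DCS}(P\Sigma_n^+)\to gr_*^J(IA_n)$ is induced by $\Gamma^sP\Sigma_n^+\subset J_n^s$. *)

theory Defs
  imports "HOL-Algebra.Algebra"
begin

type_synonym fword = "(nat \<times> bool) list"
  (* (i, True) is the letter x_i, (i, False) is x_i^{-1} *)

fun push :: "nat \<times> bool \<Rightarrow> fword \<Rightarrow> fword" where
  "push a [] = [a]"
| "push a (b # w) = (if fst a = fst b \<and> snd a \<noteq> snd b then w else a # b # w)"

definition reduce :: "fword \<Rightarrow> fword" where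
  "reduce w = foldr push w []"

definition reduced :: "fword \<Rightarrow> bool" where
  "reduced w \<longleftrightarrow> reduce w = w"

definition free_group :: "nat \<Rightarrow> fword monoid" where
  "free_group n = \<lparr>carrier = {w. reduced w \<and> (\<forall>a\<in>set w. fst a \<in> {1..n})},
                   monoid.mult = (\<lambda>v w. reduce (v @ w)), one = []\<rparr>"

definition gen :: "nat \<Rightarrow> fword" where
  "gen i = [(i, True)]"

definition inv_word :: "fword \<Rightarrow> fword" where
  "inv_word w = rev (map (\<lambda>(i, b). (i, \<not> b)) w)"

definition letter_img :: "(nat \<Rightarrow> fword) \<Rightarrow> nat \<times> bool \<Rightarrow> fword" where
  "letter_img f a = (if snd a then f (fst a) else inv_word (f (fst a)))"

definition lift_hom :: "nat \<Rightarrow> (nat \<Rightarrow> fword) \<Rightarrow> fword \<Rightarrow> fword" where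
  "lift_hom n f = (\<lambda>w \<in> carrier (free_group n). reduce (concat (map (letter_img f) w)))"

abbreviation AutF :: "nat \<Rightarrow> (fword \<Rightarrow> fword) monoid" where
  "AutF n \<equiv> AutoGroup (free_group n)"

definition alpha :: "nat \<Rightarrow> nat \<Rightarrow> nat \<Rightarrow> (fword \<Rightarrow> fword)" where
  "alpha n i j = lift_hom n (\<lambda>r. if r = i then [(j, True), (i, True), (j, False)] else gen r)"

definition PSigma_set :: "nat \<Rightarrow> (fword \<Rightarrow> fword) set" where
  "PSigma_set n = generate (AutF n) {alpha n i j | i j. 1 \<le> j \<and> j < i \<and> i \<le> n}"

definition PSigma :: "nat \<Rightarrow> (fword \<Rightarrow> fword) monoid" where
  "PSigma n = (AutF n)\<lparr>carrier := PSigma_set n\<rparr>"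

definition comm_sub :: "('a, 'b) monoid_scheme \<Rightarrow> 'a set \<Rightarrow> 'a set \<Rightarrow> 'a set" where
  "comm_sub G A B = generate G {a \<otimes>\<^bsub>G\<^esub> b \<otimes>\<^bsub>G\<^esub> inv\<^bsub>G\<^esub> a \<otimes>\<^bsub>G\<^esub> inv\<^bsub>G\<^esub> b | a b. a \<in> A \<and> b \<in> B}"

(* Gam G p is Gamma^p G for p \<ge> 1: Gamma^1 G = G, Gamma^p G = [G, Gamma^(p-1) G];
   the value at p = 0 is irrelevant and set to G *)
fun Gam :: "('a, 'b) monoid_scheme \<Rightarrow> nat \<Rightarrow> 'a set" where
  "Gam G 0 = carrier G"
| "Gam G (Suc 0) = carrier G"
| "Gam G (Suc (Suc p)) = comm_sub G (carrier G) (Gam G (Suc p))"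

definition grp :: "('a, 'b) monoid_scheme \<Rightarrow> nat \<Rightarrow> 'a set monoid" where
  "grp G p = (G\<lparr>carrier := Gam G p\<rparr>) Mod (Gam G (Suc p))"

definition grDCS :: "('a, 'b) monoid_scheme \<Rightarrow> (nat \<Rightarrow> 'a set) monoid" where
  "grDCS G = sum_group {1..} (grp G)"

definition gcomm :: "('a, 'b) monoid_scheme \<Rightarrow> 'a \<Rightarrow> 'a \<Rightarrow> 'a" where
  "gcomm G a b = a \<otimes>\<^bsub>G\<^esub> b \<otimes>\<^bsub>G\<^esub> inv\<^bsub>G\<^esub> a \<otimes>\<^bsub>G\<^esub> inv\<^bsub>G\<^esub> b"

definition grbr :: "('a, 'b) monoid_scheme \<Rightarrow> (nat \<Rightarrow> 'a set) \<Rightarrow> (nat \<Rightarrow> 'a set) \<Rightarrow> (nat \<Rightarrow> 'a set)" where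
  "grbr G c d = (\<lambda>r \<in> {1..}.
      Gam G (Suc r) #>\<^bsub>G\<^esub>
        foldr (\<lambda>p acc. gcomm G (SOME a. a \<in> c p) (SOME b. b \<in> d (r - p)) \<otimes>\<^bsub>G\<^esub> acc)
              [1..<r] \<one>\<^bsub>G\<^esub>)"

definition Gsub :: "nat \<Rightarrow> nat \<Rightarrow> nat \<Rightarrow> (fword \<Rightarrow> fword) monoid" where
  "Gsub n m l = (AutF n)\<lparr>carrier := generate (AutF n) {alpha n m a | a. 1 \<le> a \<and> a \<le> l}\<rparr>"

definition Hgrp :: "nat \<Rightarrow> nat \<Rightarrow> (nat \<Rightarrow> fword \<Rightarrow> fword) monoid" where
  "Hgrp n k = product_group {k..n} (\<lambda>m. Gsub n m (k - 1))"

definition Theta :: "nat \<Rightarrow> nat \<Rightarrow> (nat \<Rightarrow> fword \<Rightarrow> fword) \<Rightarrow> (fword \<Rightarrow> fword)" where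
  "Theta n k h = foldr (\<lambda>m acc. h m \<otimes>\<^bsub>AutF n\<^esub> acc) [k..<Suc n] \<one>\<^bsub>AutF n\<^esub>"

(* J_n^s = kernel of Aut(F_n) \<rightarrow> Aut(F_n / Gamma^(s+1) F_n) *)
definition J :: "nat \<Rightarrow> nat \<Rightarrow> (fword \<Rightarrow> fword) set" where
  "J n s = {\<phi> \<in> carrier (AutF n). \<forall>w \<in> carrier (free_group n).
              \<phi> w \<otimes>\<^bsub>free_group n\<^esub> inv\<^bsub>free_group n\<^esub> w \<in> Gam (free_group n) (Suc s)}"

(* elements of the (completed) tensor algebra: coefficient of each word x_(i1)...x_(im) *)
type_synonym tens = "nat list \<Rightarrow> int"

definition tmul :: "tens \<Rightarrow> tens \<Rightarrow> tens" where
  "tmul a b = (\<lambda>w. \<Sum>k\<le>length w. a (take k w) * b (drop k w))"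

definition tbr :: "tens \<Rightarrow> tens \<Rightarrow> tens" where
  "tbr a b = (\<lambda>w. tmul a b w - tmul b a w)"

definition tmono :: "nat list \<Rightarrow> tens" where
  "tmono v = (\<lambda>w. if w = v then 1 else 0)"

(* L[V_n]: the Lie subring of T(V_n) generated by V_n = span of X_1, ..., X_n *)
inductive_set lie_el :: "nat \<Rightarrow> tens set" for n where
  gen: "i \<in> {1..n} \<Longrightarrow> tmono [i] \<in> lie_el n"
| zero: "(\<lambda>w. 0) \<in> lie_el n"
| add: "a \<in> lie_el n \<Longrightarrow> b \<in> lie_el n \<Longrightarrow> (\<lambda>w. a w + b w) \<in> lie_el n"
| neg: "a \<in> lie_el n \<Longrightarrow> (\<lambda>w. - a w) \<in> lie_el n"
| brk: "a \<in> lie_el n \<Longrightarrow> b \<in> lie_el n \<Longrightarrow> tbr a b \<in> lie_el n"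

definition lie_deg :: "nat \<Rightarrow> nat \<Rightarrow> tens set" where
  "lie_deg n m = {a \<in> lie_el n. \<forall>w. length w \<noteq> m \<longrightarrow> a w = 0}"

definition hom_part :: "nat \<Rightarrow> tens \<Rightarrow> tens" where
  "hom_part m a = (\<lambda>w. if length w = m then a w else 0)"

(* Magnus expansion x_i \<mapsto> 1 + X_i, x_i^{-1} \<mapsto> 1 - X_i + X_i^2 - ... ;
   for w \<in> Gamma^m F_n, hom_part m (magnus w) realises the standard isomorphism
   Gamma^m F_n / Gamma^(m+1) F_n \<cong> L_m[V_n] *)
definition mag_letter :: "nat \<times> bool \<Rightarrow> tens" where
  "mag_letter a = (\<lambda>u. if snd a then (if u = [] \<or> u = [fst a] then 1 else 0)
                        else (if (\<forall>c\<in>set u. c = fst a) then (-1) ^ length u else 0))"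

definition magnus :: "fword \<Rightarrow> tens" where
  "magnus w = foldr (\<lambda>a acc. tmul (mag_letter a) acc) w (tmono [])"

section \<open>Der(L[V_n]) = direct sum over s \<ge> 1 of Hom(V_n, L_(s+1)[V_n])\<close>

(* a homomorphism V_n \<rightarrow> L_(s+1) is given by its values on the basis x_1,...,x_n *)
definition DerDeg :: "nat \<Rightarrow> nat \<Rightarrow> (nat \<Rightarrow> tens) monoid" where
  "DerDeg n s = \<lparr>carrier = {d. (\<forall>i \<in> {1..n}. d i \<in> lie_deg n (Suc s)) \<and> (\<forall>i. i \<notin> {1..n} \<longrightarrow> d i = (\<lambda>w. 0))},
                 monoid.mult = (\<lambda>d e. \<lambda>i w. d i w + e i w), one = (\<lambda>i w. 0)\<rparr>"

definition DerL :: "nat \<Rightarrow> (nat \<Rightarrow> nat \<Rightarrow> tens) monoid" where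
  "DerL n = sum_group {1..} (DerDeg n)"

(* extension of d (values on generators) to a derivation of T(V_n), hence of L[V_n] *)
definition ext_word :: "(nat \<Rightarrow> tens) \<Rightarrow> nat list \<Rightarrow> tens" where
  "ext_word d u = (\<lambda>w. \<Sum>j<length u. tmul (tmul (tmono (take j u)) (d (u ! j))) (tmono (drop (Suc j) u)) w)"

definition ext_der :: "(nat \<Rightarrow> tens) \<Rightarrow> tens \<Rightarrow> tens" where
  "ext_der d a = (\<lambda>w. \<Sum>u \<in> {u. a u \<noteq> 0}. a u * ext_word d u w)"

definition derbr_deg :: "(nat \<Rightarrow> tens) \<Rightarrow> (nat \<Rightarrow> tens) \<Rightarrow> (nat \<Rightarrow> tens)" where
  "derbr_deg d e = (\<lambda>i w. ext_der d (e i) w - ext_der e (d i) w)"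

definition derbr :: "(nat \<Rightarrow> nat \<Rightarrow> tens) \<Rightarrow> (nat \<Rightarrow> nat \<Rightarrow> tens) \<Rightarrow> (nat \<Rightarrow> nat \<Rightarrow> tens)" where
  "derbr D E = (\<lambda>r \<in> {1..}. \<lambda>i w. \<Sum>p \<in> {1..<r}. derbr_deg (D p) (E (r - p)) i w)"

definition tau :: "nat \<Rightarrow> nat \<Rightarrow> (fword \<Rightarrow> fword) \<Rightarrow> (nat \<Rightarrow> tens)" where
  "tau n s \<phi> = (\<lambda>i. if i \<in> {1..n}
      then hom_part (Suc s) (magnus (\<phi> (gen i) \<otimes>\<^bsub>free_group n\<^esub> inv\<^bsub>free_group n\<^esub> gen i))
      else (\<lambda>w. 0))"

(* the composite gr(H(n,k)) \<rightarrow> gr(P Sigma_n^+) \<rightarrow> gr^J(IA_n) \<rightarrow> Der(L[V_n]),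
   computed on a representative of each homogeneous component *)
definition Phi :: "nat \<Rightarrow> nat \<Rightarrow> (nat \<Rightarrow> (nat \<Rightarrow> fword \<Rightarrow> fword) set) \<Rightarrow> (nat \<Rightarrow> nat \<Rightarrow> tens)" where
  "Phi n k c = (\<lambda>s \<in> {1..}. tau n s (Theta n k (SOME h. h \<in> c s)))"

end

theory Submission
  imports Defs "HOL-Library.List_Lexorder" "HOL-Library.Product_Lexorder"
begin

text \<open>
  An element \<open>h\<close> of \<open>H(n,k)\<close> conjugates each \<open>x\<^sub>m\<close> with \<open>m \<ge> k\<close> by a word
  \<open>w\<^sub>m\<close> in \<open>x\<^sub>1, \<dots>, x\<^bsub>k-1\<^esub>\<close>, which it fixes: \<open>x\<^sub>m \<mapsto> w\<^sub>m\<^sup>-\<^sup>1 x\<^sub>m w\<^sub>m\<close>. If \<open>W\<^sub>m\<close> is the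
  leading term, of degree \<open>s\<close>, of the Magnus expansion of \<open>w\<^sub>m\<close>, then the Johnson image of \<open>h\<close>
  sends \<open>X\<^sub>m\<close> to \<open>[X\<^sub>m, W\<^sub>m]\<close>, and compatibility with brackets is the Jacobi identity.

  For injectivity and the splitting, the coefficient of \<open>[X\<^sub>m, W\<^sub>m]\<close> at \<open>X\<^sub>m l\<close> is the
  coefficient of \<open>W\<^sub>m\<close> at \<open>l\<close>. By the Jacobi identity the iterated
  commutators along the standard factorisations of Lyndon words of length \<open>s\<close> generate
  \<open>\<Gamma>\<^sup>s H / \<Gamma>\<^sup>s\<^sup>+\<^sup>1 H\<close>. The leading term belonging to a Lyndon word \<open>l\<close> is \<open>l\<close>
  plus lexicographically larger words, so evaluation at Lyndon words is unitriangular over the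
  integers and yields a retraction.
\<close>

section \<open>Lyndon words\<close>

text \<open>Generation and independence are proved on opposite sides of the map. Inside H it is only
  shown that the Lyndon commutators generate each graded piece; inside the tensor algebra it is only
  shown that their images have unitriangular coordinates. Both statements use the same finite index
  set of pairs (m, l), so the retraction can be prescribed on those images and the relations of H
  never have to be examined. Injectivity is then read off from the retraction. The obstacle on the
  group side is that the Jacobi identity holds only up to commutators of higher weight. Rewriting is
  therefore phrased as membership in a normal subgroup that contains the next term of the lower
  central series, and the error terms are absorbed there. On the tensor side a leading term is a
  relation between a series and a possibly zero homogeneous series. Zero must be allowed so that
  leading terms add under multiplication and so that deeper elements of the filtration obey the same
  rules. The conjugating words occur only as existential witnesses, since the Johnson image depends
  on the automorphism alone.\<close>

lemma lex_append_left: "x @ y < x @ z \<longleftrightarrow> y < (z :: nat list)"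
  by (induction x) auto

lemma lex_less_append: "y \<noteq> [] \<Longrightarrow> x < x @ (y :: nat list)"
  using lex_append_left[of x "[]" y] by (cases y) auto

lemma lex_le_append: "x \<le> x @ (y :: nat list)"
  by (cases "y = []") (auto intro: less_imp_le lex_less_append)

text \<open>If \<open>y\<close> does not extend \<open>x\<close>, the first difference lies inside
  both words, so no continuation can alter the comparison.\<close>

lemma lex_append_mono:
  fixes x y :: "nat list"
  assumes "x < y" "\<nexists>t. y = x @ t"
  shows "x @ z < y @ z'"
  using assms
proof (induction x arbitrary: y)
  case Nil
  then show ?case by auto
next
  case (Cons a x)
  then show ?case by (cases y) auto
qed

lemma lex_append_mono_length:
  fixes x y :: "nat list"
  assumes "x < y" "length y \<le> length x"
  shows "x @ z < y @ z'"
proof (rule lex_append_mono[OF assms(1)])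
  show "\<nexists>t. y = x @ t" using assms by auto
qed

definition lyndon :: "nat list \<Rightarrow> bool" where
  "lyndon w \<longleftrightarrow> w \<noteq> [] \<and> (\<forall>i. 0 < i \<and> i < length w \<longrightarrow> w < drop i w)"

lemma lyndon_not_Nil: "lyndon w \<Longrightarrow> w \<noteq> []"
  by (simp add: lyndon_def)

lemma lyndon_single [simp]: "lyndon [a]"
  unfolding lyndon_def by auto

lemma lyndon_suffix: "lyndon (s @ t) \<Longrightarrow> s \<noteq> [] \<Longrightarrow> t \<noteq> [] \<Longrightarrow> s @ t < t"
  unfolding lyndon_def by (auto dest: spec[of _ "length s"])

lemma lyndonI:
  assumes "w \<noteq> []" "\<And>s t. w = s @ t \<Longrightarrow> s \<noteq> [] \<Longrightarrow> t \<noteq> [] \<Longrightarrow> w < t"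
  shows "lyndon w"
  unfolding lyndon_def
proof (intro conjI allI impI)
  fix i assume "0 < i \<and> i < length w"
  then show "w < drop i w"
    using assms(2)[of "take i w" "drop i w"] by fastforce
qed (use assms in auto)

text \<open>If \<open>v = u @ t\<close>, then \<open>v < t\<close> because \<open>v\<close> is
  Lyndon, and prefixing \<open>u\<close> to both sides gives the claim. Otherwise \<open>u\<close>
  and \<open>v\<close> already differ inside \<open>u\<close>.\<close>

lemma lyndon_append_less:
  assumes "lyndon u" "lyndon v" "u < v"
  shows "u @ v < v"
proof (cases "\<exists>t. v = u @ t")
  case True
  then obtain t where t: "v = u @ t" by blast
  with assms have "t \<noteq> []" by auto
  then have "v < t" using lyndon_suffix[of u t] assms t lyndon_not_Nil by auto
  then show ?thesis using t lex_append_left by metis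
next
  case False
  then show ?thesis using lex_append_mono[OF assms(3) False, of v "[]"] by simp
qed

text \<open>A suffix starting inside \<open>v\<close> is at least \<open>v\<close>, which exceeds
  \<open>u @ v\<close>. A suffix starting inside \<open>u\<close> has the form \<open>r @ v\<close>
  with \<open>u < r\<close> and \<open>r\<close> shorter than \<open>u\<close>, so the comparison is
  settled within \<open>r\<close>.\<close>

lemma lyndon_append:
  assumes "lyndon u" "lyndon v" "u < v"
  shows "lyndon (u @ v)"
proof (rule lyndonI)
  show "u @ v \<noteq> []" using assms lyndon_not_Nil by auto
  fix s t assume *: "u @ v = s @ t" "s \<noteq> []" "t \<noteq> []"
  have uv: "u @ v < v" by (rule lyndon_append_less[OF assms])
  from *(1) consider (a) r where "u = s @ r" "t = r @ v" | (b) r where "s = u @ r" "v = r @ t"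
    by (auto simp: append_eq_append_conv2)
  then show "u @ v < t"
  proof cases
    case a
    show ?thesis
    proof (cases "r = []")
      case True
      with a uv show ?thesis by simp
    next
      case False
      then have "u < r" using lyndon_suffix[of s r] a assms * by auto
      then show ?thesis using a lex_append_mono_length[of u r v v] by auto
    qed
  next
    case b
    show ?thesis
    proof (cases "r = []")
      case True
      with b uv show ?thesis by simp
    next
      case False
      then have "v < t" using lyndon_suffix[of r t] b assms * by auto
      with uv show ?thesis by simp
    qed
  qed
qed

text \<open>Cutting before the least proper suffix gives the standard factorisation: for a Lyndon
  word that suffix is also its longest proper Lyndon suffix. The value is meaningful only for words
  of length at least 2.\<close>

definition std_split :: "nat list \<Rightarrow> nat" where
  "std_split w = (SOME i. 0 < i \<and> i < length w \<and> (\<forall>j. 0 < j \<and> j < length w \<longrightarrow> drop i w \<le> drop j w))"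

lemma std_split_props:
  assumes "2 \<le> length w"
  shows "0 < std_split w" "std_split w < length w"
    "0 < j \<Longrightarrow> j < length w \<Longrightarrow> drop (std_split w) w \<le> drop j w"
proof -
  let ?S = "(\<lambda>i. drop i w) ` {0<..<length w}"
  have "1 \<in> {0<..<length w}" using assms by auto
  then have S: "finite ?S" "?S \<noteq> {}" by blast+
  then obtain i where i: "i \<in> {0<..<length w}" "drop i w = Min ?S"
    using Min_in[OF S] by (metis imageE)
  have "\<exists>i. 0 < i \<and> i < length w \<and> (\<forall>j. 0 < j \<and> j < length w \<longrightarrow> drop i w \<le> drop j w)"
    using i S by (intro exI[of _ i]) auto
  from someI_ex[OF this, folded std_split_def]
  show "0 < std_split w" "std_split w < length w"
    "0 < j \<Longrightarrow> j < length w \<Longrightarrow> drop (std_split w) w \<le> drop j w" by auto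
qed

text \<open>Proper suffixes of \<open>v\<close> are suffixes of \<open>w\<close>, and
  \<open>v\<close> is the least of these, so \<open>v\<close> is Lyndon. If a suffix
  \<open>t\<close> of \<open>u\<close> were below \<open>u\<close>, then either
  \<open>u = t @ r\<close>, where \<open>w < t @ v\<close> forces \<open>r @ v < v\<close> against
  the minimality of \<open>v\<close>, or \<open>t\<close> and \<open>u\<close> differ early and
  \<open>t @ v < w\<close>, against \<open>w\<close> being Lyndon.\<close>

lemma std_split_lyndon:
  assumes "lyndon w" "2 \<le> length w"
  defines "u \<equiv> take (std_split w) w" and "v \<equiv> drop (std_split w) w"
  shows "lyndon u" "lyndon v" "u < v"
    "\<And>s t. w = s @ t \<Longrightarrow> s \<noteq> [] \<Longrightarrow> t \<noteq> [] \<Longrightarrow> v \<le> t"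
proof -
  note sp = std_split_props[OF assms(2)]
  have w: "w = u @ v" by (simp add: u_def v_def)
  have ne: "u \<noteq> []" "v \<noteq> []" using sp by (auto simp: u_def v_def)
  show min: "v \<le> t" if "w = s @ t" "s \<noteq> []" "t \<noteq> []" for s t
    using sp(3)[of "length s"] that by (auto simp: v_def)
  show "lyndon v"
  proof (rule lyndonI[OF ne(2)])
    fix s t assume "v = s @ t" "s \<noteq> []" "t \<noteq> []"
    then show "v < t" using min[of "u @ s" t] w by (auto simp: order_less_le)
  qed
  show "lyndon u"
  proof (rule lyndonI[OF ne(1)])
    fix s t assume st: "u = s @ t" "s \<noteq> []" "t \<noteq> []"
    then have 1: "w < t @ v" using lyndon_suffix[of s "t @ v"] assms(1) w by auto
    show "u < t"
    proof (rule ccontr)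
      assume "\<not> u < t"
      then have "t < u" using st by (metis append_self_conv2 linorder_neqE)
      show False
      proof (cases "\<exists>r. u = t @ r")
        case True
        then obtain r where r: "u = t @ r" by blast
        with st have "r \<noteq> []" by auto
        then have "v \<le> r @ v" using min[of t "r @ v"] w r st ne by auto
        moreover have "r @ v < v" using 1 w r lex_append_left[of t "r @ v" v] by simp
        ultimately show False by simp
      next
        case False
        then show False using lex_append_mono[OF \<open>t < u\<close>, of v v] 1 w by auto
      qed
    qed
  qed
  show "u < v"
    using lyndon_suffix[of u v] assms(1) w ne lex_le_append[of u v] by auto
qed

text \<open>Criterion for a product of Lyndon words to be already in standard form. A cut inside
  \<open>u\<close> would leave \<open>r @ v\<close> with \<open>r\<close> at least the right factor
  of \<open>u\<close>, hence at least \<open>v\<close>; but then \<open>r @ v\<close> exceeds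
  \<open>v\<close> and is not least.\<close>

lemma std_split_append:
  assumes "lyndon u" "lyndon v" "u < v"
    and "length u = 1 \<or> v \<le> drop (std_split u) u"
  shows "std_split (u @ v) = length u"
proof -
  have ne: "u \<noteq> []" "v \<noteq> []" using assms lyndon_not_Nil by auto
  then have len: "2 \<le> length (u @ v)" by (cases u; cases v) auto
  note sp = std_split_props[OF len]
  let ?t = "drop (std_split (u @ v)) (u @ v)"
  let ?s = "take (std_split (u @ v)) (u @ v)"
  have tv: "?t \<le> v" using sp(3)[of "length u"] ne by auto
  have eq: "u @ v = ?s @ ?t" by (rule append_take_drop_id[symmetric])
  have sne: "?s \<noteq> []" "?t \<noteq> []" using sp by auto
  have "v \<le> ?t \<and> (?t = v \<longrightarrow> length ?s = length u)"
  proof -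
    from eq consider (a) r where "u = ?s @ r" "?t = r @ v" | (b) r where "?s = u @ r" "v = r @ ?t"
      unfolding append_eq_append_conv2 by metis
    then show ?thesis
    proof cases
      case a
      show ?thesis
      proof (cases "r = []")
        case True
        with a show ?thesis by (metis append_Nil append_Nil2 order_refl)
      next
        case False
        have "\<not> length u = 1" using arg_cong[OF a(1), of length] sne False
          by (metis append_eq_Cons_conv append_is_Nil_conv length_0_conv length_Suc_conv One_nat_def)
        then have "2 \<le> length u" using ne by (cases u; cases "tl u") auto
        then have "drop (std_split u) u \<le> r"
          using std_split_lyndon(4)[OF assms(1) _ a(1)] sne False by auto
        then have "v \<le> r" using assms(4) \<open>\<not> length u = 1\<close> by auto
        also have "r < r @ v" by (rule lex_less_append[OF ne(2)])
        finally show ?thesis using a by auto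
      qed
    next
      case b
      show ?thesis
      proof (cases "r = []")
        case True
        with b show ?thesis by (metis append_Nil append_Nil2 order_refl)
      next
        case False
        then have "v < ?t" using b lyndon_suffix[of r ?t] assms sne by metis
        then show ?thesis by auto
      qed
    qed
  qed
  with tv have "length ?s = length u" by auto
  then show ?thesis using sp by simp
qed

text \<open>The bracket is a parameter so that one bracketing tree serves both the group commutator
  and the Lie bracket of power series; leading terms can then be computed along the tree.\<close>

function lbr :: "('a \<Rightarrow> 'a \<Rightarrow> 'a) \<Rightarrow> (nat \<Rightarrow> 'a) \<Rightarrow> nat list \<Rightarrow> 'a" where
  "lbr br g w = (if length w < 2 then g (hd w)
     else br (lbr br g (take (std_split w) w)) (lbr br g (drop (std_split w) w)))"
  by pat_completeness auto
termination
  by (relation "measure (\<lambda>(_, _, w). length w)") (use std_split_props(1,2) in \<open>auto simp: not_less intro!: diff_less\<close>)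

declare lbr.simps [simp del]

lemma lbr_single [simp]: "lbr br g [a] = g a"
  by (simp add: lbr.simps)

lemma lbr_append:
  assumes "lyndon u" "lyndon v" "u < v"
    and "length u = 1 \<or> v \<le> drop (std_split u) u"
  shows "lbr br g (u @ v) = br (lbr br g u) (lbr br g v)"
proof -
  have "u \<noteq> []" "v \<noteq> []" using assms lyndon_not_Nil by auto
  then have "\<not> length (u @ v) < 2" by (cases u; cases v) auto
  then show ?thesis
    by (subst lbr.simps) (simp add: std_split_append[OF assms])
qed

text \<open>The \<open>std_split\<close> hypothesis in the second case makes the induction follow
  the recursion of \<open>lbr\<close>.\<close>

lemma lyndon_induct [consumes 1, case_names single append]:
  assumes "lyndon w"
    and "\<And>a. P [a]"
    and "\<And>u v. lyndon u \<Longrightarrow> lyndon v \<Longrightarrow> u < v \<Longrightarrow> lyndon (u @ v) \<Longrightarrow> std_split (u @ v) = length u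
          \<Longrightarrow> P u \<Longrightarrow> P v \<Longrightarrow> P (u @ v)"
  shows "P w"
  using assms(1)
proof (induction w rule: length_induct)
  case (1 w)
  show ?case
  proof (cases "2 \<le> length w")
    case False
    with 1(2) obtain a where "w = [a]"
      by (cases w; cases "tl w") (auto simp: lyndon_def)
    then show ?thesis using assms(2) by simp
  next
    case True
    note sp = std_split_props[OF True] and sl = std_split_lyndon[OF 1(2) True]
    have "P (take (std_split w) w @ drop (std_split w) w)"
      using sp sl 1 by (intro assms(3)) auto
    then show ?thesis by simp
  qed
qed

lemma lbr_split:
  assumes "std_split (u @ v) = length u" "u \<noteq> []" "v \<noteq> []"
  shows "lbr br g (u @ v) = br (lbr br g u) (lbr br g v)"
proof -
  have "\<not> length (u @ v) < 2" using assms(2,3) by (cases u; cases v) auto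
  then show ?thesis by (subst lbr.simps) (simp add: assms)
qed

section \<open>Commutator calculus in the lower central series\<close>

lemma (in group_hom) subgroup_vimage:
  assumes "subgroup C H"
  shows "subgroup {x \<in> carrier G. h x \<in> C} G"
  using assms by (intro subgroup.intro) (auto simp: subgroup.m_closed subgroup.m_inv_closed subgroup.one_closed)

context group
begin

lemma inv_cancel_left: "x \<in> carrier G \<Longrightarrow> y \<in> carrier G \<Longrightarrow> inv x \<otimes> (x \<otimes> y) = y"
  by (simp add: m_assoc[symmetric])

lemma cancel_inv_left: "x \<in> carrier G \<Longrightarrow> y \<in> carrier G \<Longrightarrow> x \<otimes> (inv x \<otimes> y) = y"
  by (simp add: m_assoc[symmetric])

lemmas group_word_simps = m_assoc inv_mult_group inv_cancel_left cancel_inv_left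

lemma gcomm_closed [simp]: "a \<in> carrier G \<Longrightarrow> b \<in> carrier G \<Longrightarrow> gcomm G a b \<in> carrier G"
  by (simp add: gcomm_def)

lemma gcomm_inv: "a \<in> carrier G \<Longrightarrow> b \<in> carrier G \<Longrightarrow> inv (gcomm G a b) = gcomm G b a"
  by (simp add: gcomm_def group_word_simps)

lemma gcomm_eq_one_iff:
  assumes "a \<in> carrier G" "b \<in> carrier G"
  shows "gcomm G a b = \<one> \<longleftrightarrow> a \<otimes> b = b \<otimes> a"
proof -
  have "gcomm G a b = (a \<otimes> b) \<otimes> inv (b \<otimes> a)" using assms by (simp add: gcomm_def group_word_simps)
  then show ?thesis using assms by (metis inv_equality inv_inv m_closed r_inv inv_closed)
qed

lemma subgroup_commutants:
  assumes "y \<in> carrier G"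
  shows "subgroup {x \<in> carrier G. x \<otimes> y = y \<otimes> x} G"
proof
  show "x \<otimes> x' \<in> {x \<in> carrier G. x \<otimes> y = y \<otimes> x}"
    if "x \<in> {x \<in> carrier G. x \<otimes> y = y \<otimes> x}" "x' \<in> {x \<in> carrier G. x \<otimes> y = y \<otimes> x}" for x x'
    using that assms by auto (metis m_assoc)
  show "inv x \<in> {x \<in> carrier G. x \<otimes> y = y \<otimes> x}"
    if "x \<in> {x \<in> carrier G. x \<otimes> y = y \<otimes> x}" for x
    using that assms by auto (metis inv_solve_left inv_solve_right m_assoc m_closed inv_closed)
qed (use assms in auto)

lemma commute_mult:
  assumes "x \<in> carrier G" "x' \<in> carrier G" "y \<in> carrier G" "x \<otimes> y = y \<otimes> x" "x' \<otimes> y = y \<otimes> x'"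
  shows "(x \<otimes> x') \<otimes> y = y \<otimes> (x \<otimes> x')"
  using assms by (metis m_assoc)

text \<open>Write \<open>c a = e a c\<close>, \<open>c b = f b c\<close> and
  \<open>a b = g b a\<close>. The hypotheses allow \<open>e\<close> and \<open>f\<close> to be
  pulled to the front, so moving \<open>c\<close> through \<open>a b\<close> and through
  \<open>b a\<close> produces the same factor \<open>e f\<close>, which commutes with
  \<open>g\<close>. Comparing the two results leaves \<open>c g = g c\<close>.\<close>

lemma commute_gcomm:
  assumes cl: "a \<in> carrier G" "b \<in> carrier G" "c \<in> carrier G"
    and "a \<otimes> gcomm G c b = gcomm G c b \<otimes> a"
    and "gcomm G c a \<otimes> b = b \<otimes> gcomm G c a"
    and "gcomm G c a \<otimes> gcomm G c b = gcomm G c b \<otimes> gcomm G c a"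
    and "gcomm G c a \<otimes> gcomm G a b = gcomm G a b \<otimes> gcomm G c a"
    and "gcomm G c b \<otimes> gcomm G a b = gcomm G a b \<otimes> gcomm G c b"
  shows "c \<otimes> gcomm G a b = gcomm G a b \<otimes> c"
proof -
  define e f g where "e = gcomm G c a" and "f = gcomm G c b" and "g = gcomm G a b"
  have [simp]: "e \<in> carrier G" "f \<in> carrier G" "g \<in> carrier G"
    using cl by (auto simp: e_def f_def g_def)
  note com = assms(4-8)[folded e_def f_def g_def]
  have ca: "c \<otimes> a = e \<otimes> a \<otimes> c" and cb: "c \<otimes> b = f \<otimes> b \<otimes> c" and ab: "a \<otimes> b = g \<otimes> b \<otimes> a"
    using cl by (simp_all add: e_def f_def g_def gcomm_def group_word_simps)
  have 1: "c \<otimes> g \<otimes> (b \<otimes> a) = c \<otimes> a \<otimes> b" using ab cl by (simp add: m_assoc)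
  have "c \<otimes> a \<otimes> b = e \<otimes> a \<otimes> (f \<otimes> b \<otimes> c)" using ca cb cl by (simp add: m_assoc)
  also have "\<dots> = e \<otimes> (a \<otimes> f) \<otimes> b \<otimes> c" using cl by (simp add: m_assoc)
  also have "\<dots> = e \<otimes> f \<otimes> (a \<otimes> b) \<otimes> c" using com(1) cl by (simp add: m_assoc)
  also have "\<dots> = (e \<otimes> f) \<otimes> g \<otimes> (b \<otimes> a) \<otimes> c" using ab cl by (simp add: m_assoc)
  also have "\<dots> = g \<otimes> (e \<otimes> f) \<otimes> (b \<otimes> a) \<otimes> c"
    using commute_mult[of e f g] com cl by simp
  finally have 2: "c \<otimes> g \<otimes> (b \<otimes> a) = g \<otimes> (e \<otimes> f \<otimes> (b \<otimes> a) \<otimes> c)"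
    using 1 cl by (simp add: m_assoc)
  have "c \<otimes> (b \<otimes> a) = f \<otimes> b \<otimes> (e \<otimes> a \<otimes> c)" using ca cb cl by (simp add: m_assoc[symmetric]) (simp add: m_assoc)
  also have "\<dots> = f \<otimes> (b \<otimes> e) \<otimes> a \<otimes> c" using cl by (simp add: m_assoc)
  also have "\<dots> = (f \<otimes> e) \<otimes> (b \<otimes> a) \<otimes> c" using com(2)[symmetric] cl by (simp add: m_assoc)
  also have "\<dots> = (e \<otimes> f) \<otimes> (b \<otimes> a) \<otimes> c" using com(3) by simp
  finally have "c \<otimes> g \<otimes> (b \<otimes> a) = g \<otimes> c \<otimes> (b \<otimes> a)"
    using 2 cl by (simp add: m_assoc)
  then show ?thesis using cl by (simp add: g_def[symmetric])
qed

lemma coset_eq_one_iff: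
  assumes "K \<lhd> G" "x \<in> carrier G"
  shows "K #> x = K \<longleftrightarrow> x \<in> K"
  using assms by (meson coset_join1 coset_join2 normal_imp_subgroup subgroup.subset)

text \<open>Turns exact commutation statements into statements modulo \<open>K\<close>: a lemma
  about commuting elements is applied in the quotient and then read back as membership in
  \<open>K\<close>.\<close>

lemma gcomm_in_normal_iff:
  assumes "K \<lhd> G" "x \<in> carrier G" "y \<in> carrier G"
  shows "gcomm G x y \<in> K \<longleftrightarrow> (K #> x) \<otimes>\<^bsub>G Mod K\<^esub> (K #> y) = (K #> y) \<otimes>\<^bsub>G Mod K\<^esub> (K #> x)"
proof -
  interpret K: normal K G by fact
  interpret Q: group "G Mod K" by (rule K.factorgroup_is_group)
  interpret q: group_hom G "G Mod K" "\<lambda>x. K #> x"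
    by (rule group_hom.intro) (auto simp: group_hom_axioms_def K.r_coset_hom_Mod is_group K.factorgroup_is_group)
  have "K #> gcomm G x y = gcomm (G Mod K) (K #> x) (K #> y)"
    unfolding gcomm_def using assms q.hom_mult q.hom_inv by (metis inv_closed m_closed)
  moreover have "gcomm G x y \<in> K \<longleftrightarrow> K #> gcomm G x y = \<one>\<^bsub>G Mod K\<^esub>"
    using coset_eq_one_iff[OF assms(1), of "gcomm G x y"] assms by simp
  ultimately show ?thesis
    using Q.gcomm_eq_one_iff[of "K #> x" "K #> y"] assms q.hom_closed by simp
qed

lemma gcomm_in_normal_commute:
  assumes "K \<lhd> G" "x \<in> carrier G" "y \<in> carrier G" "gcomm G x y \<in> K"
  shows "gcomm G y x \<in> K"
  using gcomm_in_normal_iff assms by metis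

text \<open>The device for passing from generators to a whole subgroup: a commutator estimate
  against a fixed \<open>y\<close> only has to be checked on generators.\<close>

lemma subgroup_commutants_mod:
  assumes "K \<lhd> G" "y \<in> carrier G"
  shows "subgroup {x \<in> carrier G. gcomm G x y \<in> K} G"
proof -
  interpret K: normal K G by fact
  interpret Q: group "G Mod K" by (rule K.factorgroup_is_group)
  interpret q: group_hom G "G Mod K" "\<lambda>x. K #> x"
    by (rule group_hom.intro) (auto simp: group_hom_axioms_def K.r_coset_hom_Mod is_group K.factorgroup_is_group)
  have y: "K #> y \<in> carrier (G Mod K)" using assms by simp
  note sg = Q.subgroup_commutants[OF y]
  have eq: "{x \<in> carrier G. gcomm G x y \<in> K} =
     {x \<in> carrier G. K #> x \<in> {x \<in> carrier (G Mod K). x \<otimes>\<^bsub>G Mod K\<^esub> (K #> y) = (K #> y) \<otimes>\<^bsub>G Mod K\<^esub> x}}"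
    using gcomm_in_normal_iff assms q.hom_closed by auto
  show ?thesis unfolding eq by (rule q.subgroup_vimage[OF sg])
qed

text \<open>\<open>gcomm G c\<close> acts as a derivation on commutators, up to the listed commutators of higher weight.\<close>

lemma gcomm_gcomm_in_normal:
  assumes K: "K \<lhd> G" and cl: "a \<in> carrier G" "b \<in> carrier G" "c \<in> carrier G"
    and "gcomm G a (gcomm G c b) \<in> K"
    and "gcomm G (gcomm G c a) b \<in> K"
    and "gcomm G (gcomm G c a) (gcomm G c b) \<in> K"
    and "gcomm G (gcomm G c a) (gcomm G a b) \<in> K"
    and "gcomm G (gcomm G c b) (gcomm G a b) \<in> K"
  shows "gcomm G c (gcomm G a b) \<in> K"
proof -
  interpret K: normal K G by fact
  interpret Q: group "G Mod K" by (rule K.factorgroup_is_group)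
  interpret q: group_hom G "G Mod K" "\<lambda>x. K #> x"
    by (rule group_hom.intro) (auto simp: group_hom_axioms_def K.r_coset_hom_Mod is_group K.factorgroup_is_group)
  have c: "K #> gcomm G x y = gcomm (G Mod K) (K #> x) (K #> y)"
    if "x \<in> carrier G" "y \<in> carrier G" for x y
    unfolding gcomm_def using that q.hom_mult q.hom_inv by (metis inv_closed m_closed)
  have "(K #> c) \<otimes>\<^bsub>G Mod K\<^esub> gcomm (G Mod K) (K #> a) (K #> b) =
      gcomm (G Mod K) (K #> a) (K #> b) \<otimes>\<^bsub>G Mod K\<^esub> (K #> c)"
    by (rule Q.commute_gcomm[OF q.hom_closed[OF cl(1)] q.hom_closed[OF cl(2)] q.hom_closed[OF cl(3)]
        assms(5-9)[unfolded gcomm_in_normal_iff[OF K cl(1) gcomm_closed[OF cl(3,2)]]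
          gcomm_in_normal_iff[OF K gcomm_closed[OF cl(3,1)] cl(2)]
          gcomm_in_normal_iff[OF K gcomm_closed[OF cl(3,1)] gcomm_closed[OF cl(3,2)]]
          gcomm_in_normal_iff[OF K gcomm_closed[OF cl(3,1)] gcomm_closed[OF cl(1,2)]]
          gcomm_in_normal_iff[OF K gcomm_closed[OF cl(3,2)] gcomm_closed[OF cl(1,2)]]
          c[OF cl(3,1)] c[OF cl(3,2)] c[OF cl(1,2)]]])
  then show ?thesis unfolding gcomm_in_normal_iff[OF K cl(3) gcomm_closed[OF cl(1,2)]] c[OF cl(1,2)] .
qed

section \<open>The lower central series and its commutator estimates\<close>

lemma Gam_Suc: "0 < p \<Longrightarrow> Gam G (Suc p) = comm_sub G (carrier G) (Gam G p)"
  by (cases p) auto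

lemma comm_sub_eq: "comm_sub G A B = generate G {gcomm G a b | a b. a \<in> A \<and> b \<in> B}"
  by (simp add: comm_sub_def gcomm_def)

text \<open>The three claims are proved jointly: normality of one term makes the generators of the
  next invariant under conjugation, and the inclusion at one level gives the inclusion of generating
  sets at the next.\<close>

lemma Gam_subgroup_subset: "subgroup (Gam G p) G \<and> Gam G (Suc p) \<subseteq> Gam G p \<and> Gam G p \<lhd> G"
proof (induction p rule: less_induct)
  case (less p)
  consider "p = 0" | "p = 1" | q where "p = Suc (Suc q)" by (metis One_nat_def old.nat.exhaust)
  then show ?case
  proof cases
    case 1
    then show ?thesis by (auto simp: subgroup_self normal_inv_iff)
  next
    case 2
    have "generate G {gcomm G a b | a b. a \<in> carrier G \<and> b \<in> carrier G} \<subseteq> carrier G"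
      by (rule generate_incl) auto
    then show ?thesis using 2 by (auto simp: subgroup_self normal_inv_iff comm_sub_eq)
  next
    case 3
    note IH = less[of "Suc q", unfolded 3]
    from IH have sub: "Gam G (Suc q) \<subseteq> carrier G" by (auto dest: subgroup.subset)
    let ?X = "{gcomm G a b | a b. a \<in> carrier G \<and> b \<in> Gam G (Suc q)}"
    let ?Y = "{gcomm G a b | a b. a \<in> carrier G \<and> b \<in> Gam G (Suc (Suc q))}"
    have X: "?X \<subseteq> carrier G" using sub by auto
    have p: "Gam G p = generate G ?X" using 3 by (simp add: comm_sub_eq)
    have sg: "subgroup (Gam G p) G" unfolding p by (rule generate_is_subgroup[OF X])
    have "Gam G (Suc p) = generate G ?Y" using 3 by (simp add: comm_sub_eq)
    moreover have "?Y \<subseteq> ?X" using IH 3 by auto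
    ultimately have 1: "Gam G (Suc p) \<subseteq> Gam G p" using p mono_generate[of ?Y ?X] by simp
    have "Gam G p \<lhd> G" unfolding p
    proof (rule normal_generateI[OF X])
      fix h g assume "h \<in> ?X" and g: "g \<in> carrier G"
      then obtain a b where ab: "h = gcomm G a b" "a \<in> carrier G" "b \<in> Gam G (Suc q)" by auto
      have b: "b \<in> carrier G" using sub ab by auto
      have "g \<otimes> h \<otimes> inv g = gcomm G (g \<otimes> a \<otimes> inv g) (g \<otimes> b \<otimes> inv g)"
        using ab g b by (simp add: gcomm_def group_word_simps)
      moreover have "g \<otimes> b \<otimes> inv g \<in> Gam G (Suc q)"
        using IH g ab(3) 3 by (auto simp: normal_inv_iff)
      ultimately show "g \<otimes> h \<otimes> inv g \<in> ?X" using g ab by blast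
    qed
    with sg 1 show ?thesis by simp
  qed
qed

lemma Gam_normal: "Gam G p \<lhd> G" and Gam_subgroup: "subgroup (Gam G p) G"
  and Gam_Suc_subset: "Gam G (Suc p) \<subseteq> Gam G p"
  using Gam_subgroup_subset by auto

lemma Gam_carrier [simp]: "x \<in> Gam G p \<Longrightarrow> x \<in> carrier G"
  using Gam_subgroup subgroup.mem_carrier by metis

lemma Gam_antimono: "p \<le> q \<Longrightarrow> Gam G q \<subseteq> Gam G p"
  by (induction q rule: dec_induct) (use Gam_Suc_subset in auto)

lemma gcomm_Gam_Suc:
  assumes "x \<in> carrier G" "y \<in> Gam G p" "0 < p"
  shows "gcomm G x y \<in> Gam G (Suc p)" "gcomm G y x \<in> Gam G (Suc p)"
proof -
  show *: "gcomm G x y \<in> Gam G (Suc p)"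
    unfolding Gam_Suc[OF assms(3)] comm_sub_eq by (rule generate.incl) (use assms in blast)
  show "gcomm G y x \<in> Gam G (Suc p)"
    by (rule gcomm_in_normal_commute[OF Gam_normal _ _ *]) (use assms in auto)
qed

text \<open>A three-subgroup argument by induction on \<open>p\<close> with \<open>q\<close> free.
  For a generator \<open>[a, b]\<close> of the next term, bracketing with \<open>y\<close> gives
  \<open>[y, b]\<close> of weight \<open>p + q\<close> by induction and \<open>[y, a]\<close> of
  weight \<open>q + 1\<close>; the latter is bracketed with \<open>b\<close> by the induction
  hypothesis at \<open>q + 1\<close>.\<close>

lemma gcomm_Gam:
  assumes "x \<in> Gam G p" "y \<in> Gam G q" "0 < p" "0 < q"
  shows "gcomm G x y \<in> Gam G (p + q)"
  using assms(3,1,2,4)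
proof (induction p arbitrary: x y q rule: nat_induct_non_zero)
  case 1
  then show ?case using gcomm_Gam_Suc[of x y q] by simp
next
  case (Suc p)
  let ?K = "Gam G (Suc p + q)"
  let ?X = "{gcomm G a b | a b. a \<in> carrier G \<and> b \<in> Gam G p}"
  have y: "y \<in> carrier G" using Suc.prems by auto
  have "?X \<subseteq> {x \<in> carrier G. gcomm G x y \<in> ?K}"
  proof
    fix z assume "z \<in> ?X"
    then obtain a b where ab: "z = gcomm G a b" "a \<in> carrier G" "b \<in> Gam G p" by auto
    have b: "b \<in> carrier G" using ab by auto
    have f: "gcomm G y b \<in> Gam G (p + q)"
      using gcomm_in_normal_commute[OF Gam_normal b y] Suc.IH[OF ab(3) Suc.prems(2,3)] by simp
    have e: "gcomm G y a \<in> Gam G (Suc q)" using gcomm_Gam_Suc[OF ab(2) Suc.prems(2,3)] by simp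
    have g: "gcomm G a b \<in> Gam G p"
      using gcomm_Gam_Suc(1)[OF ab(2,3) Suc.hyps] Gam_Suc_subset by auto
    have "gcomm G y (gcomm G a b) \<in> ?K"
    proof (rule gcomm_gcomm_in_normal[OF Gam_normal ab(2) b y])
      show "gcomm G a (gcomm G y b) \<in> ?K"
        using gcomm_Gam_Suc(1)[OF ab(2) f] Suc.hyps by simp
      show "gcomm G (gcomm G y a) b \<in> ?K"
        using gcomm_in_normal_commute[OF Gam_normal b _ Suc.IH[OF ab(3) e]] ab(2) y by simp
      show "gcomm G (gcomm G y a) (gcomm G y b) \<in> ?K"
        using gcomm_Gam_Suc(1)[OF _ f] ab(2) y Suc.hyps by simp
      show "gcomm G (gcomm G y a) (gcomm G a b) \<in> ?K"
        using gcomm_in_normal_commute[OF Gam_normal _ _ Suc.IH[OF g e]] ab(2) y b by simp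
      show "gcomm G (gcomm G y b) (gcomm G a b) \<in> ?K"
        using gcomm_Gam_Suc(2)[OF _ f] ab(2) b Suc.hyps by simp
    qed
    then have "gcomm G z y \<in> ?K"
      using gcomm_in_normal_commute[OF Gam_normal y] ab b by simp
    then show "z \<in> {x \<in> carrier G. gcomm G x y \<in> ?K}" using ab b by simp
  qed
  from generate_subgroup_incl[OF this subgroup_commutants_mod[OF Gam_normal y]] Suc.prems(1)
  show ?case unfolding Gam_Suc[OF Suc.hyps] comm_sub_eq by blast
qed

text \<open>The Jacobi identity as an implication: when two of the three double brackets lie in
  \<open>K\<close>, so does the third. The error terms pair two commutators sharing one of the
  entries, so their weight exceeds \<open>p + q + r\<close> and they are absorbed by
  \<open>K\<close>.\<close>

lemma gcomm_jacobi_mod: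
  assumes K: "K \<lhd> G" and sub: "Gam G (Suc (p + q + r)) \<subseteq> K"
    and a: "a \<in> Gam G p" "0 < p" and b: "b \<in> Gam G q" "0 < q" and c: "c \<in> Gam G r" "0 < r"
    and 1: "gcomm G a (gcomm G b c) \<in> K" and 2: "gcomm G (gcomm G a c) b \<in> K"
  shows "gcomm G (gcomm G a b) c \<in> K"
proof -
  have cl: "a \<in> carrier G" "b \<in> carrier G" "c \<in> carrier G" using a b c by auto
  have e: "gcomm G c a \<in> Gam G (r + p)" and f: "gcomm G c b \<in> Gam G (r + q)"
    and g: "gcomm G a b \<in> Gam G (p + q)" by (rule gcomm_Gam; use assms in auto)+
  have sub': "Gam G s \<subseteq> K" if "s \<ge> Suc (p + q + r)" for s using sub that Gam_antimono by blast
  have "gcomm G c (gcomm G a b) \<in> K"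
  proof (rule gcomm_gcomm_in_normal[OF K cl])
    have "inv (gcomm G b c) \<in> {x \<in> carrier G. gcomm G x a \<in> K}"
      by (rule subgroup.m_inv_closed[OF subgroup_commutants_mod[OF K cl(1)]])
        (use gcomm_in_normal_commute[OF K _ _ 1] cl in auto)
    then show "gcomm G a (gcomm G c b) \<in> K"
      using gcomm_in_normal_commute[OF K, of "gcomm G c b" a] cl gcomm_inv by auto
    have "inv (gcomm G a c) \<in> {x \<in> carrier G. gcomm G x b \<in> K}"
      by (rule subgroup.m_inv_closed[OF subgroup_commutants_mod[OF K cl(2)]]) (use 2 cl in auto)
    then show "gcomm G (gcomm G c a) b \<in> K" using cl gcomm_inv by auto
    show "gcomm G (gcomm G c a) (gcomm G c b) \<in> K"
      using gcomm_Gam[OF e f] sub'[of "r + p + (r + q)"] a b c by auto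
    show "gcomm G (gcomm G c a) (gcomm G a b) \<in> K"
      using gcomm_Gam[OF e g] sub'[of "r + p + (p + q)"] a b c by auto
    show "gcomm G (gcomm G c b) (gcomm G a b) \<in> K"
      using gcomm_Gam[OF f g] sub'[of "r + q + (p + q)"] a b c by auto
  qed
  then show ?thesis using gcomm_in_normal_commute[OF K] cl by simp
qed

end

section \<open>Lyndon commutators generate the graded quotients\<close>

context group
begin

text \<open>The preimage in \<open>G\<close> of the subgroup generated by \<open>B\<close> modulo
  the next term of the series. It plays the part of an integer span in degree \<open>N\<close>
  without leaving \<open>G\<close>.\<close>

definition gspan :: "nat \<Rightarrow> 'a set \<Rightarrow> 'a set" where
  "gspan N B = generate G (B \<union> Gam G (Suc N))"

lemma gspan_subgroup: "B \<subseteq> carrier G \<Longrightarrow> subgroup (gspan N B) G"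
  unfolding gspan_def by (rule generate_is_subgroup) auto

lemma gspan_mono: "B \<subseteq> Y \<Longrightarrow> gspan N B \<subseteq> gspan N Y"
  unfolding gspan_def by (rule mono_generate) auto

lemma gspan_incl: "x \<in> B \<Longrightarrow> x \<in> gspan N B"
  unfolding gspan_def by (rule generate.incl) auto

lemma Gam_subset_gspan: "Gam G (Suc N) \<subseteq> gspan N B"
  unfolding gspan_def by (auto intro: generate.incl)

text \<open>Conjugating an element of weight \<open>N\<close> changes it only by a commutator of
  weight \<open>N + 1\<close>, which is in the span by construction.\<close>

lemma gspan_normal:
  assumes B: "B \<subseteq> Gam G N" and N: "0 < N"
  shows "gspan N B \<lhd> G"
  unfolding normal_inv_iff
proof (intro conjI ballI)
  have Xc: "B \<subseteq> carrier G" using B by auto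
  show sg: "subgroup (gspan N B) G" by (rule gspan_subgroup[OF Xc])
  fix x h assume x: "x \<in> carrier G" and h: "h \<in> gspan N B"
  have "gspan N B \<subseteq> Gam G N"
    unfolding gspan_def using B Gam_Suc_subset by (intro generate_subgroup_incl Gam_subgroup) auto
  then have hN: "h \<in> Gam G N" using h by auto
  have "gcomm G x h \<in> gspan N B" using gcomm_Gam_Suc(1)[OF x hN N] Gam_subset_gspan by auto
  then have "gcomm G x h \<otimes> h \<in> gspan N B" using subgroup.m_closed[OF sg _ h] by auto
  also have "gcomm G x h \<otimes> h = x \<otimes> h \<otimes> inv x"
    using x hN by (simp add: gcomm_def group_word_simps)
  finally show "x \<otimes> h \<otimes> inv x \<in> gspan N B" .
qed

text \<open>Linearity of the bracket in its first argument: the tail of weight \<open>N + 1\<close>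
  contributes only weight \<open>N + 1 + q\<close>, which \<open>K\<close> contains.\<close>

lemma gcomm_gspan_left:
  assumes K: "K \<lhd> G" "Gam G (Suc (N + q)) \<subseteq> K" and y: "y \<in> Gam G q" "0 < q"
    and B: "B \<subseteq> carrier G" "\<And>z. z \<in> B \<Longrightarrow> gcomm G z y \<in> K" and x: "x \<in> gspan N B"
  shows "gcomm G x y \<in> K"
proof -
  have yc: "y \<in> carrier G" using y by auto
  have "B \<union> Gam G (Suc N) \<subseteq> {x \<in> carrier G. gcomm G x y \<in> K}"
    using B gcomm_Gam[OF _ y(1), of _ "Suc N"] y(2) K(2) by auto
  from generate_subgroup_incl[OF this subgroup_commutants_mod[OF K(1) yc]] x
  show ?thesis unfolding gspan_def by blast
qed

lemma lbr_gcomm_Gam: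
  assumes "lyndon w" "g ` set w \<subseteq> carrier G"
  shows "lbr (gcomm G) g w \<in> Gam G (length w)"
  using assms
proof (induction rule: lyndon_induct)
  case (append u v)
  then have "u \<noteq> []" "v \<noteq> []" using lyndon_not_Nil by auto
  with append show ?case by (simp add: lbr_split gcomm_Gam image_Un)
qed simp

text \<open>If \<open>u = u' u''\<close> is the standard factorisation and \<open>u'' < v\<close>, the Jacobi identity rewrites
  \<open>[[u', u''], v]\<close> into brackets whose larger entry is below \<open>v\<close>; the bounds on \<open>w\<close> are what keeps
  this induction going.\<close>

lemma gcomm_lbr_gspan:
  assumes "finite S" and g: "g ` S \<subseteq> carrier G"
    and "lyndon u" "lyndon v" "u < v" "set u \<subseteq> S" "set v \<subseteq> S"
  shows "gcomm G (lbr (gcomm G) g u) (lbr (gcomm G) g v) \<in> gspan (length u + length v)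
    (lbr (gcomm G) g ` {w. lyndon w \<and> length w = length u + length v \<and> set w \<subseteq> S \<and> u @ v \<le> w \<and> w < v})"
  using assms(3-7)
proof (induction "length u + length v" arbitrary: u v rule: less_induct)
  case (less u0 v0)
  define N where "N = length u0 + length v0"
  define B where "B u v = {w. lyndon w \<and> length w = length u + length v \<and> set w \<subseteq> S \<and> u @ v \<le> w \<and> w < v}"
    for u v
  let ?c = "lbr (gcomm G) g"
  note IH1 = less(1)[folded N_def B_def]
  have cGam: "?c w \<in> Gam G (length w)" if "lyndon w" "set w \<subseteq> S" for w
    using lbr_gcomm_Gam[OF that(1)] that(2) g by auto
  have len: "0 < length w" if "lyndon w" for w using lyndon_not_Nil[OF that] by simp
  have BG: "?c ` B u v \<subseteq> Gam G (length u + length v)" for u v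
    unfolding B_def using cGam by force
  have BC: "?c ` B u v \<subseteq> carrier G" for u v using BG Gam_carrier by blast
  have main: "gcomm G (?c u) (?c v) \<in> gspan N (?c ` B u v)"
    if "N = length u + length v" "lyndon u" "lyndon v" "u < v" "set u \<subseteq> S" "set v \<subseteq> S" for u v
    using that
  \<comment> \<open>The outer induction is on the total weight; within one weight the induction is
    on \<open>v\<close>. The lexicographic order on all words is not well-founded, hence the count
    of words below \<open>v\<close> over the finite alphabet \<open>S\<close> with length at most
    \<open>N\<close>.\<close>
  proof (induction "card {x. set x \<subseteq> S \<and> length x \<le> N \<and> x < v}" arbitrary: u v rule: less_induct)
    case (less v u)
    have fin: "finite {x. set x \<subseteq> S \<and> length x \<le> N \<and> x < y}" for y
      by (rule finite_subset[OF _ finite_lists_length_le[OF assms(1), of N]]) auto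
    have IH2: "gcomm G (?c u') (?c v') \<in> gspan N (?c ` B u' v')"
      if "v' < v" "N = length u' + length v'" "lyndon u'" "lyndon v'" "u' < v'" "set u' \<subseteq> S" "set v' \<subseteq> S"
      for u' v'
    proof -
      have "v' \<in> {x. set x \<subseteq> S \<and> length x \<le> N \<and> x < v}" using that by auto
      moreover have "v' \<notin> {x. set x \<subseteq> S \<and> length x \<le> N \<and> x < v'}" by auto
      moreover have "{x. set x \<subseteq> S \<and> length x \<le> N \<and> x < v'} \<subseteq> {x. set x \<subseteq> S \<and> length x \<le> N \<and> x < v}"
        using that(1) by auto
      ultimately have "{x. set x \<subseteq> S \<and> length x \<le> N \<and> x < v'} \<subset> {x. set x \<subseteq> S \<and> length x \<le> N \<and> x < v}"
        by blast
      from psubset_card_mono[OF fin this] show ?thesis by (rule less(1)[OF _ that(2-7)])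
    qed
    let ?K = "gspan N (?c ` B u v)"
    have K: "?K \<lhd> G" using gspan_normal[OF BG[of u v]] len less.prems by simp
    show ?case
    proof (cases "length u = 1 \<or> v \<le> drop (std_split u) u")
      case True
      \<comment> \<open>Here \<open>u @ v\<close> is in standard form, so the commutator is itself
        one of the listed generators.\<close>
      have "u @ v \<in> B u v"
        unfolding B_def using less.prems lyndon_append lyndon_append_less by auto
      then show ?thesis
        using lbr_append[OF less.prems(2-4) True] by (metis gspan_incl image_eqI)
    next
      case False
      define u1 u2 where "u1 = take (std_split u) u" and "u2 = drop (std_split u) u"
      have u: "u = u1 @ u2" by (simp add: u1_def u2_def)
      have lu: "2 \<le> length u" using False less.prems len[of u] by linarith
      note sl = std_split_lyndon[OF less.prems(2) lu, folded u1_def u2_def]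
      note spp = std_split_props[OF lu]
      have ne: "u1 \<noteq> []" "u2 \<noteq> []" using sl lyndon_not_Nil by auto
      have su: "std_split u = length u1" using spp by (simp add: u1_def)
      have cu: "?c u = gcomm G (?c u1) (?c u2)"
        by (rule lbr_split[of u1 u2 "gcomm G" g, folded u, OF su ne])
      have u2v: "u2 < v" using False by (auto simp: u2_def not_le)
      have sets: "set u1 \<subseteq> S" "set u2 \<subseteq> S" using less.prems u by auto
      have uu2: "u < u2" using lyndon_suffix[of u1 u2] less.prems u ne by auto
      note len' = len[OF sl(1)] len[OF sl(2)] len[OF less.prems(3)]
      have G1: "?c u1 \<in> Gam G (length u1)" and G2: "?c u2 \<in> Gam G (length u2)"
        and Gv: "?c v \<in> Gam G (length v)"
        using cGam sl less.prems sets by auto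
      have NN: "N = length u1 + length u2 + length v" using less.prems(1) u by simp
      have lt: "length u1 + length v < N" "length u2 + length v < N" using NN len' by linarith+
      show ?thesis unfolding cu
      proof (rule gcomm_jacobi_mod[OF K _ G1 len'(1) G2 len'(2) Gv len'(3)])
        show "Gam G (Suc (length u1 + length u2 + length v)) \<subseteq> ?K"
          using Gam_subset_gspan NN by simp
        \<comment> \<open>This bracket has smaller weight, so the outer hypothesis spreads it over
          words \<open>w\<close> with \<open>u2 @ v \<le> w < v\<close>. Since
          \<open>u1 < u2 \<le> w\<close>, the inner hypothesis then applies to the pair
          \<open>u1\<close>, \<open>w\<close>.\<close>
        have "gcomm G (?c u2) (?c v) \<in> gspan (length u2 + length v) (?c ` B u2 v)"
          by (rule IH1[OF lt(2)]) (use sl(2) less.prems sets u2v in simp_all)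
        then have "gcomm G (gcomm G (?c u2) (?c v)) (?c u1) \<in> ?K"
        proof (rule gcomm_gspan_left[OF K _ G1 len'(1) BC, rotated -1])
          show "Gam G (Suc (length u2 + length v + length u1)) \<subseteq> ?K"
            using Gam_subset_gspan NN by (simp add: ac_simps)
          fix z assume "z \<in> ?c ` B u2 v"
          then obtain w where z: "z = ?c w" and w: "lyndon w" "length w = length u2 + length v"
              "set w \<subseteq> S" "u2 @ v \<le> w" "w < v" by (auto simp: B_def)
          have "u2 \<le> w" using lex_le_append[of u2 v] w(4) by simp
          then have u1w: "u1 < w" using sl(3) by simp
          have "gcomm G (?c u1) (?c w) \<in> gspan N (?c ` B u1 w)"
            by (rule IH2) (use w sl(1-3) sets NN u1w in auto)
          moreover have "B u1 w \<subseteq> B u v"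
          proof -
            have "u1 @ (u2 @ v) \<le> u1 @ w" using w(4) lex_append_left[of u1] by (metis order_le_less)
            then show ?thesis using w(2,5) u by (auto simp: B_def)
          qed
          ultimately have "gcomm G (?c u1) (?c w) \<in> ?K" using gspan_mono[of "?c ` B u1 w" "?c ` B u v"] by blast
          then show "gcomm G z (?c u1) \<in> ?K"
            unfolding z using gcomm_in_normal_commute[OF K] G1 cGam[OF w(1,3)] Gam_carrier by blast
        qed
        then show "gcomm G (?c u1) (gcomm G (?c u2) (?c v)) \<in> ?K"
          using gcomm_in_normal_commute[OF K] G1 G2 Gv by (meson Gam_carrier gcomm_closed)
        have u1v: "u1 < v" using sl(3) u2v by simp
        have "gcomm G (?c u1) (?c v) \<in> gspan (length u1 + length v) (?c ` B u1 v)"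
          by (rule IH1[OF lt(1)]) (use sl(1) less.prems sets u1v in simp_all)
        then show "gcomm G (gcomm G (?c u1) (?c v)) (?c u2) \<in> ?K"
        proof (rule gcomm_gspan_left[OF K _ G2 len'(2) BC, rotated -1])
          show "Gam G (Suc (length u1 + length v + length u2)) \<subseteq> ?K"
            using Gam_subset_gspan NN by (simp add: ac_simps)
          fix z assume "z \<in> ?c ` B u1 v"
          then obtain w where z: "z = ?c w" and w: "lyndon w" "length w = length u1 + length v"
              "set w \<subseteq> S" "u1 @ v \<le> w" "w < v" by (auto simp: B_def)
          have cw: "?c w \<in> carrier G" "?c u2 \<in> carrier G" using cGam[OF w(1,3)] G2 Gam_carrier by blast+
          \<comment> \<open>Here \<open>w\<close> may fall on either side of \<open>u2\<close>, so
            the bracket may have to be reversed. In both orders the larger word is below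
            \<open>v\<close>, and the concatenation is still at least \<open>u @ v\<close>.\<close>
          consider "w = u2" | "w < u2" | "u2 < w" by force
          then show "gcomm G z (?c u2) \<in> ?K"
          proof cases
            case 1
            then have "gcomm G z (?c u2) = \<one>" using z cw gcomm_eq_one_iff by simp
            then show ?thesis using subgroup.one_closed[OF normal_imp_subgroup[OF K]] by simp
          next
            case 2
            have "gcomm G (?c w) (?c u2) \<in> gspan N (?c ` B w u2)"
              by (rule IH2) (use w sl(1-3) sets NN 2 u2v in auto)
            moreover have "B w u2 \<subseteq> B u v"
            proof -
              have "u2 @ v < v" by (rule lyndon_append_less[OF sl(2) less.prems(3) u2v])
              also have "v \<le> v @ u2" by (rule lex_le_append)
              finally have "u1 @ (u2 @ v) < u1 @ (v @ u2)" by (simp only: lex_append_left)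
              also have "u1 @ (v @ u2) \<le> w @ u2"
              proof (cases "u1 @ v = w")
                case True
                then show ?thesis by auto
              next
                case False
                then have "u1 @ v < w" using w(4) by simp
                then show ?thesis using lex_append_mono_length[of "u1 @ v" w u2 u2] w(2) by simp
              qed
              finally show ?thesis using w(2) u u2v by (auto simp: B_def)
            qed
            ultimately show ?thesis using z gspan_mono[of "?c ` B w u2" "?c ` B u v"] by blast
          next
            case 3
            have "gcomm G (?c u2) (?c w) \<in> gspan N (?c ` B u2 w)"
              by (rule IH2) (use w sl(1-3) sets NN 3 in auto)
            moreover have "B u2 w \<subseteq> B u v"
            proof -
              have "u @ v < u2 @ w" using lex_append_mono_length[OF uu2] u by simp
              then show ?thesis using w(2,5) u by (auto simp: B_def)
            qed
            ultimately have "gcomm G (?c u2) (?c w) \<in> ?K"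
              using gspan_mono[of "?c ` B u2 w" "?c ` B u v"] by blast
            then show ?thesis unfolding z using gcomm_in_normal_commute[OF K cw(2,1)] by simp
          qed
        qed
      qed
    qed
  qed
  from main[of u0 v0] less.prems show ?case by (simp add: N_def B_def)
qed

lemma commute_lbr_gcomm:
  assumes "lyndon w" "x \<in> carrier G" "g ` set w \<subseteq> carrier G"
    and "\<And>a. a \<in> set w \<Longrightarrow> g a \<otimes> x = x \<otimes> g a"
  shows "lbr (gcomm G) g w \<otimes> x = x \<otimes> lbr (gcomm G) g w"
  using assms
proof (induction rule: lyndon_induct)
  case (append u v)
  have ne: "u \<noteq> []" "v \<noteq> []" using append.hyps(1,2) lyndon_not_Nil by auto
  let ?Z = "{y \<in> carrier G. y \<otimes> x = x \<otimes> y}"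
  have Z: "subgroup ?Z G" by (rule subgroup_commutants) fact
  have "lbr (gcomm G) g u \<in> ?Z" "lbr (gcomm G) g v \<in> ?Z"
    using append lbr_gcomm_Gam[OF append(1), of g] lbr_gcomm_Gam[OF append(2), of g] by (auto simp: image_Un)
  then have "gcomm G (lbr (gcomm G) g u) (lbr (gcomm G) g v) \<in> ?Z"
    unfolding gcomm_def by (intro subgroup.m_closed[OF Z] subgroup.m_inv_closed[OF Z])
  then show ?case using append ne by (simp add: lbr_split)
qed simp

text \<open>Models a product of groups indexed by \<open>M\<close>, each generated by letters from
  \<open>S\<close>. Raising the weight brackets one generator with a Lyndon commutator: for distinct
  indices the bracket is trivial, and for equal ones it is the rewriting lemma with a one-letter
  word.\<close>

lemma Gam_subset_gspan_lbr:
  assumes fin: "finite S" and g: "\<And>m a. m \<in> M \<Longrightarrow> a \<in> S \<Longrightarrow> g m a \<in> carrier G"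
    and gen: "carrier G = generate G {g m a | m a. m \<in> M \<and> a \<in> S}"
    and comm: "\<And>m m' a b. m \<in> M \<Longrightarrow> m' \<in> M \<Longrightarrow> m \<noteq> m' \<Longrightarrow> a \<in> S \<Longrightarrow> b \<in> S
        \<Longrightarrow> g m a \<otimes> g m' b = g m' b \<otimes> g m a"
    and s: "0 < s"
  shows "Gam G s \<subseteq> gspan s {lbr (gcomm G) (g m) w | m w. m \<in> M \<and> lyndon w \<and> length w = s \<and> set w \<subseteq> S}"
  using s
proof (induction s rule: nat_induct_non_zero)
  case 1
  have "carrier G \<subseteq> gspan 1 {lbr (gcomm G) (g m) w | m w. m \<in> M \<and> lyndon w \<and> length w = 1 \<and> set w \<subseteq> S}"
    unfolding gen gspan_def
  proof (rule mono_generate, rule subsetI)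
    fix x assume "x \<in> {g m a | m a. m \<in> M \<and> a \<in> S}"
    then obtain m a where "x = g m a" "m \<in> M" "a \<in> S" by blast
    then have "x = lbr (gcomm G) (g m) [a]" "m \<in> M" "lyndon [a]" "length [a] = 1" "set [a] \<subseteq> S" by auto
    then show "x \<in> {lbr (gcomm G) (g m) w | m w. m \<in> M \<and> lyndon w \<and> length w = 1 \<and> set w \<subseteq> S}
      \<union> Gam G (Suc 1)" by blast
  qed
  then show ?case by simp
next
  case (Suc s)
  define B where "B s = {lbr (gcomm G) (g m) w | m w. m \<in> M \<and> lyndon w \<and> length w = s \<and> set w \<subseteq> S}" for s
  have XG: "B t \<subseteq> Gam G t" for t
    unfolding B_def using g by (auto intro!: lbr_gcomm_Gam)
  then have XC: "B t \<subseteq> carrier G" for t by (meson Gam_carrier subset_iff)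
  let ?K = "gspan (Suc s) (B (Suc s))"
  have K: "?K \<lhd> G" by (rule gspan_normal[OF XG]) simp
  note KS = normal_imp_subgroup[OF K]
  have step: "gcomm G (g m a) (lbr (gcomm G) (g m') w) \<in> ?K"
    if "m \<in> M" "a \<in> S" "m' \<in> M" "lyndon w" "length w = s" "set w \<subseteq> S" for m a m' w
  proof -
    have wc: "lbr (gcomm G) (g m') w \<in> carrier G"
      by (rule Gam_carrier[OF lbr_gcomm_Gam[OF that(4)]]) (use that g in auto)
    have ac: "g m a \<in> carrier G" using that g by simp
    show ?thesis
    proof (cases "m = m'")
      case False
      have "lbr (gcomm G) (g m') w \<otimes> g m a = g m a \<otimes> lbr (gcomm G) (g m') w"
        by (rule commute_lbr_gcomm[OF that(4)]) (use that g comm False in auto)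
      then have "gcomm G (g m a) (lbr (gcomm G) (g m') w) = \<one>"
        using gcomm_eq_one_iff[OF ac wc] by simp
      then show ?thesis using subgroup.one_closed[OF KS] by simp
    next
      case True
      let ?c = "lbr (gcomm G) (g m)"
      have sub: "gspan (Suc s) (?c ` {w. lyndon w \<and> length w = Suc s \<and> set w \<subseteq> S \<and> P w}) \<subseteq> ?K" for P
        by (rule gspan_mono) (use that in \<open>auto simp: B_def\<close>)
      have gS: "g m ` S \<subseteq> carrier G" using g that by auto
      consider "[a] = w" | "[a] < w" | "w < [a]" by force
      then show ?thesis
      proof cases
        case 1
        then have "gcomm G (g m a) (lbr (gcomm G) (g m') w) = \<one>"
          using gcomm_eq_one_iff[OF ac wc] True by auto
        then show ?thesis using subgroup.one_closed[OF KS] by simp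
      next
        case 2
        then show ?thesis
          using gcomm_lbr_gspan[OF fin gS, of "[a]" w] that True sub[of "\<lambda>w'. [a] @ w \<le> w' \<and> w' < w"] by auto
      next
        case 3
        have "gcomm G (?c w) (?c [a]) \<in> ?K"
          using gcomm_lbr_gspan[OF fin gS that(4) _ 3] that sub[of "\<lambda>w'. w @ [a] \<le> w' \<and> w' < [a]"] by auto
        then show ?thesis using gcomm_in_normal_commute[OF K _ ac] True wc by simp
      qed
    qed
  qed
  have step2: "gcomm G x y \<in> ?K" if x: "x \<in> carrier G" and y: "y \<in> Gam G s" for x y
  proof -
    have yc: "y \<in> carrier G" using y by simp
    \<comment> \<open>Linearity is used in both arguments: first \<open>y\<close> is reduced to
      Lyndon commutators against a fixed generator, then \<open>x\<close> is reduced to generators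
      against a fixed \<open>y\<close>.\<close>
    have "{g m a | m a. m \<in> M \<and> a \<in> S} \<subseteq> {x \<in> carrier G. gcomm G x y \<in> ?K}"
    proof clarify
      fix m a assume ma: "m \<in> M" "a \<in> S"
      have "gcomm G y (g m a) \<in> ?K"
      proof (rule gcomm_gspan_left[OF K, where N = s and q = 1])
        show "y \<in> gspan s (B s)" using Suc.IH y unfolding B_def by blast
        show "g m a \<in> Gam G 1" using g ma by simp
        show "gcomm G z (g m a) \<in> ?K" if z: "z \<in> B s" for z
        proof -
          have "gcomm G (g m a) z \<in> ?K" using z step[OF ma] unfolding B_def by blast
          then show ?thesis using gcomm_in_normal_commute[OF K] g[OF ma] XC z by blast
        qed
        show "Gam G (Suc (s + 1)) \<subseteq> ?K" using Gam_subset_gspan[of "Suc s"] by (simp only: Suc_eq_plus1)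
      qed (use XC in auto)
      then show "g m a \<in> carrier G \<and> gcomm G (g m a) y \<in> ?K"
        using gcomm_in_normal_commute[OF K yc] g ma by simp
    qed
    from generate_subgroup_incl[OF this subgroup_commutants_mod[OF K yc]] gen x show ?thesis by blast
  qed
  have "Gam G (Suc s) \<subseteq> ?K"
    unfolding Gam_Suc[OF Suc.hyps] comm_sub_eq
    by (rule generate_subgroup_incl[OF _ KS]) (use step2 in blast)
  then show ?case unfolding B_def .
qed

end

section \<open>Functoriality of the lower central series and its graded quotients\<close>

lemma (in group_hom) Gam_hom: "h ` Gam G s \<subseteq> Gam H s"
proof (induction s rule: less_induct)
  case (less s)
  consider "s = 0" | "s = 1" | q where "s = Suc (Suc q)" by (metis One_nat_def old.nat.exhaust)
  then show ?case
  proof cases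
    case 3
    let ?X = "{gcomm G a b | a b. a \<in> carrier G \<and> b \<in> Gam G (Suc q)}"
    have IH: "h ` Gam G (Suc q) \<subseteq> Gam H (Suc q)" using less 3 by simp
    have "?X \<subseteq> {x \<in> carrier G. h x \<in> Gam H s}"
    proof clarify
      fix a b assume ab: "a \<in> carrier G" "b \<in> Gam G (Suc q)"
      have bc: "b \<in> carrier G" using ab by simp
      have "h (gcomm G a b) = gcomm H (h a) (h b)" using ab bc by (simp add: gcomm_def)
      then show "gcomm G a b \<in> carrier G \<and> h (gcomm G a b) \<in> Gam H s"
        using ab bc IH 3 H.gcomm_Gam_Suc(1)[of "h a" "h b" "Suc q"] by auto
    qed
    from G.generate_subgroup_incl[OF this subgroup_vimage[OF H.Gam_subgroup]]
    show ?thesis using 3 by (auto simp: G.comm_sub_eq)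
  qed auto
qed

context group
begin

lemma Gam_normal_Gam: "Gam G (Suc p) \<lhd> G\<lparr>carrier := Gam G p\<rparr>"
  by (rule normal_restrict_supergroup[OF Gam_subgroup Gam_normal Gam_Suc_subset])

lemma grp_group: "group (grp G p)"
  unfolding grp_def by (rule normal.factorgroup_is_group[OF Gam_normal_Gam])

lemma grp_carrier: "carrier (grp G p) = (\<lambda>x. Gam G (Suc p) #> x) ` Gam G p"
  by (simp add: grp_def carrier_FactGroup r_coset_def)

lemma grp_one: "\<one>\<^bsub>grp G p\<^esub> = Gam G (Suc p)"
  by (simp add: grp_def)

lemma grp_mult:
  assumes "x \<in> carrier G" "y \<in> carrier G"
  shows "(Gam G (Suc p) #> x) \<otimes>\<^bsub>grp G p\<^esub> (Gam G (Suc p) #> y) = Gam G (Suc p) #> (x \<otimes> y)"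
  using normal.rcos_sum[OF Gam_normal assms] by (simp add: grp_def)

lemma coset_Gam_eq_iff:
  assumes "x \<in> carrier G" "y \<in> carrier G"
  shows "Gam G p #> x = Gam G p #> y \<longleftrightarrow> y \<in> Gam G p #> x"
proof
  assume "Gam G p #> x = Gam G p #> y"
  then show "y \<in> Gam G p #> x" using rcos_self[OF assms(2) Gam_subgroup] by simp
next
  assume "y \<in> Gam G p #> x"
  then show "Gam G p #> x = Gam G p #> y" using repr_independence[OF _ assms(1) Gam_subgroup] by blast
qed

lemma grp_elem:
  assumes "c \<in> carrier (grp G p)" "x \<in> c"
  shows "x \<in> Gam G p" "c = Gam G (Suc p) #> x"
proof -
  obtain y where y: "y \<in> Gam G p" "c = Gam G (Suc p) #> y" using assms by (auto simp: grp_carrier)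
  then show "x \<in> Gam G p"
    using assms Gam_Suc_subset[of p] subgroup.m_closed[OF Gam_subgroup[of p]] unfolding r_coset_def by blast
  then show "c = Gam G (Suc p) #> x"
    using y assms coset_Gam_eq_iff by (metis Gam_carrier)
qed

lemma grp_some:
  assumes "c \<in> carrier (grp G p)"
  shows "(SOME x. x \<in> c) \<in> c"
proof -
  obtain y where y: "y \<in> Gam G p" "c = Gam G (Suc p) #> y" using assms by (auto simp: grp_carrier)
  then have "y \<in> c" using rcos_self[OF _ Gam_subgroup] by simp
  then show ?thesis by (rule someI)
qed

lemma grp_comm_group:
  assumes "0 < p"
  shows "comm_group (grp G p)"
proof (rule group.group_comm_groupI[OF grp_group])
  fix c d assume "c \<in> carrier (grp G p)" "d \<in> carrier (grp G p)"
  then obtain x y where x: "x \<in> Gam G p" "c = Gam G (Suc p) #> x"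
    and y: "y \<in> Gam G p" "d = Gam G (Suc p) #> y" by (auto simp: grp_carrier)
  have xy: "x \<in> carrier G" "y \<in> carrier G" using x y by auto
  have "x \<otimes> y = gcomm G x y \<otimes> (y \<otimes> x)" using xy by (simp add: gcomm_def group_word_simps)
  moreover have "gcomm G x y \<in> Gam G (Suc p)" using gcomm_Gam_Suc(1)[OF xy(1) y(1) assms] .
  ultimately have "x \<otimes> y \<in> Gam G (Suc p) #> (y \<otimes> x)" unfolding r_coset_def by auto
  then have "Gam G (Suc p) #> (y \<otimes> x) = Gam G (Suc p) #> (x \<otimes> y)"
    using coset_Gam_eq_iff xy by simp
  then show "c \<otimes>\<^bsub>grp G p\<^esub> d = d \<otimes>\<^bsub>grp G p\<^esub> c" using x y xy by (simp add: grp_mult)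
qed

end

text \<open>Diagonal entries equal to 1 allow elimination over the integers. The new homomorphism
  removes the \<open>x i d\<close>-fold multiple of \<open>e i\<close> from \<open>d\<close>,
  applies the one already built, and adds the same multiple of \<open>a i\<close>. Later
  \<open>e j\<close> have \<open>x i\<close>-coordinate 0, so their values are unaffected.\<close>

lemma hom_of_triangular:
  assumes D: "comm_group D" and A: "comm_group A"
    and e: "\<And>i. i \<in> set is \<Longrightarrow> e i \<in> carrier D" and a: "\<And>i. i \<in> set is \<Longrightarrow> a i \<in> carrier A"
    and x: "\<And>i d d'. i \<in> set is \<Longrightarrow> d \<in> carrier D \<Longrightarrow> d' \<in> carrier D \<Longrightarrow> x i (d \<otimes>\<^bsub>D\<^esub> d') = (x i d + x i d' :: int)"
    and diag: "\<And>i. i \<in> set is \<Longrightarrow> x i (e i) = 1"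
    and tri: "sorted_wrt (\<lambda>i j. x i (e j) = 0) is"
  shows "\<exists>R \<in> hom D A. \<forall>i \<in> set is. R (e i) = a i"
  using e a x diag tri
proof (induction "is")
  case Nil
  interpret A: comm_group A by fact
  show ?case by (intro bexI[of _ "\<lambda>_. \<one>\<^bsub>A\<^esub>"]) (auto simp: hom_def)
next
  case (Cons i "is")
  interpret A: comm_group A by fact
  interpret D: comm_group D by fact
  have "\<exists>R \<in> hom D A. \<forall>j \<in> set is. R (e j) = a j" by (rule Cons.IH) (use Cons.prems in auto)
  then obtain R where R: "R \<in> hom D A" "\<And>j. j \<in> set is \<Longrightarrow> R (e j) = a j" by blast
  interpret R: group_hom D A R using R by unfold_locales
  have ei: "e i \<in> carrier D" and ai: "a i \<in> carrier A" using Cons.prems by auto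
  define R' where "R' d = R (d \<otimes>\<^bsub>D\<^esub> e i [^]\<^bsub>D\<^esub> (- x i d)) \<otimes>\<^bsub>A\<^esub> a i [^]\<^bsub>A\<^esub> x i d" for d
  have "R' \<in> hom D A"
  proof (rule homI)
    fix d d' assume d: "d \<in> carrier D" "d' \<in> carrier D"
    show "R' d \<in> carrier A" using d ei ai by (simp add: R'_def)
    have xx: "x i (d \<otimes>\<^bsub>D\<^esub> d') = x i d + x i d'" using Cons.prems(3) d by simp
    have 1: "e i [^]\<^bsub>D\<^esub> (- x i (d \<otimes>\<^bsub>D\<^esub> d')) = e i [^]\<^bsub>D\<^esub> (- x i d) \<otimes>\<^bsub>D\<^esub> e i [^]\<^bsub>D\<^esub> (- x i d')"
      using ei by (simp add: xx D.int_pow_mult[symmetric])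
    have 2: "a i [^]\<^bsub>A\<^esub> x i (d \<otimes>\<^bsub>D\<^esub> d') = a i [^]\<^bsub>A\<^esub> x i d \<otimes>\<^bsub>A\<^esub> a i [^]\<^bsub>A\<^esub> x i d'"
      using ai by (simp add: xx A.int_pow_mult)
    show "R' (d \<otimes>\<^bsub>D\<^esub> d') = R' d \<otimes>\<^bsub>A\<^esub> R' d'"
      unfolding R'_def 1 2 using d ei ai by (simp add: A.m_ac)
  qed
  moreover have "R' (e i) = a i"
    using ei ai Cons.prems(4)[of i] by (simp add: R'_def D.int_pow_neg A.int_pow_1 D.int_pow_1)
  moreover have "R' (e j) = a j" if "j \<in> set is" for j
  proof -
    have "x i (e j) = 0" using Cons.prems(5) that by simp
    then show ?thesis using that R(2) Cons.prems by (simp add: R'_def)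
  qed
  ultimately show ?case by auto
qed

section \<open>Noncommutative power series\<close>

text \<open>A copy of \<open>tens\<close> that can carry a \<open>ring_1\<close> instance with
  \<open>tmul\<close> as its product, so that identities between series are proved by ring
  simplification.\<close>

typedef ncps = "UNIV :: tens set" morphisms cf Ncps by simp

setup_lifting type_definition_ncps

lemma ncps_eqI: "(\<And>w. cf a w = cf b w) \<Longrightarrow> a = b"
  by transfer (rule ext)

lemma tmul_assoc: "tmul (tmul a b) c = tmul a (tmul b c)"
proof
  fix w :: "nat list"
  let ?n = "length w"
  have "tmul (tmul a b) c w = (\<Sum>k\<le>?n. \<Sum>j\<le>k. a (take j w) * b (drop j (take k w)) * c (drop k w))"
    by (auto simp: tmul_def sum_distrib_right min_def intro!: sum.cong)
  also have "\<dots> = (\<Sum>(k, j)\<in>Sigma {..?n} (\<lambda>k. {..k}). a (take j w) * b (drop j (take k w)) * c (drop k w))"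
    by (subst sum.Sigma) auto
  \<comment> \<open>Both sides sum over two cut points of the word; the pair of cuts is replaced by
    the first cut and the length of the middle piece.\<close>
  also have "\<dots> = (\<Sum>(j, i)\<in>Sigma {..?n} (\<lambda>j. {..?n - j}). a (take j w) * b (take i (drop j w)) * c (drop i (drop j w)))"
    by (rule sum.reindex_bij_witness[where i = "\<lambda>(j, i). (j + i, j)" and j = "\<lambda>(k, j). (j, k - j)"])
      (auto simp: drop_take add.commute)
  also have "\<dots> = (\<Sum>j\<le>?n. \<Sum>i\<le>?n - j. a (take j w) * b (take i (drop j w)) * c (drop i (drop j w)))"
    by (subst sum.Sigma) auto
  also have "\<dots> = tmul a (tmul b c) w"
    by (auto simp: tmul_def sum_distrib_left mult.assoc intro!: sum.cong)
  finally show "tmul (tmul a b) c w = tmul a (tmul b c) w" .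
qed

lemma tmul_one_left: "tmul (tmono []) a = a"
proof
  fix w
  have "tmul (tmono []) a w = (\<Sum>k\<le>length w. if k = 0 then a w else 0)"
    unfolding tmul_def by (rule sum.cong) (auto simp: tmono_def)
  then show "tmul (tmono []) a w = a w" by simp
qed

lemma tmul_one_right: "tmul a (tmono []) = a"
proof
  fix w
  have "tmul a (tmono []) w = (\<Sum>k\<le>length w. if k = length w then a w else 0)"
    unfolding tmul_def by (rule sum.cong) (auto simp: tmono_def)
  then show "tmul a (tmono []) w = a w" by simp
qed

instantiation ncps :: ring_1
begin
lift_definition zero_ncps :: ncps is "\<lambda>w. 0" .
lift_definition one_ncps :: ncps is "tmono []" .
lift_definition plus_ncps :: "ncps \<Rightarrow> ncps \<Rightarrow> ncps" is "\<lambda>a b w. a w + b w" .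
lift_definition minus_ncps :: "ncps \<Rightarrow> ncps \<Rightarrow> ncps" is "\<lambda>a b w. a w - b w" .
lift_definition uminus_ncps :: "ncps \<Rightarrow> ncps" is "\<lambda>a w. - a w" .
lift_definition times_ncps :: "ncps \<Rightarrow> ncps \<Rightarrow> ncps" is tmul .
instance
proof
  fix a b c :: ncps
  show "a * b * c = a * (b * c)" by transfer (rule tmul_assoc)
  show "1 * a = a" by transfer (rule tmul_one_left)
  show "a * 1 = a" by transfer (rule tmul_one_right)
  show "(a + b) * c = a * c + b * c"
    by transfer (auto simp: tmul_def fun_eq_iff algebra_simps sum.distrib)
  show "a * (b + c) = a * b + a * c"
    by transfer (auto simp: tmul_def fun_eq_iff algebra_simps sum.distrib)
  show "(0::ncps) \<noteq> 1" by transfer (auto simp: tmono_def fun_eq_iff)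
qed (transfer, auto simp: fun_eq_iff)+
end

lemma cf_zero: "cf 0 = (\<lambda>w. 0)" and cf_one: "cf 1 = tmono []"
  and cf_add: "cf (a + b) = (\<lambda>w. cf a w + cf b w)" and cf_diff: "cf (a - b) = (\<lambda>w. cf a w - cf b w)"
  and cf_minus: "cf (- a) = (\<lambda>w. - cf a w)" and cf_mult: "cf (a * b) = tmul (cf a) (cf b)"
  by (transfer; simp)+

lemma cf_sum: "cf (sum f A) w = (\<Sum>i\<in>A. cf (f i) w)"
  by (induction A rule: infinite_finite_induct) (auto simp: cf_zero cf_add)

lemma cf_of_int_mult: "cf (of_int z * a) w = z * cf a w"
proof -
  have "cf (of_nat n * a) w = int n * cf a w" for n
    by (induction n) (auto simp: cf_zero cf_add algebra_simps)
  then show ?thesis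
    by (cases z rule: int_cases2) (auto simp: cf_minus)
qed

lift_definition nmon :: "nat list \<Rightarrow> ncps" is tmono .

lemma cf_nmon: "cf (nmon v) = tmono v"
  by transfer simp

lemma nmon_append: "nmon (u @ v) = nmon u * nmon v"
proof (rule ncps_eqI)
  fix w
  have "cf (nmon u * nmon v) w = (\<Sum>k\<le>length w. if k = length u then tmono (u @ v) w else 0)"
    unfolding cf_mult cf_nmon tmul_def
  proof (rule sum.cong)
    fix k assume "k \<in> {..length w}"
    then show "tmono u (take k w) * tmono v (drop k w) = (if k = length u then tmono (u @ v) w else 0)"
    proof (cases "k = length u")
      case True
      have "w = u @ v \<longleftrightarrow> take k w = u \<and> drop k w = v"
        using append_take_drop_id[of k w] True by (metis append_eq_conv_conj)
      then show ?thesis using True by (simp add: tmono_def)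
    next
      case False
      then have "take k w \<noteq> u" using \<open>k \<in> {..length w}\<close> by auto
      then show ?thesis using False by (simp add: tmono_def)
    qed
  qed simp
  also have "\<dots> = tmono (u @ v) w" by (auto simp: tmono_def)
  finally show "cf (nmon (u @ v)) w = cf (nmon u * nmon v) w" by (simp add: cf_nmon)
qed

section \<open>Brackets, order, degree and support of power series\<close>

definition bra :: "ncps \<Rightarrow> ncps \<Rightarrow> ncps" where
  "bra a b = a * b - b * a"

lemma cf_bra: "cf (bra a b) = tbr (cf a) (cf b)"
  by (simp add: bra_def cf_diff cf_mult tbr_def)

definition ordp :: "nat \<Rightarrow> ncps \<Rightarrow> bool" where
  "ordp s a \<longleftrightarrow> (\<forall>w. length w < s \<longrightarrow> cf a w = 0)"

definition homog :: "nat \<Rightarrow> ncps \<Rightarrow> bool" where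
  "homog s a \<longleftrightarrow> (\<forall>w. length w \<noteq> s \<longrightarrow> cf a w = 0)"

definition supp :: "nat set \<Rightarrow> ncps \<Rightarrow> bool" where
  "supp S a \<longleftrightarrow> (\<forall>w. \<not> set w \<subseteq> S \<longrightarrow> cf a w = 0)"

lemma ordp_mono: "ordp t a \<Longrightarrow> s \<le> t \<Longrightarrow> ordp s a"
  by (auto simp: ordp_def)

lemma ordp_add: "ordp s a \<Longrightarrow> ordp s b \<Longrightarrow> ordp s (a + b)"
  and ordp_diff: "ordp s a \<Longrightarrow> ordp s b \<Longrightarrow> ordp s (a - b)"
  and ordp_zero: "ordp s 0"
  by (auto simp: ordp_def cf_add cf_diff cf_minus cf_zero)

lemma ordp_mult: "ordp p a \<Longrightarrow> ordp q b \<Longrightarrow> ordp (p + q) (a * b)"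
proof -
  assume a: "ordp p a" and b: "ordp q b"
  have "cf a (take k w) * cf b (drop k w) = 0" if "length w < p + q" "k \<le> length w" for k w
    using a b that by (cases "k < p") (auto simp: ordp_def)
  then show ?thesis by (auto simp: ordp_def cf_mult tmul_def intro!: sum.neutral)
qed

lemma ordp_0: "ordp 0 a"
  by (simp add: ordp_def)

lemma homog_add: "homog s a \<Longrightarrow> homog s b \<Longrightarrow> homog s (a + b)"
  and homog_diff: "homog s a \<Longrightarrow> homog s b \<Longrightarrow> homog s (a - b)"
  and homog_minus: "homog s a \<Longrightarrow> homog s (- a)"
  and homog_zero: "homog s 0"
  by (auto simp: homog_def cf_add cf_diff cf_minus cf_zero)

lemma homog_mult: "homog p a \<Longrightarrow> homog q b \<Longrightarrow> homog (p + q) (a * b)"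
proof -
  assume a: "homog p a" and b: "homog q b"
  have "cf a (take k w) * cf b (drop k w) = 0" if "length w \<noteq> p + q" "k \<le> length w" for k w
    using a b that by (cases "k = p") (auto simp: homog_def)
  then show ?thesis by (auto simp: homog_def cf_mult tmul_def intro!: sum.neutral)
qed

lemma homog_ordp: "homog s a \<Longrightarrow> ordp s a"
  by (simp add: homog_def ordp_def)

lemma homog_bra: "homog p a \<Longrightarrow> homog q b \<Longrightarrow> homog (p + q) (bra a b)"
  unfolding bra_def using homog_mult[of p a q b] homog_mult[of q b p a] by (auto simp: add.commute homog_diff)

lemma homog_nmon: "homog (length v) (nmon v)"
  by (auto simp: homog_def cf_nmon tmono_def)

lemma homog_nmon_single: "homog (Suc 0) (nmon [i])"
  using homog_nmon[of "[i]"] by simp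

lemma supp_add: "supp S a \<Longrightarrow> supp S b \<Longrightarrow> supp S (a + b)"
  and supp_diff: "supp S a \<Longrightarrow> supp S b \<Longrightarrow> supp S (a - b)"
  and supp_minus: "supp S a \<Longrightarrow> supp S (- a)"
  and supp_zero: "supp S 0"
  by (auto simp: supp_def cf_add cf_diff cf_minus cf_zero cf_one tmono_def)

lemma supp_mult:
  assumes "supp S a" "supp S b"
  shows "supp S (a * b)"
  unfolding supp_def
proof (intro allI impI)
  fix w assume w: "\<not> set w \<subseteq> S"
  have "cf a (take k w) * cf b (drop k w) = 0" for k
  proof -
    have "\<not> (set (take k w) \<subseteq> S \<and> set (drop k w) \<subseteq> S)"
      using w by (metis append_take_drop_id le_sup_iff set_append)
    then show ?thesis using assms by (auto simp: supp_def)
  qed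
  then show "cf (a * b) w = 0" unfolding cf_mult tmul_def by (intro sum.neutral) blast
qed

lemma supp_bra: "supp S a \<Longrightarrow> supp S b \<Longrightarrow> supp S (bra a b)"
  by (simp add: bra_def supp_diff supp_mult)

lemma supp_homog_finite: "finite S \<Longrightarrow> supp S a \<Longrightarrow> homog s a \<Longrightarrow> finite {w. cf a w \<noteq> 0}"
  by (rule finite_subset[OF _ finite_lists_length_eq[of S s]]) (auto simp: supp_def homog_def)

text \<open>Expresses u = 1 + A + (terms of degree above s). The case \<open>A = 0\<close> is
  included deliberately: leading terms may cancel in products, and deeper elements have leading term
  0 in lower degrees.\<close>

definition leads :: "nat \<Rightarrow> ncps \<Rightarrow> ncps \<Rightarrow> bool" where
  "leads s u A \<longleftrightarrow> homog s A \<and> ordp (Suc s) (u - 1 - A)"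

lemma ordp_homog_add: "homog s a \<Longrightarrow> ordp (Suc s) b \<Longrightarrow> ordp s (a + b)"
  by (auto simp: homog_def ordp_def cf_add)

text \<open>The cross term has order at least \<open>2 * s\<close>, which exceeds \<open>s\<close>
  because \<open>s\<close> is positive.\<close>

lemma leads_mult:
  assumes "leads s u A" "leads s v B" "0 < s"
  shows "leads s (u * v) (A + B)"
proof -
  define E F where "E = u - 1 - A" and "F = v - 1 - B"
  have u: "u = 1 + (A + E)" and v: "v = 1 + (B + F)" by (simp_all add: E_def F_def)
  have o: "ordp (Suc s) E" "ordp (Suc s) F" "homog s A" "homog s B"
    using assms by (auto simp: leads_def E_def F_def)
  have o1: "ordp s (A + E)" "ordp s (B + F)"
    using o by (auto intro: ordp_homog_add)
  have eq: "u * v - 1 - (A + B) = E + F + (A + E) * (B + F)"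
    by (simp add: u v algebra_simps)
  have "ordp (Suc s) ((A + E) * (B + F))"
    by (rule ordp_mono[OF ordp_mult[OF o1]]) (use assms(3) in simp)
  then show ?thesis unfolding leads_def eq using o by (auto intro: ordp_add homog_add)
qed

text \<open>From \<open>(A + E) * u' = 1 - u'\<close> one substitution gives u' = 1 - (A + E) + (A +
  E)(A + E)u', whose last term has order at least \<open>2 * s\<close>.\<close>

lemma leads_inverse:
  assumes "leads s u A" "u * u' = 1" "0 < s"
  shows "leads s u' (- A)"
proof -
  define E where "E = u - 1 - A"
  have u: "u = 1 + (A + E)" by (simp add: E_def)
  have o: "ordp (Suc s) E" "homog s A" using assms by (auto simp: leads_def E_def)
  have o1: "ordp s (A + E)" using o by (auto intro: ordp_homog_add)
  have "(1 + (A + E)) * u' = 1" using assms(2) u by simp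
  then have y: "(A + E) * u' = 1 - u'" unfolding distrib_right[of 1] by (simp add: eq_diff_eq add.commute)
  have eq: "u' - 1 - (- A) = (A + E) * ((A + E) * u') - E"
    unfolding y right_diff_distrib by simp
  have "ordp (s + (s + 0)) ((A + E) * ((A + E) * u'))" by (intro ordp_mult o1 ordp_0)
  then have "ordp (Suc s) ((A + E) * ((A + E) * u'))" by (rule ordp_mono) (use assms(3) in simp)
  then show ?thesis unfolding leads_def eq using o by (auto intro: ordp_diff homog_minus)
qed

text \<open>Since \<open>v * u * (u' * v') = 1\<close>, the commutator minus 1 equals
  \<open>(u * v - v * u) * (u' * v')\<close>. The first factor is \<open>bra A B\<close> plus higher
  terms, and the second is 1 plus terms of positive order.\<close>

lemma leads_commutator:
  assumes "leads p u A" "leads q v B" "u * u' = 1" "v * v' = 1" "0 < p" "0 < q"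
  shows "leads (p + q) (u * v * u' * v') (bra A B)"
proof -
  define E F where "E = u - 1 - A" and "F = v - 1 - B"
  define E' F' where "E' = u' - 1 - (- A)" and "F' = v' - 1 - (- B)"
  have u: "u = 1 + (A + E)" and v: "v = 1 + (B + F)" by (simp_all add: E_def F_def)
  have o: "ordp (Suc p) E" "ordp (Suc q) F" "homog p A" "homog q B"
    using assms by (auto simp: leads_def E_def F_def)
  have o': "ordp (Suc p) E'" "ordp (Suc q) F'"
    using leads_inverse[OF assms(1,3,5)] leads_inverse[OF assms(2,4,6)] by (auto simp: leads_def E'_def F'_def)
  have u': "u' = 1 + (E' - A)" and v': "v' = 1 + (F' - B)" by (simp_all add: E'_def F'_def)
  note hA = homog_ordp[OF o(3)] homog_ordp[OF o(4)]
  have o1: "ordp 1 (E' - A)" "ordp 1 (F' - B)"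
    by (rule ordp_diff; rule ordp_mono[OF o'(1)] ordp_mono[OF o'(2)] ordp_mono[OF hA(1)] ordp_mono[OF hA(2)];
        use assms(5,6) in simp)+
  have h: "homog (p + q) (bra A B)" by (rule homog_bra[OF o(3,4)])
  define R where "R = A * F + E * B + E * F - B * E - F * A - F * E"
  have "ordp (p + Suc q) (A * F)" "ordp (Suc p + q) (E * B)" "ordp (Suc p + Suc q) (E * F)"
    "ordp (q + Suc p) (B * E)" "ordp (Suc q + p) (F * A)" "ordp (Suc q + Suc p) (F * E)"
    by (intro ordp_mult o hA)+
  then have oR: "ordp (Suc (p + q)) R"
    unfolding R_def by (intro ordp_add ordp_diff) (simp_all add: ordp_def)
  have uv: "u * v - v * u = bra A B + R" by (simp add: u v bra_def R_def algebra_simps)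
  define T where "T = (E' - A) + (F' - B) + (E' - A) * (F' - B)"
  have oT: "ordp 1 T" unfolding T_def
    by (intro ordp_add o1 ordp_mono[OF ordp_mult[OF o1]]) simp
  have uv': "u' * v' = 1 + T" by (simp add: u' v' T_def algebra_simps)
  have "v * u * (u' * v') = v * (u * u') * v'" by (simp only: mult.assoc)
  then have vu: "v * u * (u' * v') = 1" using assms(3,4) by simp
  have "u * v * u' * v' = (u * v - v * u) * (u' * v') + v * u * (u' * v')"
    by (simp add: algebra_simps)
  also have "\<dots> = (bra A B + R) * (1 + T) + 1" unfolding vu unfolding uv uv' ..
  finally have eq: "u * v * u' * v' - 1 - bra A B = R + (bra A B + R) * T"
    by (simp add: algebra_simps)
  have "ordp (p + q) (bra A B + R)"
    by (rule ordp_homog_add[OF h oR])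
  from ordp_mult[OF this oT] have "ordp (Suc (p + q)) ((bra A B + R) * T)" by simp
  then show ?thesis unfolding leads_def eq using oR h by (auto intro: ordp_add)
qed

lemma leads_weaken:
  assumes "leads (Suc s) u A"
  shows "leads s u 0"
proof -
  have "cf (u - 1) w = 0" if "length w < Suc s" for w
  proof -
    have "cf (u - 1 - A) w = 0" "cf A w = 0" using assms that by (auto simp: leads_def homog_def ordp_def)
    then show ?thesis by (simp add: cf_diff)
  qed
  then show ?thesis by (simp add: leads_def homog_zero ordp_def)
qed

text \<open>Links the relation to the homogeneous part taken in \<open>tau\<close>, and makes the
  leading term unique in positive degree, where the constant 1 contributes nothing.\<close>

lemma hom_part_leads:
  assumes "leads s u A" "0 < s"
  shows "hom_part s (cf u) = cf A"
proof
  fix w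
  show "hom_part s (cf u) w = cf A w"
  proof (cases "length w = s")
    case True
    then have "cf (u - 1 - A) w = 0" using assms by (auto simp: leads_def ordp_def)
    moreover have "cf 1 w = 0" using True assms by (auto simp: cf_one tmono_def)
    ultimately show ?thesis using True by (simp add: hom_part_def cf_diff)
  next
    case False
    then show ?thesis using assms by (auto simp: hom_part_def leads_def homog_def)
  qed
qed

lemma lie_el_zero: "cf 0 \<in> lie_el n" and lie_el_add: "cf a \<in> lie_el n \<Longrightarrow> cf b \<in> lie_el n \<Longrightarrow> cf (a + b) \<in> lie_el n"
  and lie_el_minus: "cf a \<in> lie_el n \<Longrightarrow> cf (- a) \<in> lie_el n"
  and lie_el_bra: "cf a \<in> lie_el n \<Longrightarrow> cf b \<in> lie_el n \<Longrightarrow> cf (bra a b) \<in> lie_el n"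
  and lie_el_nmon: "i \<in> {1..n} \<Longrightarrow> cf (nmon [i]) \<in> lie_el n"
  by (simp_all add: cf_zero cf_add cf_minus cf_bra cf_nmon lie_el.intros del: atLeastAtMost_iff)

text \<open>Words in the product for \<open>u\<close>, \<open>v\<close> are at least
  \<open>u @ v\<close>, while those in the reversed product are at least \<open>v @ u\<close>, which
  is strictly larger. So the coefficient at \<open>u @ v\<close> comes from the first product alone,
  where only the cut after \<open>u\<close> contributes.\<close>

lemma lbr_bra_triangular:
  assumes "lyndon l"
  shows "(\<forall>w. cf (lbr bra (\<lambda>i. nmon [i]) l) w \<noteq> 0 \<longrightarrow> length w = length l \<and> l \<le> w)
    \<and> cf (lbr bra (\<lambda>i. nmon [i]) l) l = 1"
  using assms
proof (induction rule: lyndon_induct)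
  case (single a)
  then show ?case by (simp add: cf_nmon tmono_def)
next
  case (append u v)
  have ne: "u \<noteq> []" "v \<noteq> []" using append.hyps(1,2) lyndon_not_Nil by auto
  let ?P = "\<lambda>l. cf (lbr bra (\<lambda>i. nmon [i]) l)"
  have split: "?P (u @ v) w = tmul (?P u) (?P v) w - tmul (?P v) (?P u) w" for w
    by (simp add: lbr_split[OF append(5) ne] bra_def cf_diff cf_mult)
  have prod: "\<exists>k. length (take k w) = length l \<and> l \<le> take k w \<and> length (drop k w) = length l' \<and> l' \<le> drop k w"
    if ll: "l \<in> {u, v}" "l' \<in> {u, v}" "tmul (?P l) (?P l') w \<noteq> 0" for l l' w
  proof -
    obtain k where "?P l (take k w) * ?P l' (drop k w) \<noteq> 0"
      using ll(3) unfolding tmul_def by (meson sum.not_neutral_contains_not_neutral)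
    then have "?P l (take k w) \<noteq> 0" "?P l' (drop k w) \<noteq> 0" by auto
    moreover have "\<forall>x. ?P l x \<noteq> 0 \<longrightarrow> length x = length l \<and> l \<le> x" "\<forall>x. ?P l' x \<noteq> 0 \<longrightarrow> length x = length l' \<and> l' \<le> x"
      using append.IH ll(1,2) by auto
    ultimately show ?thesis by blast
  qed
  have prod_le: "length w = length l + length l' \<and> l @ l' \<le> w"
    if ll: "l \<in> {u, v}" "l' \<in> {u, v}" "tmul (?P l) (?P l') w \<noteq> 0" for l l' w
  proof -
    obtain k where k: "length (take k w) = length l" "l \<le> take k w" "length (drop k w) = length l'" "l' \<le> drop k w"
      using prod[OF ll] by blast
    have "l @ l' \<le> take k w @ drop k w"
    proof (cases "l = take k w")
      case True
      then show ?thesis using k(4) lex_append_left[of l l' "drop k w"] by (metis order_le_less)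
    next
      case False
      then have "l < take k w" using k(2) by simp
      then show ?thesis using lex_append_mono_length[of l "take k w" l' "drop k w"] k(1) by simp
    qed
    moreover have "length (take k w @ drop k w) = length l + length l'" unfolding length_append using k by simp
    ultimately show ?thesis by simp
  qed
  have "u @ v < v" by (rule lyndon_append_less) fact+
  also have "v \<le> v @ u" by (rule lex_le_append)
  finally have uv: "u @ v < v @ u" .
  have vu0: "tmul (?P v) (?P u) (u @ v) = 0"
    using prod_le[of v u "u @ v"] uv by (metis insertCI leD)
  have "tmul (?P u) (?P v) (u @ v) = (\<Sum>k\<le>length (u @ v). if k = length u then 1 else 0)"
    unfolding tmul_def
  proof (rule sum.cong[OF refl])
    fix k assume k: "k \<in> {..length (u @ v)}"
    show "?P u (take k (u @ v)) * ?P v (drop k (u @ v)) = (if k = length u then 1 else 0)"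
    proof (cases "k = length u")
      case True
      moreover have "?P u u = 1" "?P v v = 1" using append.IH by blast+
      ultimately show ?thesis by simp
    next
      case False
      then have "length (take k (u @ v)) \<noteq> length u" using k by simp
      then have "?P u (take k (u @ v)) = 0" using append.IH(1) by blast
      then show ?thesis using False by simp
    qed
  qed
  also have "\<dots> = 1" by simp
  finally have "?P (u @ v) (u @ v) = 1" using split[of "u @ v"] vu0 by simp
  moreover have "length w = length (u @ v) \<and> u @ v \<le> w" if "?P (u @ v) w \<noteq> 0" for w
  proof -
    from that have "tmul (?P u) (?P v) w \<noteq> 0 \<or> tmul (?P v) (?P u) w \<noteq> 0" using split[of w] by auto
    then show ?thesis using prod_le[of u v w] prod_le[of v u w] uv by auto
  qed
  ultimately show ?case by blast
qed

lemma cf_nmon_mult_Cons: "cf (nmon [m] * a) (m # w) = cf a w"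
proof -
  have "cf (nmon [m] * a) (m # w) = (\<Sum>k\<le>Suc (length w). if k = 1 then cf a w else 0)"
    unfolding cf_mult tmul_def cf_nmon
    by (rule sum.cong) (auto simp: tmono_def take_Cons' split: nat.splits)
  also have "\<dots> = cf a w" by (subst sum.delta) auto
  finally show ?thesis .
qed

text \<open>The letter \<open>m\<close> does not occur in \<open>a\<close>, and \<open>a\<close> has
  no constant term, so no word of \<open>a * nmon [m]\<close> begins with \<open>m\<close>.
  Bracketing with X_m therefore loses no information about \<open>a\<close>.\<close>

lemma cf_bra_nmon_Cons:
  assumes "supp S a" "m \<notin> S" "homog s a" "0 < s"
  shows "cf (bra (nmon [m]) a) (m # w) = cf a w"
proof -
  have "cf (a * nmon [m]) (m # w) = 0"
    unfolding cf_mult tmul_def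
  proof (rule sum.neutral, rule ballI)
    fix k assume "k \<in> {..length (m # w)}"
    show "cf a (take k (m # w)) * cf (nmon [m]) (drop k (m # w)) = 0"
      using assms by (cases k) (auto simp: supp_def homog_def)
  qed
  then show ?thesis by (simp add: bra_def cf_diff cf_nmon_mult_Cons)
qed

section \<open>Derivations of the tensor algebra acting on brackets\<close>

lemma ext_der_sum:
  assumes "finite U" "\<And>u. u \<notin> U \<Longrightarrow> a u = 0"
  shows "ext_der d a w = (\<Sum>u\<in>U. a u * ext_word d u w)"
  unfolding ext_der_def by (rule sum.mono_neutral_left) (use assms in auto)

lemma tmul_zero: "tmul a (\<lambda>w. 0) = (\<lambda>w. 0)" "tmul (\<lambda>w. 0) a = (\<lambda>w. 0)"
  by (auto simp: tmul_def)

lemma ext_word_Cons: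
  assumes "\<And>x. x \<in> set u \<Longrightarrow> d x = (\<lambda>w. 0)"
  shows "ext_word d (i # u) = tmul (d i) (tmono u)"
proof
  fix w
  have "ext_word d (i # u) w = tmul (d i) (tmono u) w
     + (\<Sum>j<length u. tmul (tmul (tmono (i # take j u)) (d (u ! j))) (tmono (drop (Suc j) u)) w)"
    unfolding ext_word_def length_Cons sum.lessThan_Suc_shift by (simp add: tmul_one_left)
  then show "ext_word d (i # u) w = tmul (d i) (tmono u) w" using assms by (simp add: tmul_zero)
qed

lemma ext_word_snoc:
  assumes "\<And>x. x \<in> set u \<Longrightarrow> d x = (\<lambda>w. 0)"
  shows "ext_word d (u @ [i]) = tmul (tmono u) (d i)"
proof
  fix w
  have "ext_word d (u @ [i]) w = tmul (tmono u) (d i) w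
     + (\<Sum>j<length u. tmul (tmul (tmono (take j (u @ [i]))) (d ((u @ [i]) ! j))) (tmono (drop (Suc j) (u @ [i]))) w)"
    unfolding ext_word_def by (simp add: tmul_one_right)
  then show "ext_word d (u @ [i]) w = tmul (tmono u) (d i) w" using assms by (simp add: tmul_zero nth_append)
qed

lemma ncps_sum_nmon:
  assumes "finite {w. cf a w \<noteq> 0}"
  shows "a = (\<Sum>u | cf a u \<noteq> 0. of_int (cf a u) * nmon u)"
proof (rule ncps_eqI)
  fix w
  have "cf (\<Sum>u | cf a u \<noteq> 0. of_int (cf a u) * nmon u) w = (\<Sum>u | cf a u \<noteq> 0. if u = w then cf a w else 0)"
    unfolding cf_sum cf_of_int_mult cf_nmon by (rule sum.cong) (auto simp: tmono_def)
  then show "cf a w = cf (\<Sum>u | cf a u \<noteq> 0. of_int (cf a u) * nmon u) w" using assms by simp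
qed

text \<open>The product rule for a derivation that annihilates every letter of \<open>b\<close>, so
  that only the factor X_i is differentiated. Because \<open>ext_der\<close> is defined word by
  word, the bracket is first expanded into monomials.\<close>

lemma ext_der_bra:
  assumes "finite S" "supp S b" "homog s b" "i \<notin> S"
    and d0: "\<And>x. x \<in> S \<Longrightarrow> d x = (\<lambda>w. 0)" and di: "d i = cf D"
  shows "ext_der d (cf (bra (nmon [i]) b)) = cf (bra D b)"
proof
  fix w
  define U where "U = {w. cf b w \<noteq> 0}"
  \<comment> \<open>A sum over an infinite set is 0, so \<open>ext_der\<close> has its intended
    meaning only on series of finite support; homogeneity over a finite alphabet guarantees
    this.\<close>
  have fin: "finite U" unfolding U_def by (rule supp_homog_finite) fact+
  have b: "b = (\<Sum>u\<in>U. of_int (cf b u) * nmon u)" unfolding U_def using fin by (intro ncps_sum_nmon) (simp add: U_def)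
  have bra_b: "bra a b = (\<Sum>u\<in>U. of_int (cf b u) * (a * nmon u - nmon u * a))" for a
  proof -
    have "bra a b = (\<Sum>u\<in>U. a * (of_int (cf b u) * nmon u)) - (\<Sum>u\<in>U. of_int (cf b u) * nmon u * a)"
      unfolding bra_def using b by (metis sum_distrib_left sum_distrib_right)
    also have "\<dots> = (\<Sum>u\<in>U. of_int (cf b u) * (a * nmon u - nmon u * a))"
      unfolding sum_subtractf[symmetric]
    proof (rule sum.cong[OF refl])
      fix u
      have "a * (of_int (cf b u) * nmon u) = of_int (cf b u) * (a * nmon u)"
        by (metis mult.assoc mult_of_int_commute)
      then show "a * (of_int (cf b u) * nmon u) - of_int (cf b u) * nmon u * a =
          of_int (cf b u) * (a * nmon u - nmon u * a)" by (simp add: right_diff_distrib mult.assoc)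
    qed
    finally show ?thesis .
  qed
  have US: "set u \<subseteq> S" if "u \<in> U" for u using that assms(2) by (auto simp: U_def supp_def)
  have cfX: "cf (bra (nmon [i]) b) v = (\<Sum>u\<in>U. cf b u * (tmono (i # u) v - tmono (u @ [i]) v))" for v
    unfolding bra_b cf_sum cf_of_int_mult nmon_append[symmetric] cf_diff cf_nmon by simp
  \<comment> \<open>A finite set containing the support of the bracket; the support itself is
    replaced by it so that the sum can be exchanged with the expansion of \<open>b\<close>.\<close>
  define V where "V = (#) i ` U \<union> (\<lambda>u. u @ [i]) ` U"
  have finV: "finite V" using fin by (simp add: V_def)
  have pick: "(\<Sum>v\<in>V. tmono x v * f v) = f x" if "x \<in> V" for x and f :: "nat list \<Rightarrow> int"
  proof -
    have "(\<Sum>v\<in>V. tmono x v * f v) = (\<Sum>v\<in>V. if v = x then f x else 0)"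
      by (rule sum.cong) (auto simp: tmono_def)
    then show ?thesis using finV that by simp
  qed
  have "ext_der d (cf (bra (nmon [i]) b)) w = (\<Sum>v\<in>V. cf (bra (nmon [i]) b) v * ext_word d v w)"
  proof (rule ext_der_sum[OF finV])
    fix v assume "v \<notin> V"
    then have "v \<noteq> i # u \<and> v \<noteq> u @ [i]" if "u \<in> U" for u using that by (auto simp: V_def)
    then show "cf (bra (nmon [i]) b) v = 0" unfolding cfX by (intro sum.neutral) (simp add: tmono_def)
  qed
  also have "\<dots> = (\<Sum>v\<in>V. \<Sum>u\<in>U. cf b u * (tmono (i # u) v * ext_word d v w - tmono (u @ [i]) v * ext_word d v w))"
    unfolding cfX sum_distrib_right by (simp add: algebra_simps)
  also have "\<dots> = (\<Sum>u\<in>U. \<Sum>v\<in>V. cf b u * (tmono (i # u) v * ext_word d v w - tmono (u @ [i]) v * ext_word d v w))"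
    by (rule sum.swap)
  also have "\<dots> = (\<Sum>u\<in>U. cf b u * (ext_word d (i # u) w - ext_word d (u @ [i]) w))"
  proof (rule sum.cong[OF refl])
    fix u assume "u \<in> U"
    then have "i # u \<in> V" "u @ [i] \<in> V" by (auto simp: V_def)
    then show "(\<Sum>v\<in>V. cf b u * (tmono (i # u) v * ext_word d v w - tmono (u @ [i]) v * ext_word d v w)) =
        cf b u * (ext_word d (i # u) w - ext_word d (u @ [i]) w)"
      by (simp add: sum_distrib_left[symmetric] sum_subtractf pick)
  qed
  also have "\<dots> = (\<Sum>u\<in>U. cf b u * cf (D * nmon u - nmon u * D) w)"
  proof (rule sum.cong[OF refl])
    fix u assume "u \<in> U"
    then have "d x = (\<lambda>w. 0)" if "x \<in> set u" for x using US d0 that by blast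
    then show "cf b u * (ext_word d (i # u) w - ext_word d (u @ [i]) w) = cf b u * cf (D * nmon u - nmon u * D) w"
      using ext_word_Cons[of u d i] ext_word_snoc[of u d i] by (simp add: di cf_diff cf_mult cf_nmon)
  qed
  also have "\<dots> = cf (bra D b) w" unfolding bra_b cf_sum cf_of_int_mult ..
  finally show "ext_der d (cf (bra (nmon [i]) b)) w = cf (bra D b) w" .
qed

lemma bra_jacobi: "bra (bra x a) b - bra (bra x b) a = bra x (bra a b)"
  by (simp add: bra_def algebra_simps)

section \<open>Free groups and the Johnson filtration\<close>

definition linv :: "nat \<times> bool \<Rightarrow> nat \<times> bool" where
  "linv a = (fst a, \<not> snd a)"

lemma cancels_iff: "fst a = fst b \<and> snd a \<noteq> snd b \<longleftrightarrow> b = linv a"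
  by (cases a; cases b) (auto simp: linv_def)

lemma linv_linv [simp]: "linv (linv a) = a"
  by (simp add: linv_def)

lemma push_Cons: "push a (b # w) = (if b = linv a then w else a # b # w)"
  using cancels_iff[of a b] by simp

declare push.simps(2) [simp del] push_Cons [simp]

abbreviation red :: "fword \<Rightarrow> bool" where
  "red \<equiv> successively (\<lambda>a b. b \<noteq> linv a)"

lemma red_push: "red w \<Longrightarrow> red (push a w)"
  by (cases w) (auto simp: successively_Cons)

lemma red_foldr_push: "red x \<Longrightarrow> red (foldr push v x)"
  by (induction v) (auto intro: red_push)

lemma red_reduce: "red (reduce w)"
  unfolding reduce_def by (rule red_foldr_push) simp

lemma push_red_Cons: "red (a # w) \<Longrightarrow> push a w = a # w"
  by (cases w) auto

lemma reduce_Cons: "reduce (a # w) = push a (reduce w)"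
  by (simp add: reduce_def)

lemma reduce_Nil [simp]: "reduce [] = []"
  by (simp add: reduce_def)

lemma reduce_red: "red w \<Longrightarrow> reduce w = w"
  by (induction w) (auto simp: reduce_Cons successively_Cons push_red_Cons)

lemma reduced_iff: "reduced w \<longleftrightarrow> red w"
  unfolding reduced_def using reduce_red red_reduce by metis

text \<open>Van der Waerden's argument: letters act on reduced words by \<open>push\<close>, and
  inverse letters act inversely. The action of a word therefore depends only on its reduced form,
  which yields associativity of the free group.\<close>

lemma push_push_linv: "red w \<Longrightarrow> push a (push (linv a) w) = w"
  by (cases w) (auto simp: push_red_Cons)

lemma foldr_push_push: "red x \<Longrightarrow> foldr push (push a v) x = push a (foldr push v x)"
  by (cases v) (auto simp: push_push_linv red_foldr_push)

lemma foldr_push_reduce: "red x \<Longrightarrow> foldr push (reduce v) x = foldr push v x"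
  by (induction v) (auto simp: reduce_Cons foldr_push_push)

lemma reduce_append: "reduce (v @ w) = foldr push v (reduce w)"
  by (simp add: reduce_def)

lemma reduce_append_left: "reduce (reduce v @ w) = reduce (v @ w)"
  by (simp add: reduce_append foldr_push_reduce red_reduce)

lemma reduce_append_right: "reduce (v @ reduce w) = reduce (v @ w)"
  by (simp add: reduce_append reduce_red red_reduce)

lemma set_push: "set (push a w) \<subseteq> insert a (set w)"
  by (cases w) auto

lemma set_reduce: "set (reduce w) \<subseteq> set w"
proof (induction w)
  case (Cons a w)
  then show ?case using set_push[of a "reduce w"] by (auto simp: reduce_Cons)
qed simp

lemma inv_word_Cons: "inv_word (a # w) = inv_word w @ [linv a]"
  by (cases a) (simp add: inv_word_def linv_def)

lemma inv_word_Nil [simp]: "inv_word [] = []"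
  by (simp add: inv_word_def)

lemma inv_word_append: "inv_word (v @ w) = inv_word w @ inv_word v"
  by (simp add: inv_word_def)

lemma inv_word_inv_word: "inv_word (inv_word w) = w"
  by (induction w) (auto simp: inv_word_Cons inv_word_append)

lemma reduce_inv_word_left: "reduce (inv_word w @ w) = []"
proof (induction w)
  case (Cons a w)
  have "reduce (inv_word (a # w) @ a # w) = foldr push (inv_word w) (push (linv a) (push (linv (linv a)) (reduce w)))"
    unfolding reduce_append inv_word_Cons by (simp add: reduce_Cons)
  also have "\<dots> = reduce (inv_word w @ w)" by (simp only: push_push_linv red_reduce reduce_append)
  finally show ?case using Cons by simp
qed simp

lemma reduce_inv_word_right: "reduce (w @ inv_word w) = []"
  using reduce_inv_word_left[of "inv_word w"] by (simp add: inv_word_inv_word)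

lemma fst_set_inv_word: "fst ` set (inv_word w) = fst ` set w"
  by (force simp: inv_word_def)

lemma free_carrier: "w \<in> carrier (free_group n) \<longleftrightarrow> red w \<and> fst ` set w \<subseteq> {1..n}"
  by (auto simp: free_group_def reduced_iff)

lemma free_mult: "v \<otimes>\<^bsub>free_group n\<^esub> w = reduce (v @ w)"
  by (simp add: free_group_def)

lemma free_one: "\<one>\<^bsub>free_group n\<^esub> = []"
  by (simp add: free_group_def)

lemma reduce_in_free: "fst ` set w \<subseteq> {1..n} \<Longrightarrow> reduce w \<in> carrier (free_group n)"
  using set_reduce[of w] red_reduce by (auto simp: free_carrier)

lemma reduce_inv_word_in_free:
  "w \<in> carrier (free_group n) \<Longrightarrow> reduce (inv_word w) \<in> carrier (free_group n)"
  by (rule reduce_in_free) (simp only: fst_set_inv_word free_carrier)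

lemma free_group_group: "group (free_group n)"
proof (rule groupI)
  fix x y z assume "x \<in> carrier (free_group n)" "y \<in> carrier (free_group n)" "z \<in> carrier (free_group n)"
  then show "x \<otimes>\<^bsub>free_group n\<^esub> y \<in> carrier (free_group n)"
    unfolding free_mult by (intro reduce_in_free) (auto simp: free_carrier)
  show "x \<otimes>\<^bsub>free_group n\<^esub> y \<otimes>\<^bsub>free_group n\<^esub> z = x \<otimes>\<^bsub>free_group n\<^esub> (y \<otimes>\<^bsub>free_group n\<^esub> z)"
    by (simp add: free_mult reduce_append_left reduce_append_right)
next
  fix x assume x: "x \<in> carrier (free_group n)"
  show "\<one>\<^bsub>free_group n\<^esub> \<otimes>\<^bsub>free_group n\<^esub> x = x"
    using x by (simp add: free_mult free_one reduce_red free_carrier)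
  show "\<exists>y\<in>carrier (free_group n). y \<otimes>\<^bsub>free_group n\<^esub> x = \<one>\<^bsub>free_group n\<^esub>"
    using x by (intro bexI[of _ "reduce (inv_word x)"])
      (simp_all add: free_mult free_one reduce_append_left reduce_inv_word_left reduce_inv_word_in_free)
qed (auto simp: free_carrier free_one)

interpretation F: group "free_group n" for n
  by (rule free_group_group)

lemma free_inv: "w \<in> carrier (free_group n) \<Longrightarrow> inv\<^bsub>free_group n\<^esub> w = reduce (inv_word w)"
  by (rule F.inv_equality)
    (simp_all add: free_mult free_one reduce_append_left reduce_inv_word_left reduce_inv_word_in_free)

lemma gen_in_free [simp]: "i \<in> {1..n} \<Longrightarrow> gen i \<in> carrier (free_group n)"
  by (simp add: free_carrier gen_def)

lemma inv_gen: "i \<in> {1..n} \<Longrightarrow> inv\<^bsub>free_group n\<^esub> gen i = [(i, False)]"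
  by (simp add: free_inv del: atLeastAtMost_iff) (simp add: gen_def inv_word_def reduce_def)

lemma free_group_generated: "generate (free_group n) (gen ` {1..n}) = carrier (free_group n)"
proof
  show "generate (free_group n) (gen ` {1..n}) \<subseteq> carrier (free_group n)"
    by (rule F.generate_incl) auto
  show "carrier (free_group n) \<subseteq> generate (free_group n) (gen ` {1..n})"
  proof
    fix w assume "w \<in> carrier (free_group n)"
    then show "w \<in> generate (free_group n) (gen ` {1..n})"
    proof (induction w)
      case Nil
      then show ?case using generate.one[of "free_group n"] by (simp add: free_one)
    next
      case (Cons a w)
      then have w: "w \<in> carrier (free_group n)" and a: "fst a \<in> {1..n}" and red: "red (a # w)"
        by (auto simp: free_carrier successively_Cons)
      have "[a] \<in> generate (free_group n) (gen ` {1..n})"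
      proof (cases "snd a")
        case True
        then have "[a] = gen (fst a)" by (cases a) (simp add: gen_def)
        then show ?thesis using a by (auto intro: generate.incl)
      next
        case False
        then have "[a] = inv\<^bsub>free_group n\<^esub> gen (fst a)" using inv_gen[OF a] by (cases a) simp
        then show ?thesis using a by (auto intro: generate.inv)
      qed
      then have "[a] \<otimes>\<^bsub>free_group n\<^esub> w \<in> generate (free_group n) (gen ` {1..n})"
        using Cons.IH[OF w] by (rule generate.eng)
      also have "[a] \<otimes>\<^bsub>free_group n\<^esub> w = a # w" using red by (simp add: free_mult reduce_red)
      finally show ?case .
    qed
  qed
qed

lemma subgroup_equalizer:
  assumes "group_hom G H f" "group_hom G H g"
  shows "subgroup {x \<in> carrier G. f x = g x} G"
proof -
  interpret f: group_hom G H f by fact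
  interpret g: group_hom G H g by fact
  show ?thesis by (rule subgroup.intro) auto
qed

lemma free_hom_eqI:
  assumes "group_hom (free_group n) H f" "group_hom (free_group n) H g"
    and "\<And>i. i \<in> {1..n} \<Longrightarrow> f (gen i) = g (gen i)" and "w \<in> carrier (free_group n)"
  shows "f w = g w"
proof -
  have "gen ` {1..n} \<subseteq> {x \<in> carrier (free_group n). f x = g x}" using assms(3) by auto
  from F.generate_subgroup_incl[OF this subgroup_equalizer[OF assms(1,2)]] assms(4)
  show ?thesis unfolding free_group_generated by blast
qed

lemma letter_img_linv: "letter_img f (linv a) = inv_word (letter_img f a)"
  by (simp add: letter_img_def linv_def inv_word_inv_word)

lemma reduce_letter_img_push:
  "reduce (concat (map (letter_img f) (push a w))) = reduce (letter_img f a @ concat (map (letter_img f) w))"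
proof (cases w)
  case (Cons b w')
  have "reduce (letter_img f a @ inv_word (letter_img f a) @ x) = reduce x" for x
    using reduce_append_left[of "letter_img f a @ inv_word (letter_img f a)" x]
    by (simp add: reduce_inv_word_right)
  then show ?thesis using Cons by (simp add: letter_img_linv)
qed simp

lemma reduce_letter_img_reduce:
  "reduce (concat (map (letter_img f) (reduce w))) = reduce (concat (map (letter_img f) w))"
proof (induction w)
  case (Cons a w)
  have "reduce (concat (map (letter_img f) (reduce (a # w))))
      = reduce (letter_img f a @ reduce (concat (map (letter_img f) (reduce w))))"
    by (simp add: reduce_Cons reduce_letter_img_push reduce_append_right)
  then show ?case by (simp add: Cons reduce_append_right)
qed simp

lemma lift_hom_hom:
  assumes "\<And>i. i \<in> {1..n} \<Longrightarrow> fst ` set (f i) \<subseteq> {1..n}"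
  shows "lift_hom n f \<in> hom (free_group n) (free_group n)"
proof (rule homI)
  fix v w assume v: "v \<in> carrier (free_group n)" and w: "w \<in> carrier (free_group n)"
  have "fst ` set (letter_img f a) \<subseteq> {1..n}" if "a \<in> set v" for a
  proof -
    have "fst a \<in> {1..n}" using v that by (auto simp: free_carrier simp del: atLeastAtMost_iff)
    then show ?thesis using assms by (simp add: letter_img_def fst_set_inv_word del: atLeastAtMost_iff)
  qed
  then have "fst ` set (concat (map (letter_img f) v)) \<subseteq> {1..n}"
    unfolding set_concat set_map by blast
  then show "lift_hom n f v \<in> carrier (free_group n)"
    using v by (simp add: lift_hom_def reduce_in_free)
  have "reduce (v @ w) \<in> carrier (free_group n)" using F.m_closed[OF v w] by (simp add: free_mult)
  then show "lift_hom n f (v \<otimes>\<^bsub>free_group n\<^esub> w) = lift_hom n f v \<otimes>\<^bsub>free_group n\<^esub> lift_hom n f w"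
    using v w by (simp add: lift_hom_def free_mult reduce_letter_img_reduce reduce_append_left reduce_append_right)
qed

lemma lift_hom_gen: "i \<in> {1..n} \<Longrightarrow> red (f i) \<Longrightarrow> lift_hom n f (gen i) = f i"
  unfolding lift_hom_def using gen_in_free[of i n] by (simp add: gen_def letter_img_def reduce_red)

section \<open>Automorphisms of the free group\<close>

interpretation A: group "AutF n" for n
  by (rule group.AutoGroup[OF free_group_group])

lemma AutF_mem_iff: "\<phi> \<in> carrier (AutF n) \<longleftrightarrow> \<phi> \<in> hom (free_group n) (free_group n) \<and> \<phi> \<in> Bij (carrier (free_group n))"
  by (simp add: AutoGroup_def auto_def)

lemma AutF_hom: "\<phi> \<in> carrier (AutF n) \<Longrightarrow> group_hom (free_group n) (free_group n) \<phi>"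
  by (simp add: AutF_mem_iff group_hom_def group_hom_axioms_def free_group_group)

lemma AutF_closed [simp]: "\<phi> \<in> carrier (AutF n) \<Longrightarrow> w \<in> carrier (free_group n) \<Longrightarrow> \<phi> w \<in> carrier (free_group n)"
  using AutF_hom group_hom.hom_closed by metis

lemma AutF_mult_apply:
  assumes "\<phi> \<in> carrier (AutF n)" "\<psi> \<in> carrier (AutF n)" "w \<in> carrier (free_group n)"
  shows "(\<phi> \<otimes>\<^bsub>AutF n\<^esub> \<psi>) w = \<phi> (\<psi> w)"
  using assms by (simp add: AutF_mem_iff) (simp add: AutoGroup_def BijGroup_def compose_def)

lemma AutF_one_apply: "w \<in> carrier (free_group n) \<Longrightarrow> \<one>\<^bsub>AutF n\<^esub> w = w"
  by (simp add: AutoGroup_def BijGroup_def)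

lemma AutF_inv_apply:
  assumes "\<phi> \<in> carrier (AutF n)" "w \<in> carrier (free_group n)"
  shows "(inv\<^bsub>AutF n\<^esub> \<phi>) (\<phi> w) = w" "\<phi> ((inv\<^bsub>AutF n\<^esub> \<phi>) w) = w"
  using AutF_mult_apply[OF A.inv_closed[OF assms(1)] assms(1) assms(2)]
    AutF_mult_apply[OF assms(1) A.inv_closed[OF assms(1)] assms(2)] assms
  by (simp_all add: AutF_one_apply)

lemma AutF_eqI:
  assumes "\<phi> \<in> carrier (AutF n)" "\<psi> \<in> carrier (AutF n)"
    and "\<And>i. i \<in> {1..n} \<Longrightarrow> \<phi> (gen i) = \<psi> (gen i)"
  shows "\<phi> = \<psi>"
proof (rule extensionalityI)
  show "\<phi> \<in> extensional (carrier (free_group n))" "\<psi> \<in> extensional (carrier (free_group n))"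
    using assms(1,2) by (auto simp: AutF_mem_iff Bij_def)
  show "\<phi> w = \<psi> w" if "w \<in> carrier (free_group n)" for w
    using free_hom_eqI[OF AutF_hom[OF assms(1)] AutF_hom[OF assms(2)] assms(3) that] .
qed

lemma alpha_in_AutF:
  assumes "i \<in> {1..n}" "j \<in> {1..n}" "i \<noteq> j"
  shows "alpha n i j \<in> carrier (AutF n)"
    and "alpha n i j (gen i) = gen j \<otimes>\<^bsub>free_group n\<^esub> gen i \<otimes>\<^bsub>free_group n\<^esub> inv\<^bsub>free_group n\<^esub> gen j"
    and "\<And>r. r \<in> {1..n} \<Longrightarrow> r \<noteq> i \<Longrightarrow> alpha n i j (gen r) = gen r"
proof -
  let ?F = "free_group n"
  \<comment> \<open>The flag \<open>e\<close> is True for \<open>alpha\<close> and False for its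
    inverse, which conjugates by the inverse of x_j. Both composites are then shown to be the
    identity by one computation with \<open>e\<close> left free.\<close>
  define f where "f = (\<lambda>e r. if r = i then [(j, e), (i, True), (j, \<not> e)] else gen r)"
  have al: "alpha n i j = lift_hom n (f True)" unfolding alpha_def f_def by (simp cong: if_cong)
  define \<phi> where "\<phi> e = lift_hom n (f e)" for e
  have hom: "\<phi> e \<in> hom ?F ?F" for e
    unfolding \<phi>_def by (rule lift_hom_hom) (use assms in \<open>auto simp: f_def gen_def\<close>)
  have gh: "group_hom ?F ?F (\<phi> e)" for e
    using hom[of e] by (simp add: group_hom_def group_hom_axioms_def free_group_group)
  have red: "red (f e r)" for e r using assms(3) by (simp add: f_def gen_def linv_def)
  have gr: "\<phi> e (gen r) = gen r" if "r \<in> {1..n}" "r \<noteq> i" for e r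
    unfolding \<phi>_def using lift_hom_gen[OF that(1) red] that(2) by (simp add: f_def)
  define y where "y e = (if e then gen j else inv\<^bsub>?F\<^esub> gen j)" for e
  have y: "y e = [(j, e)]" for e using inv_gen[OF assms(2)] by (simp add: y_def gen_def)
  have yc: "y e \<in> carrier ?F" for e using assms by (simp add: y_def del: atLeastAtMost_iff)
  have gi: "\<phi> e (gen i) = y e \<otimes>\<^bsub>?F\<^esub> gen i \<otimes>\<^bsub>?F\<^esub> y (\<not> e)" for e
  proof -
    have "\<phi> e (gen i) = [(j, e), (i, True), (j, \<not> e)]"
      unfolding \<phi>_def using lift_hom_gen[OF assms(1) red] by (simp add: f_def)
    also have "\<dots> = reduce ((y e @ gen i) @ y (\<not> e))" using red[of e i] by (simp add: reduce_red y gen_def f_def)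
    finally show ?thesis by (simp add: free_mult reduce_append_left)
  qed
  have jy: "\<phi> e (y e') = y e'" for e e'
    using group_hom.hom_inv[OF gh[of e], of "gen j"] gr[OF assms(2), of e] assms by (auto simp: y_def)
  have yy: "y e \<otimes>\<^bsub>?F\<^esub> y (\<not> e) = \<one>\<^bsub>?F\<^esub>" for e using assms by (auto simp: y_def)
  have inv: "\<phi> e (\<phi> (\<not> e) w) = w" if w: "w \<in> carrier ?F" for e w
  proof -
    have 1: "group_hom ?F ?F (\<lambda>w. \<phi> e (\<phi> (\<not> e) w))"
      using hom_compose[OF hom[of "\<not> e"] hom[of e]] by (simp add: o_def group_hom_def group_hom_axioms_def free_group_group)
    have 2: "group_hom ?F ?F (\<lambda>w. w)" by (simp add: group_hom_def group_hom_axioms_def free_group_group hom_def)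
    interpret h: group_hom ?F ?F "\<phi> e" by (rule gh)
    show ?thesis
    proof (rule free_hom_eqI[OF 1 2 _ w])
      fix r assume r: "r \<in> {1..n}"
      show "\<phi> e (\<phi> (\<not> e) (gen r)) = gen r"
      proof (cases "r = i")
        case True
        have "\<phi> e (\<phi> (\<not> e) (gen i)) = y (\<not> e) \<otimes>\<^bsub>?F\<^esub> (y e \<otimes>\<^bsub>?F\<^esub> gen i \<otimes>\<^bsub>?F\<^esub> y (\<not> e)) \<otimes>\<^bsub>?F\<^esub> y e"
          unfolding gi[of "\<not> e"] using assms(1) yc by (simp add: jy gi del: atLeastAtMost_iff)
        also have "\<dots> = (y (\<not> e) \<otimes>\<^bsub>?F\<^esub> y (\<not> \<not> e)) \<otimes>\<^bsub>?F\<^esub> gen i \<otimes>\<^bsub>?F\<^esub> (y (\<not> e) \<otimes>\<^bsub>?F\<^esub> y (\<not> \<not> e))"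
          using assms(1) yc by (simp add: F.m_assoc del: atLeastAtMost_iff)
        also have "\<dots> = gen i" unfolding yy using assms(1) by (simp del: atLeastAtMost_iff)
        finally show ?thesis using True by simp
      next
        case False
        then show ?thesis using gr r by simp
      qed
    qed
  qed
  have bij: "bij_betw (\<phi> True) (carrier ?F) (carrier ?F)"
    by (rule bij_betw_byWitness[where f' = "\<phi> False"])
      (use inv[of _ True] inv[of _ False] group_hom.hom_closed[OF gh] in auto)
  have "\<phi> True \<in> extensional (carrier ?F)" by (simp add: \<phi>_def lift_hom_def)
  then show "alpha n i j \<in> carrier (AutF n)"
    using bij hom[of True] by (simp add: al AutF_mem_iff Bij_def \<phi>_def)
  show "alpha n i j (gen i) = gen j \<otimes>\<^bsub>?F\<^esub> gen i \<otimes>\<^bsub>?F\<^esub> inv\<^bsub>?F\<^esub> gen j"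
    using gi[of True] by (simp add: al \<phi>_def y_def)
  show "alpha n i j (gen r) = gen r" if "r \<in> {1..n}" "r \<noteq> i" for r
    using gr[OF that] by (simp add: al \<phi>_def)
qed

text \<open>In the application \<open>a\<close> and \<open>b\<close> are the corrections by which an
  automorphism moves \<open>x\<close> and \<open>y\<close>. Each commutes with what it has to pass
  and cancels against its inverse; \<open>a\<close> is never moved past \<open>x\<close>, since that
  commutator need not be negligible.\<close>

lemma (in group) gcomm_mult_central:
  assumes "a \<in> carrier G" "b \<in> carrier G" "x \<in> carrier G" "y \<in> carrier G"
    and "b \<otimes> a = a \<otimes> b" "b \<otimes> x = x \<otimes> b" "b \<otimes> gcomm G x y = gcomm G x y \<otimes> b"
    and "a \<otimes> gcomm G x y = gcomm G x y \<otimes> a" "a \<otimes> y = y \<otimes> a"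
  shows "gcomm G (a \<otimes> x) (b \<otimes> y) = gcomm G x y"
proof -
  define g where "g = gcomm G x y"
  have g: "g \<in> carrier G" using assms by (simp add: g_def)
  note com = assms(5-9)[folded g_def]
  have xy: "x \<otimes> y = g \<otimes> (y \<otimes> x)" using assms(1-4) by (simp add: g_def gcomm_def group_word_simps)
  have "(a \<otimes> x) \<otimes> (b \<otimes> y) = a \<otimes> (x \<otimes> b) \<otimes> y" using assms(1-4) by (simp add: m_assoc)
  also have "\<dots> = (a \<otimes> b) \<otimes> (x \<otimes> y)" unfolding com(2)[symmetric] using assms(1-4) by (simp add: m_assoc)
  also have "\<dots> = b \<otimes> (a \<otimes> g) \<otimes> (y \<otimes> x)" unfolding com(1)[symmetric] xy using assms(1-4) g by (simp add: m_assoc)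
  also have "\<dots> = (b \<otimes> g) \<otimes> (a \<otimes> y) \<otimes> x" unfolding com(4) using assms(1-4) g by (simp add: m_assoc)
  also have "\<dots> = g \<otimes> ((b \<otimes> y) \<otimes> (a \<otimes> x))" unfolding com(3) com(5) using assms(1-4) g by (simp add: m_assoc)
  finally have "(a \<otimes> x) \<otimes> (b \<otimes> y) \<otimes> inv ((b \<otimes> y) \<otimes> (a \<otimes> x)) = g"
    using assms(1-4) g by (metis inv_solve_right m_closed)
  then show ?thesis using assms(1-4) by (simp add: gcomm_def g_def inv_mult_group m_assoc)
qed

lemma (in group) r_coset_group_hom: "K \<lhd> G \<Longrightarrow> group_hom G (G Mod K) (\<lambda>x. K #> x)"
  by (simp add: group_hom_def group_hom_axioms_def normal.factorgroup_is_group normal.r_coset_hom_Mod)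

lemma (in group) gcomm_mult_cong_mod:
  assumes K: "K \<lhd> G" and cl: "a \<in> carrier G" "b \<in> carrier G" "x \<in> carrier G" "y \<in> carrier G"
    and "gcomm G b a \<in> K" "gcomm G b x \<in> K" "gcomm G b (gcomm G x y) \<in> K"
    and "gcomm G a (gcomm G x y) \<in> K" "gcomm G a y \<in> K"
  shows "K #> gcomm G (a \<otimes> x) (b \<otimes> y) = K #> gcomm G x y"
proof -
  interpret q: group_hom G "G Mod K" "\<lambda>x. K #> x" by (rule r_coset_group_hom[OF K])
  have c: "K #> gcomm G x y = gcomm (G Mod K) (K #> x) (K #> y)"
    if "x \<in> carrier G" "y \<in> carrier G" for x y
    unfolding gcomm_def using that q.hom_mult q.hom_inv by (metis inv_closed m_closed)
  note gc = gcomm_closed[OF cl(3,4)]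
  have "gcomm (G Mod K) ((K #> a) \<otimes>\<^bsub>G Mod K\<^esub> (K #> x)) ((K #> b) \<otimes>\<^bsub>G Mod K\<^esub> (K #> y))
      = gcomm (G Mod K) (K #> x) (K #> y)"
    by (rule q.H.gcomm_mult_central[OF q.hom_closed[OF cl(1)] q.hom_closed[OF cl(2)] q.hom_closed[OF cl(3)] q.hom_closed[OF cl(4)]
        assms(6-10)[unfolded gcomm_in_normal_iff[OF K cl(2,1)] gcomm_in_normal_iff[OF K cl(2,3)]
          gcomm_in_normal_iff[OF K cl(2) gc] gcomm_in_normal_iff[OF K cl(1) gc] gcomm_in_normal_iff[OF K cl(1,4)]
          c[OF cl(3,4)]]])
  then show ?thesis unfolding c[OF cl(3,4)] c[OF m_closed[OF cl(1,3)] m_closed[OF cl(2,4)]]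
      q.hom_mult[OF cl(1,3)] q.hom_mult[OF cl(2,4)] .
qed

lemma (in group) r_coset_eq_iff:
  assumes K: "K \<lhd> G" and "x \<in> carrier G" "y \<in> carrier G"
  shows "K #> x = K #> y \<longleftrightarrow> x \<otimes> inv y \<in> K"
proof -
  have "K #> x = K #> y \<longleftrightarrow> x \<in> K #> y"
    using assms by (metis normal_imp_subgroup rcos_self repr_independence)
  also have "\<dots> \<longleftrightarrow> x \<otimes> inv y \<in> K"
    using subgroup.rcos_module[OF normal_imp_subgroup[OF K] is_group assms(3,2)] .
  finally show ?thesis .
qed

section \<open>The Johnson filtration\<close>

lemma J_iff: "\<phi> \<in> J n s \<longleftrightarrow> \<phi> \<in> carrier (AutF n) \<and> (\<forall>w \<in> carrier (free_group n).
    Gam (free_group n) (Suc s) #>\<^bsub>free_group n\<^esub> \<phi> w = Gam (free_group n) (Suc s) #>\<^bsub>free_group n\<^esub> w)"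
proof (cases "\<phi> \<in> carrier (AutF n)")
  case True
  then have "Gam (free_group n) (Suc s) #>\<^bsub>free_group n\<^esub> \<phi> w = Gam (free_group n) (Suc s) #>\<^bsub>free_group n\<^esub> w
      \<longleftrightarrow> \<phi> w \<otimes>\<^bsub>free_group n\<^esub> inv\<^bsub>free_group n\<^esub> w \<in> Gam (free_group n) (Suc s)"
    if "w \<in> carrier (free_group n)" for w
    using F.r_coset_eq_iff[OF F.Gam_normal _ that] that by simp
  then show ?thesis using True by (simp add: J_def)
qed (simp add: J_def)

lemma subgroup_congruent_mod:
  assumes "\<phi> \<in> carrier (AutF n)" "K \<lhd> free_group n"
  shows "subgroup {w \<in> carrier (free_group n). K #>\<^bsub>free_group n\<^esub> \<phi> w = K #>\<^bsub>free_group n\<^esub> w} (free_group n)"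
proof (rule subgroup_equalizer)
  show q: "group_hom (free_group n) (free_group n Mod K) (\<lambda>w. K #>\<^bsub>free_group n\<^esub> w)"
    by (rule F.r_coset_group_hom[OF assms(2)])
  show "group_hom (free_group n) (free_group n Mod K) (\<lambda>w. K #>\<^bsub>free_group n\<^esub> \<phi> w)"
    using hom_compose[OF group_hom.homh[OF AutF_hom[OF assms(1)]] group_hom.homh[OF q]] q
    by (simp add: group_hom_def group_hom_axioms_def o_def)
qed

lemma J_subgroup: "subgroup (J n s) (AutF n)"
proof (rule subgroup.intro)
  show "J n s \<subseteq> carrier (AutF n)" by (auto simp: J_iff)
  show "\<one>\<^bsub>AutF n\<^esub> \<in> J n s" by (simp add: J_iff AutF_one_apply)
  show "\<phi> \<otimes>\<^bsub>AutF n\<^esub> \<psi> \<in> J n s" if "\<phi> \<in> J n s" "\<psi> \<in> J n s" for \<phi> \<psi>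
    using that by (auto simp: J_iff AutF_mult_apply)
  show "inv\<^bsub>AutF n\<^esub> \<phi> \<in> J n s" if "\<phi> \<in> J n s" for \<phi>
  proof -
    have \<phi>: "\<phi> \<in> carrier (AutF n)" using that by (simp add: J_iff)
    have "Gam (free_group n) (Suc s) #>\<^bsub>free_group n\<^esub> (inv\<^bsub>AutF n\<^esub> \<phi>) w = Gam (free_group n) (Suc s) #>\<^bsub>free_group n\<^esub> w"
      if w: "w \<in> carrier (free_group n)" for w
    proof -
      have "(inv\<^bsub>AutF n\<^esub> \<phi>) w \<in> carrier (free_group n)" using \<phi> w by simp
      then show ?thesis using \<open>\<phi> \<in> J n s\<close> AutF_inv_apply(2)[OF \<phi> w] unfolding J_iff by metis
    qed
    then show ?thesis using \<phi> by (simp add: J_iff)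
  qed
qed

text \<open>On a generator \<open>[x, y]\<close> of the next term, \<open>x\<close> is changed by
  \<open>a\<close> of weight \<open>s + 1\<close> and \<open>y\<close>, by induction, by
  \<open>b\<close> of weight \<open>m + s\<close>. Modulo weight \<open>m + 1 + s\<close> the
  element \<open>b\<close> is central and \<open>a\<close> commutes with \<open>y\<close> and with
  \<open>[x, y]\<close>, so the commutator is unchanged.\<close>

lemma J_acts_on_Gam:
  assumes \<psi>: "\<psi> \<in> J n s" and "0 < m" "w \<in> Gam (free_group n) m"
  shows "Gam (free_group n) (m + s) #>\<^bsub>free_group n\<^esub> \<psi> w = Gam (free_group n) (m + s) #>\<^bsub>free_group n\<^esub> w"
  using assms(2,3)
proof (induction m arbitrary: w rule: nat_induct_non_zero)
  case 1
  then show ?case using \<psi> by (simp add: J_iff)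
next
  case (Suc m)
  let ?F = "free_group n" and ?K = "Gam (free_group n) (Suc m + s)"
  have \<psi>A: "\<psi> \<in> carrier (AutF n)" using \<psi> by (simp add: J_iff)
  interpret h: group_hom ?F ?F \<psi> by (rule AutF_hom[OF \<psi>A])
  have K: "?K \<lhd> ?F" by (rule F.Gam_normal)
  have "{gcomm ?F x y | x y. x \<in> carrier ?F \<and> y \<in> Gam ?F m} \<subseteq>
      {w \<in> carrier ?F. ?K #>\<^bsub>?F\<^esub> \<psi> w = ?K #>\<^bsub>?F\<^esub> w}"
  proof clarify
    fix x y assume x: "x \<in> carrier ?F" and y: "y \<in> Gam ?F m"
    have yc: "y \<in> carrier ?F" using y by simp
    define a b where "a = \<psi> x \<otimes>\<^bsub>?F\<^esub> inv\<^bsub>?F\<^esub> x" and "b = \<psi> y \<otimes>\<^bsub>?F\<^esub> inv\<^bsub>?F\<^esub> y"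
    have ac: "a \<in> carrier ?F" "b \<in> carrier ?F" using x yc by (auto simp: a_def b_def)
    have a: "a \<in> Gam ?F (Suc s)" using \<psi> x by (simp add: J_def a_def)
    have b: "b \<in> Gam ?F (m + s)"
      using Suc.IH[OF y] yc F.r_coset_eq_iff[OF F.Gam_normal, of "\<psi> y" n y] by (simp add: b_def)
    have xy: "gcomm ?F x y \<in> Gam ?F (Suc m)" by (rule F.gcomm_Gam_Suc(1)[OF x y Suc.hyps])
    have bK: "gcomm ?F b z \<in> ?K" if "z \<in> carrier ?F" for z
      using F.gcomm_Gam_Suc(2)[OF that b] Suc.hyps by simp
    have "gcomm ?F a (gcomm ?F x y) \<in> Gam ?F (Suc s + Suc m)" by (rule F.gcomm_Gam[OF a xy]) auto
    moreover have "Gam ?F (Suc s + Suc m) \<subseteq> ?K" by (rule F.Gam_antimono) simp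
    ultimately have a1: "gcomm ?F a (gcomm ?F x y) \<in> ?K" by blast
    have a2: "gcomm ?F a y \<in> ?K" using F.gcomm_Gam[OF a y] Suc.hyps by (simp add: add.commute)
    have "?K #>\<^bsub>?F\<^esub> gcomm ?F (a \<otimes>\<^bsub>?F\<^esub> x) (b \<otimes>\<^bsub>?F\<^esub> y) = ?K #>\<^bsub>?F\<^esub> gcomm ?F x y"
      by (rule F.gcomm_mult_cong_mod[OF K ac x yc _ _ _ a1 a2]) (use bK ac x yc in auto)
    moreover have "a \<otimes>\<^bsub>?F\<^esub> x = \<psi> x" "b \<otimes>\<^bsub>?F\<^esub> y = \<psi> y" using x yc by (simp_all add: a_def b_def F.m_assoc)
    moreover have "\<psi> (gcomm ?F x y) = gcomm ?F (\<psi> x) (\<psi> y)" using x yc by (simp add: gcomm_def)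
    ultimately show "gcomm ?F x y \<in> carrier ?F \<and> ?K #>\<^bsub>?F\<^esub> \<psi> (gcomm ?F x y) = ?K #>\<^bsub>?F\<^esub> gcomm ?F x y"
      using x yc by simp
  qed
  from F.generate_subgroup_incl[OF this subgroup_congruent_mod[OF \<psi>A K]] Suc.prems
  show ?case unfolding F.Gam_Suc[OF Suc.hyps] F.comm_sub_eq by blast
qed

text \<open>It is enough that the two composites agree modulo weight \<open>s + 2\<close>. With
  \<open>a\<close> and \<open>b\<close> the displacements of \<open>w\<close> under \<phi> and
  \<psi>, of weights 2 and \<open>s + 1\<close>, applying \<phi> to \<open>b\<close> or \<psi> to
  \<open>a\<close> changes nothing modulo that weight, and \<open>a\<close> and \<open>b\<close>
  commute there.\<close>

lemma J_commutator:
  assumes \<phi>: "\<phi> \<in> J n 1" and \<psi>: "\<psi> \<in> J n s"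
  shows "gcomm (AutF n) \<phi> \<psi> \<in> J n (Suc s)"
proof -
  let ?F = "free_group n" and ?K = "Gam (free_group n) (Suc (Suc s))"
  have A: "\<phi> \<in> carrier (AutF n)" "\<psi> \<in> carrier (AutF n)" using \<phi> \<psi> by (auto simp: J_iff)
  interpret f: group_hom ?F ?F \<phi> by (rule AutF_hom[OF A(1)])
  interpret g: group_hom ?F ?F \<psi> by (rule AutF_hom[OF A(2)])
  interpret q: group_hom ?F "?F Mod ?K" "\<lambda>w. ?K #>\<^bsub>?F\<^esub> w" by (rule F.r_coset_group_hom[OF F.Gam_normal])
  have comm: "?K #>\<^bsub>?F\<^esub> \<phi> (\<psi> w) = ?K #>\<^bsub>?F\<^esub> \<psi> (\<phi> w)" if w: "w \<in> carrier ?F" for w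
  proof -
    define a b where "a = \<phi> w \<otimes>\<^bsub>?F\<^esub> inv\<^bsub>?F\<^esub> w" and "b = \<psi> w \<otimes>\<^bsub>?F\<^esub> inv\<^bsub>?F\<^esub> w"
    have c: "a \<in> carrier ?F" "b \<in> carrier ?F" using w by (auto simp: a_def b_def)
    have \<phi>w: "\<phi> w = a \<otimes>\<^bsub>?F\<^esub> w" and \<psi>w: "\<psi> w = b \<otimes>\<^bsub>?F\<^esub> w" using w by (simp_all add: a_def b_def F.m_assoc)
    have a: "a \<in> Gam ?F 2" using \<phi> w by (simp add: J_def a_def numeral_2_eq_2)
    have b: "b \<in> Gam ?F (Suc s)" using \<psi> w by (simp add: J_def b_def)
    have 1: "?K #>\<^bsub>?F\<^esub> \<phi> b = ?K #>\<^bsub>?F\<^esub> b" using J_acts_on_Gam[OF \<phi> _ b] by simp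
    have 2: "?K #>\<^bsub>?F\<^esub> \<psi> a = ?K #>\<^bsub>?F\<^esub> a" using J_acts_on_Gam[OF \<psi> _ a] by simp
    have "gcomm ?F b a \<in> ?K" using F.gcomm_Gam_Suc(2)[OF c(1) b] by simp
    then have 3: "(?K #>\<^bsub>?F\<^esub> b) \<otimes>\<^bsub>?F Mod ?K\<^esub> (?K #>\<^bsub>?F\<^esub> a) = (?K #>\<^bsub>?F\<^esub> a) \<otimes>\<^bsub>?F Mod ?K\<^esub> (?K #>\<^bsub>?F\<^esub> b)"
      using F.gcomm_in_normal_iff[OF F.Gam_normal c(2,1)] by blast
    have "\<phi> (\<psi> w) = \<phi> b \<otimes>\<^bsub>?F\<^esub> a \<otimes>\<^bsub>?F\<^esub> w" unfolding \<psi>w using c w by (simp add: \<phi>w F.m_assoc)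
    then have "?K #>\<^bsub>?F\<^esub> \<phi> (\<psi> w) = (?K #>\<^bsub>?F\<^esub> \<phi> b) \<otimes>\<^bsub>?F Mod ?K\<^esub> (?K #>\<^bsub>?F\<^esub> a) \<otimes>\<^bsub>?F Mod ?K\<^esub> (?K #>\<^bsub>?F\<^esub> w)"
      using c w by (simp only: q.hom_mult f.hom_closed F.m_closed)
    also have "\<dots> = (?K #>\<^bsub>?F\<^esub> \<psi> a) \<otimes>\<^bsub>?F Mod ?K\<^esub> (?K #>\<^bsub>?F\<^esub> b) \<otimes>\<^bsub>?F Mod ?K\<^esub> (?K #>\<^bsub>?F\<^esub> w)"
      unfolding 1 2 3 ..
    also have "\<dots> = ?K #>\<^bsub>?F\<^esub> (\<psi> a \<otimes>\<^bsub>?F\<^esub> b \<otimes>\<^bsub>?F\<^esub> w)"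
      using c w by (simp only: q.hom_mult g.hom_closed F.m_closed)
    also have "\<psi> a \<otimes>\<^bsub>?F\<^esub> b \<otimes>\<^bsub>?F\<^esub> w = \<psi> (\<phi> w)" unfolding \<phi>w using c w by (simp add: \<psi>w F.m_assoc)
    finally show ?thesis .
  qed
  have "?K #>\<^bsub>?F\<^esub> gcomm (AutF n) \<phi> \<psi> v = ?K #>\<^bsub>?F\<^esub> v" if v: "v \<in> carrier ?F" for v
  proof -
    let ?i = "inv\<^bsub>AutF n\<^esub> \<phi>" and ?j = "inv\<^bsub>AutF n\<^esub> \<psi>"
    have i: "?i \<in> carrier (AutF n)" "?j \<in> carrier (AutF n)" using A by auto
    have j: "?j v \<in> carrier ?F" "?i (?j v) \<in> carrier ?F" using i v by auto
    have "gcomm (AutF n) \<phi> \<psi> v = \<phi> (\<psi> (?i (?j v)))"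
      unfolding gcomm_def using A i v by (simp add: AutF_mult_apply)
    then show ?thesis using comm[OF j(2)] AutF_inv_apply(2)[OF A(1) j(1)] AutF_inv_apply(2)[OF A(2) v] by simp
  qed
  then show ?thesis using A by (simp add: J_iff)
qed

lemma alpha_in_J:
  assumes "i \<in> {1..n}" "j \<in> {1..n}" "i \<noteq> j"
  shows "alpha n i j \<in> J n 1"
proof -
  let ?F = "free_group n" and ?K = "Gam (free_group n) (Suc 1)"
  note al = alpha_in_AutF[OF assms]
  have "gen ` {1..n} \<subseteq> {w \<in> carrier ?F. ?K #>\<^bsub>?F\<^esub> alpha n i j w = ?K #>\<^bsub>?F\<^esub> w}"
  proof clarify
    fix r assume r: "r \<in> {1..n}"
    have "alpha n i j (gen r) \<otimes>\<^bsub>?F\<^esub> inv\<^bsub>?F\<^esub> gen r \<in> ?K"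
    proof (cases "r = i")
      case True
      have "alpha n i j (gen r) \<otimes>\<^bsub>?F\<^esub> inv\<^bsub>?F\<^esub> gen r = gcomm ?F (gen j) (gen i)"
        using al(2) True by (simp add: gcomm_def)
      then show ?thesis using F.gcomm_Gam_Suc(1)[of "gen j" n "gen i" 1] assms by simp
    next
      case False
      then have "alpha n i j (gen r) \<otimes>\<^bsub>?F\<^esub> inv\<^bsub>?F\<^esub> gen r = \<one>\<^bsub>?F\<^esub>" using al(3) r by simp
      then show ?thesis using subgroup.one_closed[OF F.Gam_subgroup] by metis
    qed
    then show "gen r \<in> carrier ?F \<and> ?K #>\<^bsub>?F\<^esub> alpha n i j (gen r) = ?K #>\<^bsub>?F\<^esub> gen r"
      using F.r_coset_eq_iff[OF F.Gam_normal, of "alpha n i j (gen r)" n "gen r"] AutF_closed[OF al(1)] gen_in_free[OF r]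
      by blast
  qed
  from F.generate_subgroup_incl[OF this subgroup_congruent_mod[OF al(1) F.Gam_normal]]
  show ?thesis unfolding free_group_generated J_iff using al(1) by blast
qed

lemma PSigma_subgroup: "subgroup (PSigma_set n) (AutF n)"
  unfolding PSigma_set_def by (rule A.generate_is_subgroup) (auto intro!: alpha_in_AutF)

lemma PSigma_group: "group (PSigma n)"
  unfolding PSigma_def by (rule A.subgroup_imp_group[OF PSigma_subgroup])

lemma PSigma_set_subset_J: "PSigma_set n \<subseteq> J n 1"
  unfolding PSigma_set_def
proof (rule A.generate_subgroup_incl[OF _ J_subgroup], clarify)
  fix i j :: nat assume "1 \<le> j" "j < i" "i \<le> n"
  then show "alpha n i j \<in> J n 1" by (intro alpha_in_J) auto
qed

text \<open>This inclusion is what makes the arrow from the descending central series quotients to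
  the Johnson quotients exist.\<close>

lemma Gam_PSigma_subset_J:
  assumes "0 < s"
  shows "Gam (PSigma n) s \<subseteq> J n s"
  using assms
proof (induction s rule: nat_induct_non_zero)
  case 1
  show ?case using PSigma_set_subset_J by (simp add: PSigma_def)
next
  case (Suc s)
  interpret P: group "PSigma n" by (rule PSigma_group)
  have cP: "carrier (PSigma n) = PSigma_set n" by (simp add: PSigma_def)
  \<comment> \<open>The series is formed inside \<open>PSigma\<close> but the filtration inside
    \<open>AutF\<close>; commutators, and below also generated subgroups, have to be identified
    across the two groups.\<close>
  have eq: "gcomm (PSigma n) a b = gcomm (AutF n) a b" if "a \<in> PSigma_set n" "b \<in> PSigma_set n" for a b
    unfolding gcomm_def PSigma_def using A.m_inv_consistent[OF PSigma_subgroup] that by simp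
  let ?B = "{gcomm (PSigma n) a b | a b. a \<in> carrier (PSigma n) \<and> b \<in> Gam (PSigma n) s}"
  have B: "?B \<subseteq> J n (Suc s)"
  proof clarify
    fix a b assume a: "a \<in> carrier (PSigma n)" and b: "b \<in> Gam (PSigma n) s"
    have "b \<in> carrier (PSigma n)" using b by simp
    then have "gcomm (PSigma n) a b = gcomm (AutF n) a b" using eq a unfolding cP by blast
    moreover have "a \<in> J n 1" "b \<in> J n s" using a b PSigma_set_subset_J Suc.IH unfolding cP by blast+
    ultimately show "gcomm (PSigma n) a b \<in> J n (Suc s)" using J_commutator by simp
  qed
  have "?B \<subseteq> PSigma_set n" using P.gcomm_closed P.Gam_carrier cP by blast
  then have "generate (PSigma n) ?B = generate (AutF n) ?B"
    unfolding PSigma_def using A.generate_consistent[OF _ PSigma_subgroup] by blast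
  then show ?case
    unfolding P.Gam_Suc[OF Suc.hyps] P.comm_sub_eq using A.generate_subgroup_incl[OF B J_subgroup] by simp
qed

section \<open>The Magnus expansion\<close>

definition Mag :: "fword \<Rightarrow> ncps" where
  "Mag w = Ncps (magnus w)"

definition mag :: "nat \<times> bool \<Rightarrow> ncps" where
  "mag a = Ncps (mag_letter a)"

lemma cf_Mag: "cf (Mag w) = magnus w"
  by (simp add: Mag_def Ncps_inverse)

lemma cf_mag: "cf (mag a) = mag_letter a"
  by (simp add: mag_def Ncps_inverse)

lemma Mag_Nil [simp]: "Mag [] = 1"
  by (rule ncps_eqI) (simp add: cf_Mag magnus_def cf_one)

lemma Mag_Cons: "Mag (a # w) = mag a * Mag w"
  by (rule ncps_eqI) (simp add: cf_Mag cf_mult cf_mag, simp add: magnus_def)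

lemma mag_True: "mag (i, True) = 1 + nmon [i]"
  by (rule ncps_eqI) (auto simp: cf_mag mag_letter_def cf_add cf_one cf_nmon tmono_def)

lemma cf_nmon_mult: "cf (nmon [i] * a) w = (case w of [] \<Rightarrow> 0 | c # v \<Rightarrow> if c = i then cf a v else 0)"
proof (cases w)
  case Nil
  then show ?thesis by (simp add: cf_mult tmul_def cf_nmon tmono_def)
next
  case (Cons c v)
  show ?thesis
  proof (cases "c = i")
    case True
    then show ?thesis using Cons cf_nmon_mult_Cons by simp
  next
    case False
    have "cf (nmon [i] * a) w = 0"
      unfolding cf_mult tmul_def cf_nmon
    proof (rule sum.neutral, rule ballI)
      fix k
      show "tmono [i] (take k w) * cf a (drop k w) = 0"
        using False Cons by (cases k) (auto simp: tmono_def)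
    qed
    then show ?thesis using False Cons by simp
  qed
qed

lemma cf_mult_nmon_snoc: "cf (a * nmon [i]) (v @ [c]) = (if c = i then cf a v else 0)"
proof -
  have "cf (a * nmon [i]) (v @ [c]) = (\<Sum>k\<le>Suc (length v). if k = length v then (if c = i then cf a v else 0) else 0)"
    unfolding cf_mult tmul_def cf_nmon length_append_singleton
  proof (rule sum.cong[OF refl])
    fix k assume k: "k \<in> {..Suc (length v)}"
    show "cf a (take k (v @ [c])) * tmono [i] (drop k (v @ [c])) =
        (if k = length v then if c = i then cf a v else 0 else 0)"
    proof (cases "k = length v")
      case False
      then have "length (drop k (v @ [c])) \<noteq> length [i]" using k by auto
      then have "drop k (v @ [c]) \<noteq> [i]" by metis
      then show ?thesis using False by (simp add: tmono_def)
    qed (auto simp: tmono_def)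
  qed
  then show ?thesis by simp
qed

lemma mag_inverse: "(1 + nmon [i]) * mag (i, False) = 1" "mag (i, False) * (1 + nmon [i]) = 1"
proof -
  have c: "cf (mag (i, False)) u = (if \<forall>c\<in>set u. c = i then (-1) ^ length u else 0)" for u
    by (simp add: cf_mag mag_letter_def)
  show "(1 + nmon [i]) * mag (i, False) = 1"
  proof (rule ncps_eqI)
    fix w show "cf ((1 + nmon [i]) * mag (i, False)) w = cf 1 w"
      by (cases w) (auto simp: distrib_right cf_add cf_nmon_mult c cf_one tmono_def)
  qed
  show "mag (i, False) * (1 + nmon [i]) = 1"
  proof (rule ncps_eqI)
    fix w show "cf (mag (i, False) * (1 + nmon [i])) w = cf 1 w"
    proof (cases w rule: rev_cases)
      case Nil
      then show ?thesis by (simp add: distrib_left cf_add c cf_one tmono_def cf_mult[of _ "nmon [i]"] tmul_def cf_nmon)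
    next
      case (snoc v x)
      then show ?thesis by (auto simp: distrib_left cf_add cf_mult_nmon_snoc c cf_one tmono_def)
    qed
  qed
qed

lemma mag_linv: "mag a * mag (linv a) = 1"
  using mag_inverse[of "fst a"] by (cases a; cases "snd a") (auto simp: linv_def mag_True)

text \<open>A cancelling pair contributes \<open>mag a * mag (linv a) = 1\<close>, so the Magnus
  expansion survives free reduction and is multiplicative on the free group.\<close>

lemma Mag_push: "Mag (push a w) = mag a * Mag w"
proof (cases w)
  case (Cons b v)
  then show ?thesis using mag_linv[of a] by (auto simp: Mag_Cons mult.assoc[symmetric])
qed (simp add: Mag_Cons)

lemma Mag_reduce: "Mag (reduce w) = Mag w"
  by (induction w) (auto simp: reduce_Cons Mag_push Mag_Cons)

lemma Mag_append: "Mag (v @ w) = Mag v * Mag w"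
  by (induction v) (auto simp: Mag_Cons mult.assoc)

lemma Mag_mult: "Mag (v \<otimes>\<^bsub>free_group n\<^esub> w) = Mag v * Mag w"
  by (simp add: free_mult Mag_reduce Mag_append)

lemma Mag_inv: "w \<in> carrier (free_group n) \<Longrightarrow> Mag w * Mag (inv\<^bsub>free_group n\<^esub> w) = 1"
  using Mag_mult[of n w "inv\<^bsub>free_group n\<^esub> w"] by (simp add: free_one)

lemma leads_gen: "leads (Suc 0) (Mag (gen i)) (nmon [i])"
  by (simp add: gen_def Mag_Cons mag_True leads_def homog_nmon_single ordp_zero)

section \<open>Conjugating words and their leading terms\<close>

lemma free_group_mono:
  assumes "l \<le> n"
  shows "carrier (free_group l) \<subseteq> carrier (free_group n)"
  using assms by (force simp: free_carrier)

lemma free_inv_mono: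
  assumes "l \<le> n" "w \<in> carrier (free_group l)"
  shows "inv\<^bsub>free_group n\<^esub> w = inv\<^bsub>free_group l\<^esub> w"
  using assms free_group_mono[OF assms(1)] by (auto simp: free_inv)

lemma free_mult_mono: "v \<otimes>\<^bsub>free_group l\<^esub> w = v \<otimes>\<^bsub>free_group n\<^esub> w"
  by (simp add: free_mult)

text \<open>Besides the leading term itself, two invariants travel along: the support bound, needed
  to differentiate and to read off coefficients, and membership in the Lie ring, needed to land in
  \<open>DerDeg\<close>. The latter uses \<open>n\<close> because the target is built from all of
  V_n.\<close>

definition wlead :: "nat \<Rightarrow> nat \<Rightarrow> nat \<Rightarrow> fword \<Rightarrow> ncps \<Rightarrow> bool" where
  "wlead n l s w A \<longleftrightarrow> w \<in> carrier (free_group l) \<and> leads s (Mag w) A \<and> supp {1..l} A \<and> cf A \<in> lie_el n"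

lemma wlead_mult:
  assumes "wlead n l s v A" "wlead n l s w B" "0 < s"
  shows "wlead n l s (v \<otimes>\<^bsub>free_group l\<^esub> w) (A + B)"
  using assms by (auto simp: wlead_def Mag_mult intro: leads_mult supp_add lie_el_add)

lemma wlead_inv:
  assumes "wlead n l s w A" "0 < s"
  shows "wlead n l s (inv\<^bsub>free_group l\<^esub> w) (- A)"
  using assms leads_inverse[of s "Mag w" A "Mag (inv\<^bsub>free_group l\<^esub> w)"]
  by (auto simp: wlead_def Mag_inv intro: supp_minus lie_el_minus)

lemma wlead_one: "wlead n l s [] 0"
  by (simp add: wlead_def free_carrier leads_def homog_zero ordp_zero supp_zero lie_el_zero)

lemma wlead_gcomm:
  assumes "wlead n l p v A" "wlead n l q w B" "0 < p" "0 < q"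
  shows "wlead n l (p + q) (gcomm (free_group l) v w) (bra A B)"
  using assms leads_commutator[of p "Mag v" A q "Mag w" B "Mag (inv\<^bsub>free_group l\<^esub> v)" "Mag (inv\<^bsub>free_group l\<^esub> w)"]
  by (auto simp: wlead_def gcomm_def Mag_mult Mag_inv intro: supp_bra lie_el_bra)

lemma wlead_weaken: "wlead n l (Suc s) w A \<Longrightarrow> wlead n l s w 0"
  by (auto simp: wlead_def supp_zero lie_el_zero intro: leads_weaken)

lemma wlead_gen: "a \<in> {1..l} \<Longrightarrow> l \<le> n \<Longrightarrow> wlead n l (Suc 0) (gen a) (nmon [a])"
  unfolding wlead_def using leads_gen lie_el_nmon[of a n] gen_in_free[of a l]
  by (auto simp: supp_def cf_nmon tmono_def)

text \<open>Composition of automorphisms reverses the conjugators of \<open>x\<^sub>m \<mapsto> w x\<^sub>m w\<^sup>-\<^sup>1\<close>; with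
  \<open>w\<^sup>-\<^sup>1\<close> on the left, \<open>\<phi>\<close> and \<open>w\<close> multiply in the same order.\<close>

definition conjrep :: "nat \<Rightarrow> nat \<Rightarrow> nat \<Rightarrow> (fword \<Rightarrow> fword) \<Rightarrow> fword \<Rightarrow> bool" where
  "conjrep n l m \<phi> w \<longleftrightarrow> \<phi> \<in> carrier (AutF n) \<and> w \<in> carrier (free_group l)
    \<and> \<phi> (gen m) = inv\<^bsub>free_group n\<^esub> w \<otimes>\<^bsub>free_group n\<^esub> gen m \<otimes>\<^bsub>free_group n\<^esub> w
    \<and> (\<forall>r\<in>{1..n}. r \<noteq> m \<longrightarrow> \<phi> (gen r) = gen r)"

text \<open>\<phi> is compared with the inclusion, both regarded as homomorphisms from
  \<open>free_group l\<close> to \<open>free_group n\<close>, so that agreement on the first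
  \<open>l\<close> generators is enough.\<close>

lemma AutF_fixes:
  assumes "\<phi> \<in> carrier (AutF n)" "l \<le> n" "\<And>r. r \<in> {1..l} \<Longrightarrow> \<phi> (gen r) = gen r" "v \<in> carrier (free_group l)"
  shows "\<phi> v = v"
proof (rule free_hom_eqI[where H = "free_group n" and g = "\<lambda>w. w", OF _ _ assms(3,4)])
  note sub = free_group_mono[OF assms(2)]
  interpret h: group_hom "free_group n" "free_group n" \<phi> by (rule AutF_hom[OF assms(1)])
  show "group_hom (free_group l) (free_group n) \<phi>"
    using sub h.hom_mult h.hom_closed
    by (auto simp: group_hom_def group_hom_axioms_def free_group_group hom_def subset_iff free_mult_mono[of l _ _ n])
  show "group_hom (free_group l) (free_group n) (\<lambda>w. w)"
    using sub by (auto simp: group_hom_def group_hom_axioms_def free_group_group hom_def free_mult_mono[of l _ _ n])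
qed

lemma conjrep_fixes:
  assumes "conjrep n l m \<phi> w" "l < m" "m \<le> n" "v \<in> carrier (free_group l)"
  shows "\<phi> v = v"
  by (rule AutF_fixes[where l = l and n = n]) (use assms in \<open>auto simp: conjrep_def\<close>)

lemma conjrep_one: "m \<in> {1..n} \<Longrightarrow> conjrep n l m \<one>\<^bsub>AutF n\<^esub> []"
  unfolding conjrep_def using F.one_closed[of l] F.one_closed[of n] F.inv_one[of n] gen_in_free[of _ n]
  by (simp add: AutF_one_apply free_one[symmetric, of n] del: atLeastAtMost_iff) (simp add: free_carrier free_one)

lemma conjrep_mult:
  assumes "conjrep n l m \<phi> w" "conjrep n l m \<psi> v" "l < m" "m \<le> n"
  shows "conjrep n l m (\<phi> \<otimes>\<^bsub>AutF n\<^esub> \<psi>) (w \<otimes>\<^bsub>free_group l\<^esub> v)"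
proof -
  let ?F = "free_group n"
  have A: "\<phi> \<in> carrier (AutF n)" "\<psi> \<in> carrier (AutF n)" using assms by (auto simp: conjrep_def)
  have c: "w \<in> carrier (free_group l)" "v \<in> carrier (free_group l)" using assms by (auto simp: conjrep_def)
  have ln: "l \<le> n" and m: "m \<in> {1..n}" using assms by auto
  have c': "w \<in> carrier ?F" "v \<in> carrier ?F" using c free_group_mono[OF ln] by auto
  interpret h: group_hom ?F ?F \<phi> by (rule AutF_hom[OF A(1)])
  have "\<phi> (\<psi> (gen m)) = \<phi> (inv\<^bsub>?F\<^esub> v \<otimes>\<^bsub>?F\<^esub> gen m \<otimes>\<^bsub>?F\<^esub> v)" using assms by (simp add: conjrep_def)
  \<comment> \<open>\<phi> fixes the conjugator \<open>v\<close>, whose letters are all below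
    \<open>m\<close>, and acts only on the middle letter.\<close>
  also have "\<dots> = inv\<^bsub>?F\<^esub> v \<otimes>\<^bsub>?F\<^esub> (inv\<^bsub>?F\<^esub> w \<otimes>\<^bsub>?F\<^esub> gen m \<otimes>\<^bsub>?F\<^esub> w) \<otimes>\<^bsub>?F\<^esub> v"
    using c' m conjrep_fixes[OF assms(1,3,4) c(2)] assms(1) by (simp add: conjrep_def del: atLeastAtMost_iff)
  also have "\<dots> = inv\<^bsub>?F\<^esub> (w \<otimes>\<^bsub>?F\<^esub> v) \<otimes>\<^bsub>?F\<^esub> gen m \<otimes>\<^bsub>?F\<^esub> (w \<otimes>\<^bsub>?F\<^esub> v)"
    using c' m by (simp add: F.m_assoc F.inv_mult_group del: atLeastAtMost_iff)
  finally show ?thesis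
    using assms A c m F.m_closed[OF c, unfolded free_mult_mono[of l w v n]] unfolding conjrep_def
    by (simp add: AutF_mult_apply free_mult_mono[of l w v n] del: atLeastAtMost_iff)
qed

lemma conjrep_inv:
  assumes "conjrep n l m \<phi> w" "l < m" "m \<le> n"
  shows "conjrep n l m (inv\<^bsub>AutF n\<^esub> \<phi>) (inv\<^bsub>free_group l\<^esub> w)"
proof -
  let ?F = "free_group n"
  have A: "\<phi> \<in> carrier (AutF n)" and c: "w \<in> carrier (free_group l)" using assms by (auto simp: conjrep_def)
  have ln: "l \<le> n" and m: "m \<in> {1..n}" using assms by auto
  have c': "w \<in> carrier ?F" using c free_group_mono[OF ln] by auto
  interpret h: group_hom ?F ?F \<phi> by (rule AutF_hom[OF A])
  let ?i = "inv\<^bsub>AutF n\<^esub> \<phi>" and ?g = "w \<otimes>\<^bsub>?F\<^esub> gen m \<otimes>\<^bsub>?F\<^esub> inv\<^bsub>?F\<^esub> w"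
  have "\<phi> ?g = w \<otimes>\<^bsub>?F\<^esub> (inv\<^bsub>?F\<^esub> w \<otimes>\<^bsub>?F\<^esub> gen m \<otimes>\<^bsub>?F\<^esub> w) \<otimes>\<^bsub>?F\<^esub> inv\<^bsub>?F\<^esub> w"
    using c' m conjrep_fixes[OF assms c] assms(1) by (simp add: conjrep_def del: atLeastAtMost_iff)
  also have "\<dots> = gen m" using c' m by (simp add: F.group_word_simps del: atLeastAtMost_iff)
  finally have 1: "?i (gen m) = ?g" using AutF_inv_apply(1)[OF A, of ?g] c' m by (simp del: atLeastAtMost_iff)
  have 2: "?i (gen r) = gen r" if "r \<in> {1..n}" "r \<noteq> m" for r
    using AutF_inv_apply(1)[OF A, of "gen r"] that assms(1) by (simp add: conjrep_def del: atLeastAtMost_iff)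
  have 3: "inv\<^bsub>?F\<^esub> (inv\<^bsub>free_group l\<^esub> w) = w" using F.inv_inv[OF c'] unfolding free_inv_mono[OF ln c] .
  show ?thesis
    unfolding conjrep_def 3 using A c 1[unfolded free_inv_mono[OF ln c]] 2 by simp
qed

lemma conjrep_gcomm:
  assumes "conjrep n l m \<phi> w" "conjrep n l m \<psi> v" "l < m" "m \<le> n"
  shows "conjrep n l m (gcomm (AutF n) \<phi> \<psi>) (gcomm (free_group l) w v)"
  unfolding gcomm_def by (intro conjrep_mult conjrep_inv assms)

text \<open>\<open>alpha\<close> has x_a on the left of x_m, where \<open>conjrep\<close> expects
  the inverse of the conjugator; hence the conjugator is the inverse of x_a, with leading term
  -X_a.\<close>

lemma conjrep_alpha:
  assumes "a \<in> {1..l}" "l < m" "m \<le> n"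
  shows "conjrep n l m (alpha n m a) (inv\<^bsub>free_group l\<^esub> gen a)"
proof -
  have a: "m \<in> {1..n}" "a \<in> {1..n}" "m \<noteq> a" using assms by auto
  have ln: "l \<le> n" using assms by simp
  note al = alpha_in_AutF[OF a]
  have ga: "gen a \<in> carrier (free_group l)" "gen a \<in> carrier (free_group n)" using a assms by auto
  have "inv\<^bsub>free_group n\<^esub> (inv\<^bsub>free_group l\<^esub> gen a) = gen a"
    using F.inv_inv[OF ga(2)] unfolding free_inv_mono[OF ln ga(1)] .
  then show ?thesis unfolding conjrep_def
    using al(1,3) al(2)[unfolded free_inv_mono[OF ln ga(1)]] ga by simp
qed

section \<open>The graded monomorphism\<close>

lemma DerDeg_comm_group: "comm_group (DerDeg n s)"
proof (rule comm_groupI)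
  fix x y z assume x: "x \<in> carrier (DerDeg n s)" and y: "y \<in> carrier (DerDeg n s)"
  show "x \<otimes>\<^bsub>DerDeg n s\<^esub> y \<in> carrier (DerDeg n s)"
    using x y by (auto simp: DerDeg_def lie_deg_def intro!: lie_el.add)
  show "x \<otimes>\<^bsub>DerDeg n s\<^esub> y \<otimes>\<^bsub>DerDeg n s\<^esub> z = x \<otimes>\<^bsub>DerDeg n s\<^esub> (y \<otimes>\<^bsub>DerDeg n s\<^esub> z)"
    "x \<otimes>\<^bsub>DerDeg n s\<^esub> y = y \<otimes>\<^bsub>DerDeg n s\<^esub> x" "\<one>\<^bsub>DerDeg n s\<^esub> \<otimes>\<^bsub>DerDeg n s\<^esub> x = x"
    by (simp_all add: DerDeg_def ac_simps)
  show "\<exists>y\<in>carrier (DerDeg n s). y \<otimes>\<^bsub>DerDeg n s\<^esub> x = \<one>\<^bsub>DerDeg n s\<^esub>"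
    using x by (intro bexI[of _ "\<lambda>i w. - x i w"]) (auto simp: DerDeg_def lie_deg_def intro!: lie_el.neg)
qed (auto simp: DerDeg_def lie_deg_def lie_el.zero)

lemma DerDeg_group: "group (DerDeg n s)"
  using DerDeg_comm_group comm_group.axioms(2) by blast

lemma DerDeg_mult: "d \<otimes>\<^bsub>DerDeg n s\<^esub> e = (\<lambda>i w. d i w + e i w)"
  and DerDeg_one: "\<one>\<^bsub>DerDeg n s\<^esub> = (\<lambda>i w. 0)"
  by (simp_all add: DerDeg_def)

section \<open>The group H(n,k) and the leading terms of its elements\<close>

context
  fixes n k :: nat
  assumes k2: "2 \<le> k" and kn: "k \<le> n"
  notes One_nat_def [simp del]
begin

abbreviation (input) "HH \<equiv> Hgrp n k"

lemma ltk: "m \<in> {k..n} \<Longrightarrow> k - 1 < m" "m \<in> {k..n} \<Longrightarrow> m \<le> n" "m \<in> {k..n} \<Longrightarrow> m \<in> {1..n}"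
  using k2 by auto

lemma Gsub_subgroup:
  assumes "m \<in> {k..n}"
  shows "subgroup (carrier (Gsub n m (k - 1))) (AutF n)"
proof -
  have "{alpha n m a | a. 1 \<le> a \<and> a \<le> k - 1} \<subseteq> carrier (AutF n)"
  proof clarify
    fix a assume "1 \<le> a" "a \<le> k - 1"
    then show "alpha n m a \<in> carrier (AutF n)"
      using assms k2 by (intro alpha_in_AutF) auto
  qed
  then show ?thesis using A.generate_is_subgroup by (simp add: Gsub_def)
qed

lemma Gsub_eq: "Gsub n m (k - 1) = (AutF n)\<lparr>carrier := carrier (Gsub n m (k - 1))\<rparr>"
  by (simp add: Gsub_def)

lemma Gsub_group: "m \<in> {k..n} \<Longrightarrow> group (Gsub n m (k - 1))"
  using A.subgroup_imp_group[OF Gsub_subgroup] Gsub_eq by metis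

lemma Gsub_mult: "x \<otimes>\<^bsub>Gsub n m (k - 1)\<^esub> y = x \<otimes>\<^bsub>AutF n\<^esub> y"
  by (simp add: Gsub_def)

lemma Gsub_one: "\<one>\<^bsub>Gsub n m (k - 1)\<^esub> = \<one>\<^bsub>AutF n\<^esub>"
  by (simp add: Gsub_def)

lemma Gsub_inv:
  "m \<in> {k..n} \<Longrightarrow> x \<in> carrier (Gsub n m (k - 1)) \<Longrightarrow> inv\<^bsub>Gsub n m (k - 1)\<^esub> x = inv\<^bsub>AutF n\<^esub> x"
  by (subst Gsub_eq, rule A.m_inv_consistent[OF Gsub_subgroup])

lemma Hgrp_group: "group HH"
  unfolding Hgrp_def by (rule product_group) (rule Gsub_group)

interpretation H: group HH
  by (rule Hgrp_group)

lemma Hgrp_carrier: "carrier HH = (\<Pi>\<^sub>E m\<in>{k..n}. carrier (Gsub n m (k - 1)))"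
  by (simp add: Hgrp_def)

lemma Hgrp_mult: "x \<otimes>\<^bsub>HH\<^esub> y = (\<lambda>m\<in>{k..n}. x m \<otimes>\<^bsub>AutF n\<^esub> y m)"
  by (simp add: Hgrp_def Gsub_mult)

lemma Hgrp_one: "\<one>\<^bsub>HH\<^esub> = (\<lambda>m\<in>{k..n}. \<one>\<^bsub>AutF n\<^esub>)"
  by (simp add: Hgrp_def Gsub_one)

lemma Hgrp_inv: "x \<in> carrier HH \<Longrightarrow> inv\<^bsub>HH\<^esub> x = (\<lambda>m\<in>{k..n}. inv\<^bsub>AutF n\<^esub> x m)"
  unfolding Hgrp_def using Gsub_group Gsub_inv
  by (subst inv_product_group) (auto simp: PiE_iff intro!: restrict_ext)

lemma Hgrp_in_AutF: "x \<in> carrier HH \<Longrightarrow> m \<in> {k..n} \<Longrightarrow> x m \<in> carrier (AutF n)"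
  using subgroup.mem_carrier[OF Gsub_subgroup] by (auto simp: Hgrp_carrier PiE_iff)

lemma Hgrp_gcomm:
  assumes "x \<in> carrier HH" "y \<in> carrier HH" "m \<in> {k..n}"
  shows "gcomm HH x y m = gcomm (AutF n) (x m) (y m)"
  using assms unfolding gcomm_def by (simp add: Hgrp_mult Hgrp_inv)

text \<open>One leading term per factor of H(n,k). The conjugating words are existential, so the
  calculus needs no coherent choice of them.\<close>

definition hlead :: "nat \<Rightarrow> (nat \<Rightarrow> fword \<Rightarrow> fword) \<Rightarrow> (nat \<Rightarrow> ncps) \<Rightarrow> bool" where
  "hlead s h A \<longleftrightarrow> h \<in> carrier HH \<and>
    (\<forall>m\<in>{k..n}. \<exists>w. conjrep n (k - 1) m (h m) w \<and> wlead n (k - 1) s w (A m))"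

lemma hlead_mult:
  assumes "hlead s x A" "hlead s y B" "0 < s"
  shows "hlead s (x \<otimes>\<^bsub>HH\<^esub> y) (\<lambda>m. A m + B m)"
  unfolding hlead_def
proof (intro conjI ballI)
  show "x \<otimes>\<^bsub>HH\<^esub> y \<in> carrier HH" using assms by (simp add: hlead_def)
  fix m assume m: "m \<in> {k..n}"
  obtain v w where "conjrep n (k - 1) m (x m) v" "wlead n (k - 1) s v (A m)"
    "conjrep n (k - 1) m (y m) w" "wlead n (k - 1) s w (B m)"
    using assms m unfolding hlead_def by meson
  moreover have "(x \<otimes>\<^bsub>HH\<^esub> y) m = x m \<otimes>\<^bsub>AutF n\<^esub> y m" using m by (simp add: Hgrp_mult)
  ultimately show "\<exists>w. conjrep n (k - 1) m ((x \<otimes>\<^bsub>HH\<^esub> y) m) w \<and> wlead n (k - 1) s w (A m + B m)"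
    using conjrep_mult[OF _ _ ltk(1,2)[OF m]] wlead_mult[OF _ _ assms(3)] by metis
qed

lemma hlead_inv:
  assumes "hlead s x A" "0 < s"
  shows "hlead s (inv\<^bsub>HH\<^esub> x) (\<lambda>m. - A m)"
  unfolding hlead_def
proof (intro conjI ballI)
  have x: "x \<in> carrier HH" using assms by (simp add: hlead_def)
  then show "inv\<^bsub>HH\<^esub> x \<in> carrier HH" by simp
  fix m assume m: "m \<in> {k..n}"
  obtain v where "conjrep n (k - 1) m (x m) v" "wlead n (k - 1) s v (A m)"
    using assms m unfolding hlead_def by meson
  moreover have "(inv\<^bsub>HH\<^esub> x) m = inv\<^bsub>AutF n\<^esub> x m" using m x by (simp add: Hgrp_inv)
  ultimately show "\<exists>w. conjrep n (k - 1) m ((inv\<^bsub>HH\<^esub> x) m) w \<and> wlead n (k - 1) s w (- A m)"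
    using conjrep_inv[OF _ ltk(1,2)[OF m]] wlead_inv[OF _ assms(2)] by metis
qed

lemma hlead_one: "hlead s \<one>\<^bsub>HH\<^esub> (\<lambda>m. 0)"
  unfolding hlead_def
proof (intro conjI ballI)
  fix m assume m: "m \<in> {k..n}"
  show "\<exists>w. conjrep n (k - 1) m (\<one>\<^bsub>HH\<^esub> m) w \<and> wlead n (k - 1) s w 0"
    using conjrep_one[OF ltk(3)[OF m]] wlead_one m by (simp add: Hgrp_one) blast
qed simp

lemma hlead_gcomm:
  assumes "hlead p x A" "hlead q y B" "0 < p" "0 < q"
  shows "hlead (p + q) (gcomm HH x y) (\<lambda>m. bra (A m) (B m))"
  unfolding hlead_def
proof (intro conjI ballI)
  have x: "x \<in> carrier HH" "y \<in> carrier HH" using assms by (auto simp: hlead_def)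
  then show "gcomm HH x y \<in> carrier HH" by simp
  fix m assume m: "m \<in> {k..n}"
  obtain v w where "conjrep n (k - 1) m (x m) v" "wlead n (k - 1) p v (A m)"
    "conjrep n (k - 1) m (y m) w" "wlead n (k - 1) q w (B m)"
    using assms m unfolding hlead_def by meson
  then show "\<exists>w. conjrep n (k - 1) m (gcomm HH x y m) w \<and> wlead n (k - 1) (p + q) w (bra (A m) (B m))"
    unfolding Hgrp_gcomm[OF x m] using conjrep_gcomm wlead_gcomm[OF _ _ assms(3,4)] ltk[OF m] by blast
qed

lemma hlead_weaken: "hlead (Suc s) h A \<Longrightarrow> hlead s h (\<lambda>m. 0)"
  unfolding hlead_def using wlead_weaken by blast

lemma Gsub_lead:
  assumes m: "m \<in> {k..n}" and \<phi>: "\<phi> \<in> carrier (Gsub n m (k - 1))"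
  shows "\<exists>A w. conjrep n (k - 1) m \<phi> w \<and> wlead n (k - 1) (Suc 0) w A"
proof -
  note lt = ltk[OF m]
  have al: "conjrep n (k - 1) m (alpha n m a) (inv\<^bsub>free_group (k - 1)\<^esub> gen a)
      \<and> wlead n (k - 1) (Suc 0) (inv\<^bsub>free_group (k - 1)\<^esub> gen a) (- nmon [a])" if "1 \<le> a" "a \<le> k - 1" for a
    using conjrep_alpha[OF _ lt(1,2)] wlead_inv[OF wlead_gen] that lt by auto
  have "\<phi> \<in> generate (AutF n) {alpha n m a | a. 1 \<le> a \<and> a \<le> k - 1}" using \<phi> by (simp add: Gsub_def)
  then show ?thesis
  proof (induction rule: generate.induct)
    case one
    then show ?case using conjrep_one[OF lt(3)] wlead_one by blast
  next
    case (incl h)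
    then show ?case using al by blast
  next
    case (inv h)
    then obtain a where a: "h = alpha n m a" "1 \<le> a" "a \<le> k - 1" by blast
    show ?case unfolding a(1) using conjrep_inv[OF conjunct1[OF al[OF a(2,3)]] lt(1,2)]
        wlead_inv[OF conjunct2[OF al[OF a(2,3)]]] by blast
  next
    case (eng h1 h2)
    then show ?case using conjrep_mult[OF _ _ lt(1,2)] wlead_mult by blast
  qed
qed

lemma hlead_Suc_0:
  assumes h: "h \<in> carrier HH"
  shows "\<exists>A. hlead (Suc 0) h A"
proof -
  have "\<forall>m. \<exists>A. m \<in> {k..n} \<longrightarrow> (\<exists>w. conjrep n (k - 1) m (h m) w \<and> wlead n (k - 1) (Suc 0) w A)"
    using Gsub_lead h unfolding Hgrp_carrier PiE_iff by blast
  then obtain A where "\<forall>m. m \<in> {k..n} \<longrightarrow> (\<exists>w. conjrep n (k - 1) m (h m) w \<and> wlead n (k - 1) (Suc 0) w (A m))"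
    by metis
  then show ?thesis using h unfolding hlead_def by blast
qed

text \<open>The generators of the next term of the series are commutators, for which degrees add and
  leading terms are bracketed; products and inverses stay in the same degree.\<close>

lemma hlead_exists:
  assumes "0 < s" "h \<in> Gam HH s"
  shows "\<exists>A. hlead s h A"
  using assms
proof (induction s arbitrary: h rule: nat_induct_non_zero)
  case 1
  then show ?case using hlead_Suc_0 unfolding One_nat_def by simp
next
  case (Suc s)
  have cm: "\<exists>A. hlead (Suc s) (gcomm HH a b) A" if ab: "a \<in> carrier HH" "b \<in> Gam HH s" for a b
  proof -
    obtain A where A: "hlead (Suc 0) a A" using hlead_Suc_0[OF ab(1)] ..
    obtain B where B: "hlead s b B" using Suc.IH[OF ab(2)] ..
    show ?thesis using hlead_gcomm[OF A B _ Suc.hyps] by auto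
  qed
  have "h \<in> generate HH {gcomm HH a b | a b. a \<in> carrier HH \<and> b \<in> Gam HH s}"
    using Suc.prems H.Gam_Suc[OF Suc.hyps] H.comm_sub_eq by simp
  then show ?case
  proof (induction rule: generate.induct)
    case one
    then show ?case using hlead_one by blast
  next
    case (incl h)
    then show ?case using cm by blast
  next
    case (inv h)
    then show ?case using cm hlead_inv by blast
  next
    case (eng h1 h2)
    then show ?case using hlead_mult by blast
  qed
qed

lemma hlead_props:
  assumes "hlead s h A" "m \<in> {k..n}"
  shows "supp {1..k - 1} (A m)" "homog s (A m)" "cf (A m) \<in> lie_el n"
  using assms unfolding hlead_def wlead_def leads_def by blast+

section \<open>The homomorphism \<open>Theta\<close>\<close>

lemma Hgrp_apply:
  assumes "h \<in> carrier HH" "m \<in> {k..n}" "i \<in> {1..n}"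
  shows "i \<noteq> m \<Longrightarrow> h m (gen i) = gen i"
    and "i \<in> {k..n} \<Longrightarrow> i \<noteq> m \<Longrightarrow> h m (h i (gen i)) = h i (gen i)"
proof -
  have G: "h m \<in> carrier (Gsub n m (k - 1))" if "m \<in> {k..n}" for m
    using assms(1) that by (auto simp: Hgrp_carrier PiE_iff)
  obtain w where w: "conjrep n (k - 1) m (h m) w" using Gsub_lead[OF assms(2) G[OF assms(2)]] by blast
  show fixed: "h m (gen i) = gen i" if "i \<noteq> m"
    using w that assms(3) by (simp add: conjrep_def)
  show "h m (h i (gen i)) = h i (gen i)" if i: "i \<in> {k..n}" "i \<noteq> m"
  proof -
    obtain v where v: "conjrep n (k - 1) i (h i) v" using Gsub_lead[OF i(1) G[OF i(1)]] by blast
    interpret g: group_hom "free_group n" "free_group n" "h m"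
      using AutF_hom w by (simp add: conjrep_def)
    have vl: "v \<in> carrier (free_group (k - 1))" using v by (simp add: conjrep_def)
    have "k - 1 \<le> n" using kn by simp
    then have vn: "v \<in> carrier (free_group n)" using free_group_mono vl by blast
    have "h i (gen i) = inv\<^bsub>free_group n\<^esub> v \<otimes>\<^bsub>free_group n\<^esub> gen i \<otimes>\<^bsub>free_group n\<^esub> v"
      using v by (simp add: conjrep_def)
    then show ?thesis
      using conjrep_fixes[OF w ltk(1,2)[OF assms(2)] vl] vn fixed[OF i(2)] assms(3)
      by (simp del: atLeastAtMost_iff)
  qed
qed

text \<open>Every factor moves only its own x_m and fixes all conjugating words, so the product acts
  on each generator through the single factor belonging to it, in whatever order the factors are
  taken.\<close>

lemma foldr_mult_apply:
  assumes h: "h \<in> carrier HH" and "distinct ms" "set ms \<subseteq> {k..n}"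
  defines "T \<equiv> foldr (\<lambda>m acc. h m \<otimes>\<^bsub>AutF n\<^esub> acc) ms \<one>\<^bsub>AutF n\<^esub>"
  shows "T \<in> carrier (AutF n) \<and> (\<forall>i\<in>{1..n}. T (gen i) = (if i \<in> set ms then h i (gen i) else gen i))"
  using assms(2,3) unfolding T_def
proof (induction ms)
  case Nil
  then show ?case by (simp add: AutF_one_apply)
next
  case (Cons m ms)
  let ?T = "foldr (\<lambda>m acc. h m \<otimes>\<^bsub>AutF n\<^esub> acc) ms \<one>\<^bsub>AutF n\<^esub>"
  have T: "?T \<in> carrier (AutF n)" and IH: "\<And>i. i \<in> {1..n} \<Longrightarrow> ?T (gen i) = (if i \<in> set ms then h i (gen i) else gen i)"
    using Cons by auto
  have m: "m \<in> {k..n}" "m \<notin> set ms" using Cons.prems by auto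
  have hm: "h m \<in> carrier (AutF n)" using Hgrp_in_AutF[OF h m(1)] .
  have "(h m \<otimes>\<^bsub>AutF n\<^esub> ?T) (gen i) = (if i \<in> set (m # ms) then h i (gen i) else gen i)" if i: "i \<in> {1..n}" for i
  proof -
    have "(h m \<otimes>\<^bsub>AutF n\<^esub> ?T) (gen i) = h m (?T (gen i))" using AutF_mult_apply[OF hm T gen_in_free[OF i]] .
    then show ?thesis
      using IH[OF i] Hgrp_apply[OF h m(1) i] m(2) Cons.prems by (auto simp del: atLeastAtMost_iff)
  qed
  then show ?case using T hm by simp
qed

lemma Theta_AutF: "h \<in> carrier HH \<Longrightarrow> Theta n k h \<in> carrier (AutF n)"
  and Theta_gen: "h \<in> carrier HH \<Longrightarrow> i \<in> {1..n} \<Longrightarrow> Theta n k h (gen i) = (if i \<in> {k..n} then h i (gen i) else gen i)"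
proof -
  have set: "set [k..<Suc n] = {k..n}" by (simp only: set_upt atLeastLessThanSuc_atLeastAtMost)
  have *: "Theta n k h \<in> carrier (AutF n) \<and>
      (\<forall>i\<in>{1..n}. Theta n k h (gen i) = (if i \<in> {k..n} then h i (gen i) else gen i))" if "h \<in> carrier HH"
    using foldr_mult_apply[OF that distinct_upt, of k "Suc n", unfolded set, OF subset_refl] unfolding Theta_def .
  show "h \<in> carrier HH \<Longrightarrow> Theta n k h \<in> carrier (AutF n)" using * by blast
  show "h \<in> carrier HH \<Longrightarrow> i \<in> {1..n} \<Longrightarrow> Theta n k h (gen i) = (if i \<in> {k..n} then h i (gen i) else gen i)"
    using * by blast
qed

lemma Theta_PSigma:
  assumes h: "h \<in> carrier HH"
  shows "Theta n k h \<in> PSigma_set n"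
proof -
  have "generate (AutF n) {alpha n m a | a. 1 \<le> a \<and> a \<le> k - 1} \<subseteq> PSigma_set n" if "m \<in> {k..n}" for m
    unfolding PSigma_set_def
  proof (rule A.mono_generate, clarify)
    fix a assume "1 \<le> a" "a \<le> k - 1"
    then have "1 \<le> a" "a < m" "m \<le> n" using that k2 by auto
    then show "\<exists>i j. alpha n m a = alpha n i j \<and> 1 \<le> j \<and> j < i \<and> i \<le> n" by blast
  qed
  moreover have "h m \<in> generate (AutF n) {alpha n m a | a. 1 \<le> a \<and> a \<le> k - 1}" if "m \<in> {k..n}" for m
    using PiE_mem[OF h[unfolded Hgrp_carrier] that] by (simp add: Gsub_def)
  ultimately have hm: "h m \<in> PSigma_set n" if "m \<in> {k..n}" for m using that by (meson subsetD)
  have "foldr (\<lambda>m acc. h m \<otimes>\<^bsub>AutF n\<^esub> acc) ms \<one>\<^bsub>AutF n\<^esub> \<in> PSigma_set n" if "set ms \<subseteq> {k..n}" for ms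
    using that by (induction ms)
      (simp_all add: subgroup.m_closed[OF PSigma_subgroup] subgroup.one_closed[OF PSigma_subgroup] hm del: atLeastAtMost_iff)
  then show ?thesis unfolding Theta_def by (simp add: subset_eq del: upt_Suc)
qed

lemma Theta_mult:
  assumes x: "x \<in> carrier HH" and y: "y \<in> carrier HH"
  shows "Theta n k (x \<otimes>\<^bsub>HH\<^esub> y) = Theta n k x \<otimes>\<^bsub>AutF n\<^esub> Theta n k y"
proof (rule AutF_eqI)
  have xy: "x \<otimes>\<^bsub>HH\<^esub> y \<in> carrier HH" using x y by simp
  show "Theta n k (x \<otimes>\<^bsub>HH\<^esub> y) \<in> carrier (AutF n)" "Theta n k x \<otimes>\<^bsub>AutF n\<^esub> Theta n k y \<in> carrier (AutF n)"
    using Theta_AutF x y xy by auto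
  fix i assume i: "i \<in> {1..n}"
  note Tx = Theta_AutF[OF x]
  have "(Theta n k x \<otimes>\<^bsub>AutF n\<^esub> Theta n k y) (gen i) = Theta n k x (Theta n k y (gen i))"
    using AutF_mult_apply[OF Tx Theta_AutF[OF y] gen_in_free[OF i]] .
  also have "\<dots> = Theta n k (x \<otimes>\<^bsub>HH\<^esub> y) (gen i)"
  proof (cases "i \<in> {k..n}")
    case False
    then show ?thesis using i x y xy by (simp only: Theta_gen if_False)
  next
    case True
    have "y i \<in> carrier (Gsub n i (k - 1))" using y True by (auto simp: Hgrp_carrier PiE_iff)
    then obtain v where v: "conjrep n (k - 1) i (y i) v" using Gsub_lead[OF True] by blast
    have "x i \<in> carrier (Gsub n i (k - 1))" using x True by (auto simp: Hgrp_carrier PiE_iff)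
    then obtain w where w: "conjrep n (k - 1) i (x i) w" using Gsub_lead[OF True] by blast
    have vl: "v \<in> carrier (free_group (k - 1))" using v by (simp add: conjrep_def)
    have ln: "k - 1 \<le> n" using kn by simp
    have vn: "v \<in> carrier (free_group n)" using vl free_group_mono[OF ln] by auto
    have yi: "y i (gen i) = inv\<^bsub>free_group n\<^esub> v \<otimes>\<^bsub>free_group n\<^esub> gen i \<otimes>\<^bsub>free_group n\<^esub> v"
      using v by (simp add: conjrep_def)
    \<comment> \<open>All factors of \<open>x\<close> fix the first \<open>k - 1\<close> generators,
      hence the conjugator of \<open>y i\<close>; this is why \<open>Theta\<close> respects products
      componentwise.\<close>
    have "Theta n k x v = v"
    proof (rule AutF_fixes[OF Tx ln _ vl])
      fix r assume r: "r \<in> {1..k - 1}"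
      then have "r \<in> {1..n}" "r \<notin> {k..n}" using k2 kn by auto
      then show "Theta n k x (gen r) = gen r" using Theta_gen[OF x] by simp
    qed
    moreover have "x i v = v" using conjrep_fixes[OF w ltk(1,2)[OF True] vl] .
    moreover have "group_hom (free_group n) (free_group n) (Theta n k x)" "group_hom (free_group n) (free_group n) (x i)"
      using AutF_hom Tx w by (auto simp: conjrep_def)
    ultimately have "Theta n k x (y i (gen i)) = x i (y i (gen i))"
      unfolding yi using vn gen_in_free[OF i] Theta_gen[OF x i] True
      by (simp add: group_hom.hom_mult group_hom.hom_inv)
    also have "\<dots> = (x \<otimes>\<^bsub>HH\<^esub> y) i (gen i)"
      using True AutF_mult_apply[OF _ _ gen_in_free[OF i]] v w by (simp add: Hgrp_mult conjrep_def)
    finally show ?thesis using True Theta_gen[OF y i] Theta_gen[OF xy i] by simp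
  qed
  finally show "Theta n k (x \<otimes>\<^bsub>HH\<^esub> y) (gen i) = (Theta n k x \<otimes>\<^bsub>AutF n\<^esub> Theta n k y) (gen i)" by simp
qed

lemma Theta_hom: "Theta n k \<in> hom HH (PSigma n)"
  by (rule homI) (simp_all add: PSigma_def Theta_PSigma Theta_mult)

lemma Theta_Gam: "Theta n k ` Gam HH s \<subseteq> Gam (PSigma n) s"
  by (rule group_hom.Gam_hom)
    (simp add: group_hom_def group_hom_axioms_def Hgrp_group PSigma_group Theta_hom)

section \<open>Johnson images in terms of leading terms\<close>

definition lead_der :: "(nat \<Rightarrow> ncps) \<Rightarrow> nat \<Rightarrow> tens" where
  "lead_der A = (\<lambda>i. if i \<in> {k..n} then cf (bra (nmon [i]) (A i)) else (\<lambda>w. 0))"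

text \<open>The displacement of x_i is the group commutator of the inverse of \<open>w\<close> with
  x_i. Its leading term is the bracket of \<open>- A i\<close> with X_i, that is, of X_i with
  \<open>A i\<close>.\<close>

lemma tau_Theta:
  assumes hl: "hlead s h A" and s: "0 < s"
  shows "tau n s (Theta n k h) = lead_der A"
proof
  fix i
  let ?F = "free_group n"
  have h: "h \<in> carrier HH" using hl by (simp add: hlead_def)
  have sub: "{k..n} \<subseteq> {1..n}" using k2 by auto
  show "tau n s (Theta n k h) i = lead_der A i"
  proof (cases "i \<in> {1..n}")
    case False
    then show ?thesis using sub by (auto simp: tau_def lead_der_def)
  next
    case i: True
    note gi = gen_in_free[OF i]
    show ?thesis
    proof (cases "i \<in> {k..n}")
      case False
      then have "Theta n k h (gen i) \<otimes>\<^bsub>?F\<^esub> inv\<^bsub>?F\<^esub> gen i = []"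
        using Theta_gen[OF h i] gi by (simp add: free_one del: atLeastAtMost_iff)
      moreover have "hom_part (Suc s) (magnus []) = (\<lambda>w. 0)"
        by (auto simp: hom_part_def magnus_def tmono_def)
      ultimately show ?thesis using i False by (auto simp: tau_def lead_der_def)
    next
      case True
      obtain w where w: "conjrep n (k - 1) i (h i) w" "wlead n (k - 1) s w (A i)"
        using hl True unfolding hlead_def by blast
      have wl: "w \<in> carrier (free_group (k - 1))" using w by (simp add: conjrep_def)
      have "k - 1 \<le> n" using kn by simp
      then have wn: "w \<in> carrier ?F" using free_group_mono wl by blast
      have "Theta n k h (gen i) = inv\<^bsub>?F\<^esub> w \<otimes>\<^bsub>?F\<^esub> gen i \<otimes>\<^bsub>?F\<^esub> w"
        using Theta_gen[OF h i] True w by (simp add: conjrep_def)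
      then have 1: "Mag (Theta n k h (gen i) \<otimes>\<^bsub>?F\<^esub> inv\<^bsub>?F\<^esub> gen i)
          = Mag (inv\<^bsub>?F\<^esub> w) * Mag (gen i) * Mag w * Mag (inv\<^bsub>?F\<^esub> gen i)" by (simp add: Mag_mult)
      have 2: "leads s (Mag (inv\<^bsub>?F\<^esub> w)) (- A i)"
        using leads_inverse[OF _ Mag_inv[OF wn] s] w by (simp add: wlead_def)
      have 3: "Mag (inv\<^bsub>?F\<^esub> w) * Mag w = 1" using Mag_inv[of "inv\<^bsub>?F\<^esub> w" n] wn by simp
      have "leads (Suc s) (Mag (Theta n k h (gen i) \<otimes>\<^bsub>?F\<^esub> inv\<^bsub>?F\<^esub> gen i)) (bra (- A i) (nmon [i]))"
        unfolding 1 using leads_commutator[OF 2 leads_gen 3 Mag_inv[OF gi] s] by simp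
      from hom_part_leads[OF this] have "hom_part (Suc s) (magnus (Theta n k h (gen i) \<otimes>\<^bsub>?F\<^esub> inv\<^bsub>?F\<^esub> gen i))
          = cf (bra (nmon [i]) (A i))"
        by (simp add: cf_Mag bra_def)
      then show ?thesis using True i by (simp add: tau_def lead_der_def)
    qed
  qed
qed

text \<open>\<open>lead_der A\<close> annihilates the letters below \<open>k\<close>, hence every
  \<open>B i\<close>, so its extension differentiates only the factor X_i of [X_i, B_i]. The
  difference of the two iterated brackets is one side of the Jacobi identity.\<close>

lemma derbr_deg_lead:
  assumes x: "hlead p x A" and y: "hlead q y B"
  shows "derbr_deg (lead_der A) (lead_der B) = lead_der (\<lambda>m. bra (A m) (B m))"
proof (rule ext, rule ext)
  fix i w
  show "derbr_deg (lead_der A) (lead_der B) i w = lead_der (\<lambda>m. bra (A m) (B m)) i w"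
  proof (cases "i \<in> {k..n}")
    case False
    have "ext_der d (\<lambda>w. 0) w = 0" for d by (simp add: ext_der_def)
    moreover have "lead_der C i = (\<lambda>w. 0)" for C using False by (simp only: lead_der_def if_False)
    ultimately show ?thesis by (simp add: derbr_deg_def)
  next
    case True
    have nS: "i \<notin> {1..k - 1}" using True k2 by auto
    have z: "lead_der C r = (\<lambda>w. 0)" if "r \<in> {1..k - 1}" for C r using that k2 by (auto simp: lead_der_def)
    have d: "lead_der C i = cf (bra (nmon [i]) (C i))" for C using True by (simp add: lead_der_def)
    have 1: "ext_der (lead_der A) (cf (bra (nmon [i]) (B i))) = cf (bra (bra (nmon [i]) (A i)) (B i))"
      using hlead_props[OF y True] nS z d by (intro ext_der_bra[where S = "{1..k - 1}" and s = q]) auto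
    have 2: "ext_der (lead_der B) (cf (bra (nmon [i]) (A i))) = cf (bra (bra (nmon [i]) (B i)) (A i))"
      using hlead_props[OF x True] nS z d by (intro ext_der_bra[where S = "{1..k - 1}" and s = p]) auto
    show ?thesis
      unfolding derbr_deg_def d 1 2 bra_jacobi[symmetric] by (simp add: cf_diff)
  qed
qed

text \<open>The inverse is taken so that the conjugator is x_a and the leading term is +X_a; the
  Lyndon commutators then have coefficient +1 on the diagonal.\<close>

definition hgen :: "nat \<Rightarrow> nat \<Rightarrow> nat \<Rightarrow> fword \<Rightarrow> fword" where
  "hgen m a = (\<lambda>m'\<in>{k..n}. if m' = m then inv\<^bsub>AutF n\<^esub> alpha n m a else \<one>\<^bsub>AutF n\<^esub>)"

definition emb :: "nat \<Rightarrow> (fword \<Rightarrow> fword) \<Rightarrow> nat \<Rightarrow> fword \<Rightarrow> fword" where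
  "emb m \<phi> = (\<lambda>m'\<in>{k..n}. if m' = m then \<phi> else \<one>\<^bsub>AutF n\<^esub>)"

lemma alpha_in_Gsub: "a \<in> {1..k - 1} \<Longrightarrow> alpha n m a \<in> carrier (Gsub n m (k - 1))"
  unfolding Gsub_def by (auto intro!: generate.incl)

lemma emb_closed: "m \<in> {k..n} \<Longrightarrow> \<phi> \<in> carrier (Gsub n m (k - 1)) \<Longrightarrow> emb m \<phi> \<in> carrier HH"
  using subgroup.one_closed[OF Gsub_subgroup] by (auto simp: Hgrp_carrier emb_def)

lemma hgen_eq: "hgen m a = emb m (inv\<^bsub>AutF n\<^esub> alpha n m a)"
  by (simp add: hgen_def emb_def)

lemma hgen_closed: "m \<in> {k..n} \<Longrightarrow> a \<in> {1..k - 1} \<Longrightarrow> hgen m a \<in> carrier HH"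
  unfolding hgen_eq
  by (intro emb_closed subgroup.m_inv_closed[OF Gsub_subgroup] alpha_in_Gsub)

lemma emb_mult:
  assumes "m \<in> {k..n}" "\<phi> \<in> carrier (AutF n)" "\<psi> \<in> carrier (AutF n)"
  shows "emb m \<phi> \<otimes>\<^bsub>HH\<^esub> emb m \<psi> = emb m (\<phi> \<otimes>\<^bsub>AutF n\<^esub> \<psi>)"
  using assms by (auto simp: Hgrp_mult emb_def)

lemma hgen_commute:
  assumes "m \<in> {k..n}" "m' \<in> {k..n}" "m \<noteq> m'" "a \<in> {1..k - 1}" "b \<in> {1..k - 1}"
  shows "hgen m a \<otimes>\<^bsub>HH\<^esub> hgen m' b = hgen m' b \<otimes>\<^bsub>HH\<^esub> hgen m a"
proof -
  have "hgen m a i \<otimes>\<^bsub>AutF n\<^esub> hgen m' b i = hgen m' b i \<otimes>\<^bsub>AutF n\<^esub> hgen m a i" if i: "i \<in> {k..n}" for i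
  proof -
    have "hgen m a i \<in> carrier (AutF n)" "hgen m' b i \<in> carrier (AutF n)"
      using Hgrp_in_AutF hgen_closed assms i by auto
    moreover have "hgen m a i = \<one>\<^bsub>AutF n\<^esub> \<or> hgen m' b i = \<one>\<^bsub>AutF n\<^esub>" using i assms(3) by (auto simp: hgen_def)
    ultimately show ?thesis by auto
  qed
  then show ?thesis unfolding Hgrp_mult by (auto intro!: restrict_ext)
qed

lemma emb_in_generate:
  assumes m: "m \<in> {k..n}" and \<phi>: "\<phi> \<in> carrier (Gsub n m (k - 1))"
  shows "emb m \<phi> \<in> generate HH {hgen m a | m a. m \<in> {k..n} \<and> a \<in> {1..k - 1}}"
proof -
  let ?X = "{hgen m a | m a. m \<in> {k..n} \<and> a \<in> {1..k - 1}}"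
  have X: "?X \<subseteq> carrier HH" using hgen_closed by blast
  have sub: "generate (AutF n) {alpha n m a | a. 1 \<le> a \<and> a \<le> k - 1} \<subseteq> carrier (AutF n)"
    using subgroup.subset[OF Gsub_subgroup[OF m]] by (simp add: Gsub_def)
  have "\<phi> \<in> generate (AutF n) {alpha n m a | a. 1 \<le> a \<and> a \<le> k - 1}" using \<phi> by (simp add: Gsub_def)
  then show ?thesis
  proof (induction rule: generate.induct)
    case one
    have "emb m \<one>\<^bsub>AutF n\<^esub> = \<one>\<^bsub>HH\<^esub>" by (auto simp: emb_def Hgrp_one)
    then show ?case using generate.one by metis
  next
    case (incl h)
    then obtain a where a: "h = alpha n m a" "a \<in> {1..k - 1}" by auto
    have ac: "alpha n m a \<in> carrier (AutF n)"
      using subgroup.mem_carrier[OF Gsub_subgroup[OF m] alpha_in_Gsub[OF a(2)]] .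
    have "emb m h \<otimes>\<^bsub>HH\<^esub> hgen m a = emb m \<one>\<^bsub>AutF n\<^esub>" unfolding hgen_eq a(1) using emb_mult[OF m ac] ac by simp
    also have "\<dots> = \<one>\<^bsub>HH\<^esub>" by (auto simp: emb_def Hgrp_one)
    finally have "inv\<^bsub>HH\<^esub> hgen m a = emb m h"
      by (rule H.inv_equality[OF _ hgen_closed[OF m a(2)] emb_closed[OF m]]) (use a alpha_in_Gsub in simp)
    moreover have "inv\<^bsub>HH\<^esub> hgen m a \<in> generate HH ?X" using m a by (intro generate.inv) blast
    ultimately show ?case by simp
  next
    case (inv h)
    then obtain a where a: "h = alpha n m a" "a \<in> {1..k - 1}" by auto
    show ?case unfolding a(1) hgen_eq[symmetric] using m a by (intro generate.incl) blast
  next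
    case (eng h1 h2)
    then have "emb m h1 \<otimes>\<^bsub>HH\<^esub> emb m h2 \<in> generate HH ?X" by (intro generate.eng)
    moreover have "h1 \<in> carrier (AutF n)" "h2 \<in> carrier (AutF n)" using eng.hyps sub by auto
    ultimately show ?case using emb_mult[OF m] by simp
  qed
qed

lemma Hgrp_generated: "carrier HH = generate HH {hgen m a | m a. m \<in> {k..n} \<and> a \<in> {1..k - 1}}"
proof
  let ?X = "{hgen m a | m a. m \<in> {k..n} \<and> a \<in> {1..k - 1}}"
  show "generate HH ?X \<subseteq> carrier HH" by (rule H.generate_incl) (use hgen_closed in blast)
  show "carrier HH \<subseteq> generate HH ?X"
  proof
    fix h assume h: "h \<in> carrier HH"
    \<comment> \<open>The components of \<open>h\<close> are switched on one factor at a time; each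
      step multiplies by an element concentrated in one factor.\<close>
    have "(\<lambda>m\<in>{k..n}. if m \<in> M then h m else \<one>\<^bsub>AutF n\<^esub>) \<in> generate HH ?X" if "finite M" "M \<subseteq> {k..n}" for M
      using that
    proof (induction M rule: finite_induct)
      case empty
      have "(\<lambda>m\<in>{k..n}. if m \<in> {} then h m else \<one>\<^bsub>AutF n\<^esub>) = \<one>\<^bsub>HH\<^esub>" by (simp add: Hgrp_one)
      then show ?case using generate.one by metis
    next
      case (insert m M)
      have m: "m \<in> {k..n}" using insert by auto
      have 1: "(\<lambda>i\<in>{k..n}. if i \<in> insert m M then h i else \<one>\<^bsub>AutF n\<^esub>)
          = emb m (h m) \<otimes>\<^bsub>HH\<^esub> (\<lambda>i\<in>{k..n}. if i \<in> M then h i else \<one>\<^bsub>AutF n\<^esub>)"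
        unfolding Hgrp_mult using insert.hyps Hgrp_in_AutF[OF h]
        by (intro restrict_ext) (auto simp: emb_def)
      have 2: "emb m (h m) \<in> generate HH ?X"
        by (rule emb_in_generate[OF m]) (use h m in \<open>auto simp: Hgrp_carrier PiE_iff\<close>)
      have "M \<subseteq> {k..n}" using insert.prems by blast
      then show ?case unfolding 1 by (rule generate.eng[OF 2 insert.IH])
    qed
    from this[of "{k..n}"] have "(\<lambda>m\<in>{k..n}. if m \<in> {k..n} then h m else \<one>\<^bsub>AutF n\<^esub>) \<in> generate HH ?X" by simp
    moreover have "(\<lambda>m\<in>{k..n}. if m \<in> {k..n} then h m else \<one>\<^bsub>AutF n\<^esub>) = h"
      using h by (auto simp: Hgrp_carrier PiE_iff extensional_def restrict_def fun_eq_iff)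
    ultimately show "h \<in> generate HH ?X" by simp
  qed
qed

lemma hlead_hgen:
  assumes m: "m \<in> {k..n}" and a: "a \<in> {1..k - 1}"
  shows "hlead (Suc 0) (hgen m a) (\<lambda>m'. if m' = m then nmon [a] else 0)"
  unfolding hlead_def
proof (intro conjI ballI)
  show "hgen m a \<in> carrier HH" by (rule hgen_closed[OF m a])
  fix m' assume m': "m' \<in> {k..n}"
  have ga: "gen a \<in> carrier (free_group (k - 1))" by (rule gen_in_free[OF a])
  have "conjrep n (k - 1) m (inv\<^bsub>AutF n\<^esub> alpha n m a) (gen a)"
    using conjrep_inv[OF conjrep_alpha[OF a ltk(1,2)[OF m]] ltk(1,2)[OF m]] F.inv_inv[OF ga] by simp
  moreover have "wlead n (k - 1) (Suc 0) (gen a) (nmon [a])" by (rule wlead_gen[OF a]) (use kn in simp)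
  ultimately show "\<exists>w. conjrep n (k - 1) m' (hgen m a m') w \<and> wlead n (k - 1) (Suc 0) w (if m' = m then nmon [a] else 0)"
    using conjrep_one[OF ltk(3)[OF m'], of "k - 1"] wlead_one[of n "k - 1" "Suc 0"] m' unfolding hgen_def by auto
qed

text \<open>The same bracketing tree is evaluated in H(n,k) and in the power series; the components
  outside factor \<open>m\<close> stay trivial and have leading term 0.\<close>

lemma hlead_lbr:
  assumes "lyndon l" "set l \<subseteq> {1..k - 1}" and m: "m \<in> {k..n}"
  shows "hlead (length l) (lbr (gcomm HH) (hgen m) l) (\<lambda>m'. if m' = m then lbr bra (\<lambda>i. nmon [i]) l else 0)"
  using assms(1,2)
proof (induction rule: lyndon_induct)
  case (single a)
  then show ?case using hlead_hgen[OF m, of a] unfolding lbr_single by simp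
next
  case (append u v)
  have ne: "u \<noteq> []" "v \<noteq> []" using append.hyps(1,2) lyndon_not_Nil by auto
  have eq: "(\<lambda>m'. bra (if m' = m then a else 0) (if m' = m then b else 0)) = (\<lambda>m'. if m' = m then bra a b else 0)" for a b
    by (auto simp: bra_def)
  have "hlead (length u) (lbr (gcomm HH) (hgen m) u) (\<lambda>m'. if m' = m then lbr bra (\<lambda>i. nmon [i]) u else 0)"
    "hlead (length v) (lbr (gcomm HH) (hgen m) v) (\<lambda>m'. if m' = m then lbr bra (\<lambda>i. nmon [i]) v else 0)"
    using append.IH append.prems by auto
  from hlead_gcomm[OF this] ne show ?case unfolding lbr_split[OF append.hyps(5) ne] eq length_append by simp
qed

section \<open>The Johnson image on a single graded piece and its retraction\<close>

abbreviation (input) "JT s h \<equiv> tau n s (Theta n k h)"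

lemma lead_der_DerDeg:
  assumes "hlead s h A"
  shows "lead_der A \<in> carrier (DerDeg n s)"
proof -
  have "lead_der A i \<in> lie_deg n (Suc s)" if "i \<in> {1..n}" for i
  proof (cases "i \<in> {k..n}")
    case True
    note hp = hlead_props[OF assms True]
    have "homog (Suc s) (bra (nmon [i]) (A i))" using homog_bra[OF homog_nmon_single hp(2)] by simp
    moreover have "cf (bra (nmon [i]) (A i)) \<in> lie_el n" by (rule lie_el_bra[OF lie_el_nmon[OF that] hp(3)])
    ultimately show ?thesis using True by (simp add: lead_der_def lie_deg_def homog_def)
  next
    case False
    then show ?thesis by (auto simp: lead_der_def lie_deg_def lie_el.zero)
  qed
  moreover have "lead_der A i = (\<lambda>w. 0)" if "i \<notin> {1..n}" for i using that k2 by (auto simp: lead_der_def)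
  ultimately show ?thesis by (simp add: DerDeg_def)
qed

lemma JT_closed: "0 < s \<Longrightarrow> h \<in> Gam HH s \<Longrightarrow> JT s h \<in> carrier (DerDeg n s)"
  using hlead_exists tau_Theta lead_der_DerDeg by metis

lemma JT_mult:
  assumes "0 < s" "x \<in> Gam HH s" "y \<in> Gam HH s"
  shows "JT s (x \<otimes>\<^bsub>HH\<^esub> y) = JT s x \<otimes>\<^bsub>DerDeg n s\<^esub> JT s y"
proof -
  obtain A where A: "hlead s x A" using hlead_exists[OF assms(1,2)] ..
  obtain B where B: "hlead s y B" using hlead_exists[OF assms(1,3)] ..
  show ?thesis
    unfolding tau_Theta[OF A assms(1)] tau_Theta[OF B assms(1)]
      tau_Theta[OF hlead_mult[OF A B assms(1)] assms(1)]
    by (auto simp: lead_der_def DerDeg_mult bra_def cf_diff cf_add algebra_simps fun_eq_iff)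
qed

text \<open>An element one step deeper has leading term 0 in degree \<open>s\<close>. With
  additivity this gives independence of the coset representative.\<close>

lemma JT_Gam_Suc:
  assumes "0 < s" "x \<in> Gam HH (Suc s)"
  shows "JT s x = \<one>\<^bsub>DerDeg n s\<^esub>"
proof -
  obtain A where "hlead (Suc s) x A" using hlead_exists[OF _ assms(2)] by blast
  from tau_Theta[OF hlead_weaken[OF this] assms(1)] show ?thesis
    by (auto simp: lead_der_def DerDeg_one bra_def cf_zero)
qed

lemma JT_coset:
  assumes s: "0 < s" and h: "h \<in> Gam HH s" "h' \<in> Gam HH (Suc s) #>\<^bsub>HH\<^esub> h"
  shows "JT s h' = JT s h"
proof -
  obtain g where g: "g \<in> Gam HH (Suc s)" "h' = g \<otimes>\<^bsub>HH\<^esub> h" using h by (auto simp: r_coset_def)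
  interpret D: comm_group "DerDeg n s" by (rule DerDeg_comm_group)
  have "g \<in> Gam HH s" using g H.Gam_Suc_subset by blast
  then show ?thesis
    unfolding g(2) using JT_mult[OF s _ h(1)] JT_Gam_Suc[OF s g(1)] JT_closed[OF s h(1)] by simp
qed

lemma JT_gcomm:
  assumes "0 < p" "0 < q" "x \<in> Gam HH p" "y \<in> Gam HH q"
  shows "JT (p + q) (gcomm HH x y) = derbr_deg (JT p x) (JT q y)"
proof -
  obtain A where A: "hlead p x A" using hlead_exists[OF assms(1,3)] ..
  obtain B where B: "hlead q y B" using hlead_exists[OF assms(2,4)] ..
  have "0 < p + q" using assms by simp
  from tau_Theta[OF hlead_gcomm[OF A B assms(1,2)] this]
  show ?thesis
    unfolding tau_Theta[OF A assms(1)] tau_Theta[OF B assms(2)] derbr_deg_lead[OF A B] .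
qed

text \<open>The triangular homomorphism is prescribed only on the images of the Lyndon commutators.
  That it inverts the Johnson map everywhere follows because those commutators and the next term of
  the series generate.\<close>

lemma JT_retraction:
  assumes s: "0 < s"
  shows "\<exists>R \<in> hom (DerDeg n s) (grp HH s). \<forall>h \<in> Gam HH s. R (JT s h) = Gam HH (Suc s) #>\<^bsub>HH\<^esub> h"
proof -
  define I where "I = {k..n} \<times> {l. lyndon l \<and> length l = s \<and> set l \<subseteq> {1..k - 1}}"
  have "finite {l. lyndon l \<and> length l = s \<and> set l \<subseteq> {1..k - 1}}"
    by (rule finite_subset[OF _ finite_lists_length_eq[of "{1..k - 1}" s]]) auto
  then have fin: "finite I" by (simp add: I_def)
  define P where "P = lbr bra (\<lambda>i. nmon [i])"
  define c where "c = (\<lambda>(m, l). lbr (gcomm HH) (hgen m) l)"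
  define N where "N = Gam HH (Suc s)"
  have cG: "c i \<in> Gam HH s" if iI: "i \<in> I" for i
  proof -
    obtain m l where i: "i = (m, l)" and l: "lyndon l" "length l = s" "set l \<subseteq> {1..k - 1}" "m \<in> {k..n}"
      using iI by (auto simp: I_def)
    have "hgen m ` set l \<subseteq> carrier HH" using hgen_closed[OF l(4)] l(3) by blast
    from H.lbr_gcomm_Gam[OF l(1) this] show ?thesis by (simp add: i c_def l(2))
  qed
  \<comment> \<open>The coordinates used for the triangular system: at words beginning with the
    letter \<open>m'\<close>, which is at least \<open>k\<close> and so absent from the leading
    term, the bracket shows the coefficients of the leading term unchanged.\<close>
  have ev: "JT s (c (m, l)) m' (m' # l') = (if m' = m then cf (P l) l' else 0)"
    if "(m, l) \<in> I" "m' \<in> {k..n}" for m l m' l'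
  proof -
    have l: "lyndon l" "length l = s" "set l \<subseteq> {1..k - 1}" "m \<in> {k..n}" using that by (auto simp: I_def)
    have hl: "hlead s (c (m, l)) (\<lambda>m'. if m' = m then P l else 0)"
      using hlead_lbr[OF l(1,3,4)] l(2) by (simp add: c_def P_def cong: if_cong)
    have "JT s (c (m, l)) m' (m' # l') = cf (bra (nmon [m']) (if m' = m then P l else 0)) (m' # l')"
      using tau_Theta[OF hl s] that(2) by (simp add: lead_der_def)
    also have "\<dots> = cf (if m' = m then P l else 0) l'"
      by (rule cf_bra_nmon_Cons[OF hlead_props(1)[OF hl that(2)] _ hlead_props(2)[OF hl that(2)] s])
        (use that k2 in auto)
    finally show ?thesis by (auto simp: cf_zero)
  qed
  \<comment> \<open>Pairs are ordered first by \<open>m\<close> and then lexicographically by the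
    word. Distinct \<open>m\<close> give coordinate 0, and for equal \<open>m\<close> the earlier
    word is below every word of the later Lyndon polynomial.\<close>
  let ?is = "sorted_list_of_set I"
  have set_is: "set ?is = I" using fin by simp
  interpret A: comm_group "grp HH s" by (rule H.grp_comm_group[OF s])
  have "\<exists>R \<in> hom (DerDeg n s) (grp HH s). \<forall>i \<in> set ?is. R (JT s (c i)) = N #>\<^bsub>HH\<^esub> c i"
  proof (rule hom_of_triangular[where x = "\<lambda>(m, l) d. d m (m # l)"])
    show "comm_group (DerDeg n s)" "comm_group (grp HH s)" by (rule DerDeg_comm_group, unfold_locales)
    show "JT s (c i) \<in> carrier (DerDeg n s)" if "i \<in> set ?is" for i
      using JT_closed[OF s cG] that set_is by simp
    show "N #>\<^bsub>HH\<^esub> c i \<in> carrier (grp HH s)" if "i \<in> set ?is" for i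
      using cG that set_is by (auto simp: H.grp_carrier N_def)
    show "(case i of (m, l) \<Rightarrow> \<lambda>d. d m (m # l)) (d \<otimes>\<^bsub>DerDeg n s\<^esub> d') =
        (case i of (m, l) \<Rightarrow> \<lambda>d. d m (m # l)) d + (case i of (m, l) \<Rightarrow> \<lambda>d. d m (m # l)) d'" for i d d'
      by (cases i) (simp add: DerDeg_mult)
    show "(case i of (m, l) \<Rightarrow> \<lambda>d. d m (m # l)) (JT s (c i)) = 1" if "i \<in> set ?is" for i
    proof -
      obtain m l where i: "i = (m, l)" by (cases i)
      have ml: "(m, l) \<in> I" using that set_is i by simp
      then show ?thesis using ev[OF ml, of m l] lbr_bra_triangular[of l] by (simp add: i I_def P_def)
    qed
    have "sorted_wrt (<) ?is" by (rule strict_sorted_list_of_set)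
    then show "sorted_wrt (\<lambda>i j. (case i of (m, l) \<Rightarrow> \<lambda>d. d m (m # l)) (JT s (c j)) = 0) ?is"
    proof (rule sorted_wrt_mono_rel[rotated])
      fix i j assume ij: "i \<in> set ?is" "j \<in> set ?is" "i < j"
      obtain m l m' l' where e: "i = (m, l)" "j = (m', l')" by (cases i; cases j)
      have I: "(m, l) \<in> I" "(m', l') \<in> I" using ij set_is e by auto
      have "m \<in> {k..n}" "lyndon l'" using I by (auto simp: I_def)
      have "JT s (c (m', l')) m (m # l) = (if m = m' then cf (P l') l else 0)"
        by (rule ev[OF I(2) \<open>m \<in> {k..n}\<close>])
      moreover have "cf (P l') l = 0" if "m = m'"
      proof -
        have "l < l'" using ij(3) that e by simp
        then show ?thesis using lbr_bra_triangular[OF \<open>lyndon l'\<close>] unfolding P_def by (meson leD)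
      qed
      ultimately show "(case i of (m, l) \<Rightarrow> \<lambda>d. d m (m # l)) (JT s (c j)) = 0" by (simp add: e)
    qed
  qed
  then obtain R where R: "R \<in> hom (DerDeg n s) (grp HH s)" "\<And>i. i \<in> I \<Longrightarrow> R (JT s (c i)) = N #>\<^bsub>HH\<^esub> c i"
    using set_is by auto
  interpret R: group_hom "DerDeg n s" "grp HH s" R
    using R(1) by (simp add: group_hom_def group_hom_axioms_def DerDeg_group H.grp_group)
  let ?G = "HH\<lparr>carrier := Gam HH s\<rparr>"
  have G: "group ?G" by (rule H.subgroup_imp_group[OF H.Gam_subgroup])
  \<comment> \<open>Applying \<open>R\<close> after the Johnson map and taking cosets are two
    homomorphisms on the same term of the series; the set where they agree is a subgroup, so a
    generating set decides.\<close>
  have "group_hom ?G (grp HH s) (\<lambda>h. R (JT s h))"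
    using JT_mult[OF s] JT_closed[OF s]
    by (auto simp: group_hom_def group_hom_axioms_def G H.grp_group hom_def)
  moreover have "group_hom ?G (grp HH s) (\<lambda>h. N #>\<^bsub>HH\<^esub> h)"
    by (auto simp: group_hom_def group_hom_axioms_def G H.grp_group hom_def H.grp_carrier H.grp_mult N_def)
  ultimately have "subgroup {h \<in> carrier ?G. R (JT s h) = N #>\<^bsub>HH\<^esub> h} ?G" by (rule subgroup_equalizer)
  then have E: "subgroup {h \<in> Gam HH s. R (JT s h) = N #>\<^bsub>HH\<^esub> h} HH"
    using H.incl_subgroup[OF H.Gam_subgroup] by simp
  have "c ` I \<union> Gam HH (Suc s) \<subseteq> {h \<in> Gam HH s. R (JT s h) = N #>\<^bsub>HH\<^esub> h}"
  proof (rule Un_least)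
    show "c ` I \<subseteq> {h \<in> Gam HH s. R (JT s h) = N #>\<^bsub>HH\<^esub> h}" using cG R(2) by blast
    show "Gam HH (Suc s) \<subseteq> {h \<in> Gam HH s. R (JT s h) = N #>\<^bsub>HH\<^esub> h}"
    proof
      fix h assume h: "h \<in> Gam HH (Suc s)"
      then have "h \<in> carrier HH" by (rule H.Gam_carrier)
      then have "N #>\<^bsub>HH\<^esub> h = N" using h H.coset_eq_one_iff[OF H.Gam_normal] by (simp add: N_def)
      moreover have "R (JT s h) = N" using JT_Gam_Suc[OF s h] by (simp add: H.grp_one N_def)
      ultimately show "h \<in> {h \<in> Gam HH s. R (JT s h) = N #>\<^bsub>HH\<^esub> h}" using h H.Gam_Suc_subset by auto
    qed
  qed
  from H.generate_subgroup_incl[OF this E]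
  have 1: "H.gspan s (c ` I) \<subseteq> {h \<in> Gam HH s. R (JT s h) = N #>\<^bsub>HH\<^esub> h}" unfolding H.gspan_def .
  have "Gam HH s \<subseteq> H.gspan s {lbr (gcomm HH) (hgen m) w | m w.
      m \<in> {k..n} \<and> lyndon w \<and> length w = s \<and> set w \<subseteq> {1..k - 1}}"
    by (rule H.Gam_subset_gspan_lbr[OF _ _ Hgrp_generated _ s])
      (use hgen_closed hgen_commute in auto)
  also have "{lbr (gcomm HH) (hgen m) w | m w.
      m \<in> {k..n} \<and> lyndon w \<and> length w = s \<and> set w \<subseteq> {1..k - 1}} = c ` I"
    unfolding c_def I_def by fast
  finally show ?thesis using 1 R(1) unfolding N_def by blast
qed

section \<open>Assembling the degrees into one graded map\<close>

lemma grDCS_carrier: "carrier (grDCS HH) =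
    {c \<in> (\<Pi>\<^sub>E s\<in>{1..}. carrier (grp HH s)). finite {s \<in> {1..}. c s \<noteq> Gam HH (Suc s)}}"
  unfolding grDCS_def by (subst carrier_sum_group) (simp_all add: H.grp_group H.grp_one)

lemma DerL_carrier: "carrier (DerL n) =
    {d \<in> (\<Pi>\<^sub>E s\<in>{1..}. carrier (DerDeg n s)). finite {s \<in> {1..}. d s \<noteq> \<one>\<^bsub>DerDeg n s\<^esub>}}"
  unfolding DerL_def by (subst carrier_sum_group) (simp_all add: DerDeg_group)

lemma grDCS_rep:
  assumes "c \<in> carrier (grDCS HH)" "s \<in> {1..}"
  shows "(SOME h. h \<in> c s) \<in> Gam HH s" "c s = Gam HH (Suc s) #>\<^bsub>HH\<^esub> (SOME h. h \<in> c s)"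
proof -
  have "c s \<in> carrier (grp HH s)" using assms by (auto simp: grDCS_carrier)
  then show "(SOME h. h \<in> c s) \<in> Gam HH s" "c s = Gam HH (Suc s) #>\<^bsub>HH\<^esub> (SOME h. h \<in> c s)"
    using H.grp_elem[OF _ H.grp_some] by blast+
qed

text \<open>\<open>Phi\<close> picks an arbitrary representative of each coset; this replaces it by
  any convenient one.\<close>

lemma JT_some_coset:
  assumes "0 < s" "x \<in> Gam HH s"
  shows "JT s (SOME h. h \<in> Gam HH (Suc s) #>\<^bsub>HH\<^esub> x) = JT s x"
proof (rule JT_coset[OF assms])
  have "x \<in> Gam HH (Suc s) #>\<^bsub>HH\<^esub> x" using H.rcos_self[OF _ H.Gam_subgroup] assms by simp
  then show "(SOME h. h \<in> Gam HH (Suc s) #>\<^bsub>HH\<^esub> x) \<in> Gam HH (Suc s) #>\<^bsub>HH\<^esub> x"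
    by (rule someI[where P = "\<lambda>h. h \<in> Gam HH (Suc s) #>\<^bsub>HH\<^esub> x"])
qed

lemma Phi_hom: "Phi n k \<in> hom (grDCS HH) (DerL n)"
proof (rule homI)
  fix c assume c: "c \<in> carrier (grDCS HH)"
  have "{s \<in> {1..}. Phi n k c s \<noteq> \<one>\<^bsub>DerDeg n s\<^esub>} \<subseteq> {s \<in> {1..}. c s \<noteq> Gam HH (Suc s)}"
  proof (rule subsetI, rule ccontr)
    fix s assume "s \<in> {s \<in> {1..}. Phi n k c s \<noteq> \<one>\<^bsub>DerDeg n s\<^esub>}" "s \<notin> {s \<in> {1..}. c s \<noteq> Gam HH (Suc s)}"
    then have s: "s \<in> {1..}" "Phi n k c s \<noteq> \<one>\<^bsub>DerDeg n s\<^esub>" "c s = Gam HH (Suc s)" by blast+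
    \<comment> \<open>The representative chosen from a trivial coset need not be the identity, only
      an element of the next term, and there the Johnson image of degree \<open>s\<close>
      vanishes.\<close>
    have "(SOME h. h \<in> c s) \<in> Gam HH (Suc s)"
      unfolding s(3) by (rule someI[where P = "\<lambda>h. h \<in> Gam HH (Suc s)" and x = "\<one>\<^bsub>HH\<^esub>"]) (rule subgroup.one_closed[OF H.Gam_subgroup])
    then have "Phi n k c s = \<one>\<^bsub>DerDeg n s\<^esub>" using JT_Gam_Suc[of s] s(1) by (simp add: Phi_def)
    then show False using s(2) by simp
  qed
  moreover have "finite {s \<in> {1..}. c s \<noteq> Gam HH (Suc s)}" using c by (simp add: grDCS_carrier)
  ultimately have "finite {s \<in> {1..}. Phi n k c s \<noteq> \<one>\<^bsub>DerDeg n s\<^esub>}" by (rule finite_subset)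
  moreover have "Phi n k c \<in> (\<Pi>\<^sub>E s\<in>{1..}. carrier (DerDeg n s))"
    using grDCS_rep(1)[OF c] JT_closed by (auto simp: Phi_def)
  ultimately show "Phi n k c \<in> carrier (DerL n)" by (simp add: DerL_carrier)
next
  fix c d assume c: "c \<in> carrier (grDCS HH)" and d: "d \<in> carrier (grDCS HH)"
  have "JT s (SOME h. h \<in> c s \<otimes>\<^bsub>grp HH s\<^esub> d s) = JT s (SOME h. h \<in> c s) \<otimes>\<^bsub>DerDeg n s\<^esub> JT s (SOME h. h \<in> d s)"
    if s: "s \<in> {1..}" for s
  proof -
    define x y where "x = (SOME h. h \<in> c s)" and "y = (SOME h. h \<in> d s)"
    have x: "x \<in> Gam HH s" "c s = Gam HH (Suc s) #>\<^bsub>HH\<^esub> x" using grDCS_rep[OF c s] by (simp_all add: x_def)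
    have y: "y \<in> Gam HH s" "d s = Gam HH (Suc s) #>\<^bsub>HH\<^esub> y" using grDCS_rep[OF d s] by (simp_all add: y_def)
    have "c s \<otimes>\<^bsub>grp HH s\<^esub> d s = Gam HH (Suc s) #>\<^bsub>HH\<^esub> (x \<otimes>\<^bsub>HH\<^esub> y)"
      unfolding x(2) y(2) using x y by (simp add: H.grp_mult)
    moreover have "x \<otimes>\<^bsub>HH\<^esub> y \<in> Gam HH s" by (rule subgroup.m_closed[OF H.Gam_subgroup x(1) y(1)])
    ultimately show ?thesis
      using JT_some_coset[of s "x \<otimes>\<^bsub>HH\<^esub> y"] JT_mult[OF _ x(1) y(1)] s unfolding x_def[symmetric] y_def[symmetric] by simp
  qed
  then show "Phi n k (c \<otimes>\<^bsub>grDCS HH\<^esub> d) = Phi n k c \<otimes>\<^bsub>DerL n\<^esub> Phi n k d"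
    unfolding Phi_def grDCS_def DerL_def mult_sum_group by (intro restrict_ext) simp
qed

text \<open>In degree \<open>r\<close> the bracket is represented by a product of commutators of
  weights \<open>p\<close> and \<open>r - p\<close>. Each factor lies in weight \<open>r\<close>,
  where the Johnson image is additive, so the product becomes the sum in
  \<open>derbr\<close>.\<close>

lemma Phi_grbr:
  assumes c: "c \<in> carrier (grDCS HH)" and d: "d \<in> carrier (grDCS HH)"
  shows "Phi n k (grbr HH c d) = derbr (Phi n k c) (Phi n k d)"
  unfolding Phi_def derbr_def
proof (rule restrict_ext)
  fix r :: nat assume r: "r \<in> {1..}"
  then have r0: "0 < r" by simp
  interpret D: comm_group "DerDeg n r" by (rule DerDeg_comm_group)
  define cr where "cr p = (SOME h. h \<in> c p)" for p
  define dr where "dr p = (SOME h. h \<in> d p)" for p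
  \<comment> \<open>Stated for arbitrary lists of degrees so that induction on the list
    applies.\<close>
  define Q where "Q ps = foldr (\<lambda>p acc. gcomm HH (cr p) (dr (r - p)) \<otimes>\<^bsub>HH\<^esub> acc) ps \<one>\<^bsub>HH\<^esub>" for ps
  have Q: "Q ps \<in> Gam HH r \<and> JT r (Q ps) = (\<lambda>i w. \<Sum>p\<leftarrow>ps. derbr_deg (JT p (cr p)) (JT (r - p) (dr (r - p))) i w)"
    if "set ps \<subseteq> {1..<r}" for ps
    using that
  proof (induction ps)
    case Nil
    have "\<one>\<^bsub>HH\<^esub> \<in> Gam HH p" for p by (rule subgroup.one_closed[OF H.Gam_subgroup])
    then show ?case using JT_Gam_Suc[OF r0, of "\<one>\<^bsub>HH\<^esub>"] by (simp add: Q_def DerDeg_one)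
  next
    case (Cons p ps)
    have p: "0 < p" "0 < r - p" "p + (r - p) = r" "p \<in> {1..}" "r - p \<in> {1..}" using Cons.prems by auto
    have x: "cr p \<in> Gam HH p" "dr (r - p) \<in> Gam HH (r - p)"
      unfolding cr_def dr_def using grDCS_rep(1)[OF c p(4)] grDCS_rep(1)[OF d p(5)] by auto
    have g: "gcomm HH (cr p) (dr (r - p)) \<in> Gam HH r" using H.gcomm_Gam[OF x p(1,2)] p(3) by simp
    have t: "JT r (gcomm HH (cr p) (dr (r - p))) = derbr_deg (JT p (cr p)) (JT (r - p) (dr (r - p)))"
      using JT_gcomm[OF p(1,2) x] p(3) by simp
    have Qc: "Q (p # ps) = gcomm HH (cr p) (dr (r - p)) \<otimes>\<^bsub>HH\<^esub> Q ps" by (simp add: Q_def)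
    have IH: "Q ps \<in> Gam HH r" "JT r (Q ps) = (\<lambda>i w. \<Sum>p\<leftarrow>ps. derbr_deg (JT p (cr p)) (JT (r - p) (dr (r - p))) i w)"
      using Cons by auto
    show ?case
      unfolding Qc JT_mult[OF r0 g IH(1)] t IH(2) DerDeg_mult
      using subgroup.m_closed[OF H.Gam_subgroup g IH(1)] by simp
  qed
  have set: "set [1..<r] = {1..<r}" by simp
  have "grbr HH c d r = Gam HH (Suc r) #>\<^bsub>HH\<^esub> Q [1..<r]"
    using r unfolding grbr_def Q_def cr_def dr_def by simp
  then have "JT r (SOME h. h \<in> grbr HH c d r) = JT r (Q [1..<r])"
    using JT_some_coset[OF r0] Q[of "[1..<r]"] set by simp
  also have "\<dots> = (\<lambda>i w. \<Sum>p\<in>{1..<r}. derbr_deg (JT p (cr p)) (JT (r - p) (dr (r - p))) i w)"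
    using Q[of "[1..<r]"] set by (simp add: interv_sum_list_conv_sum_set_nat)
  also have "\<dots> = (\<lambda>i w. \<Sum>p = 1..<r. derbr_deg ((\<lambda>s\<in>{1..}. JT s (SOME h. h \<in> c s)) p)
      ((\<lambda>s\<in>{1..}. JT s (SOME h. h \<in> d s)) (r - p)) i w)"
    by (intro ext sum.cong) (auto simp: cr_def dr_def)
  finally show "JT r (SOME h. h \<in> grbr HH c d r) = (\<lambda>i w. \<Sum>p = 1..<r. derbr_deg ((\<lambda>s\<in>{1..}. JT s (SOME h. h \<in> c s)) p)
      ((\<lambda>s\<in>{1..}. JT s (SOME h. h \<in> d s)) (r - p)) i w)" .
qed

text \<open>The retractions of the separate degrees are chosen independently and applied
  componentwise. They preserve finite support because each sends identity to identity.\<close>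

lemma Phi_split: "\<exists>\<rho> \<in> hom (DerL n) (grDCS HH). \<forall>c \<in> carrier (grDCS HH). \<rho> (Phi n k c) = c"
proof -
  have "\<forall>s. \<exists>R. 0 < s \<longrightarrow> R \<in> hom (DerDeg n s) (grp HH s) \<and> (\<forall>h \<in> Gam HH s. R (JT s h) = Gam HH (Suc s) #>\<^bsub>HH\<^esub> h)"
    using JT_retraction by blast
  then obtain R where R: "\<And>s. 0 < s \<Longrightarrow> R s \<in> hom (DerDeg n s) (grp HH s)"
      "\<And>s h. 0 < s \<Longrightarrow> h \<in> Gam HH s \<Longrightarrow> R s (JT s h) = Gam HH (Suc s) #>\<^bsub>HH\<^esub> h" by metis
  have gh: "group_hom (DerDeg n s) (grp HH s) (R s)" if "0 < s" for s
    using R(1)[OF that] by (simp add: group_hom_def group_hom_axioms_def DerDeg_group H.grp_group)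
  define \<rho> where "\<rho> D = (\<lambda>s\<in>{1..}. R s (D s))" for D
  have "\<rho> \<in> hom (DerL n) (grDCS HH)"
  proof (rule homI)
    fix D assume D: "D \<in> carrier (DerL n)"
    have "{s \<in> {1..}. \<rho> D s \<noteq> Gam HH (Suc s)} \<subseteq> {s \<in> {1..}. D s \<noteq> \<one>\<^bsub>DerDeg n s\<^esub>}"
      using group_hom.hom_one[OF gh] by (auto simp: \<rho>_def H.grp_one)
    moreover have "finite {s \<in> {1..}. D s \<noteq> \<one>\<^bsub>DerDeg n s\<^esub>}" using D by (simp add: DerL_carrier)
    ultimately have "finite {s \<in> {1..}. \<rho> D s \<noteq> Gam HH (Suc s)}" by (rule finite_subset)
    moreover have "\<rho> D \<in> (\<Pi>\<^sub>E s\<in>{1..}. carrier (grp HH s))"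
    proof (unfold \<rho>_def, rule restrict_PiE_iff[THEN iffD2], rule ballI)
      fix s :: nat assume s: "s \<in> {1..}"
      then have "D s \<in> carrier (DerDeg n s)" using D unfolding DerL_carrier by blast
      then show "R s (D s) \<in> carrier (grp HH s)" using group_hom.hom_closed[OF gh] s by simp
    qed
    ultimately show "\<rho> D \<in> carrier (grDCS HH)" by (simp add: grDCS_carrier)
  next
    fix D E assume DE: "D \<in> carrier (DerL n)" "E \<in> carrier (DerL n)"
    have "R s (D s \<otimes>\<^bsub>DerDeg n s\<^esub> E s) = R s (D s) \<otimes>\<^bsub>grp HH s\<^esub> R s (E s)" if s: "s \<in> {1..}" for s
    proof -
      have "D s \<in> carrier (DerDeg n s)" "E s \<in> carrier (DerDeg n s)" using DE s unfolding DerL_carrier by blast+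
      then show ?thesis using group_hom.hom_mult[OF gh] s by simp
    qed
    then show "\<rho> (D \<otimes>\<^bsub>DerL n\<^esub> E) = \<rho> D \<otimes>\<^bsub>grDCS HH\<^esub> \<rho> E"
      unfolding \<rho>_def grDCS_def DerL_def mult_sum_group by (intro restrict_ext) simp
  qed
  moreover have "\<rho> (Phi n k c) = c" if c: "c \<in> carrier (grDCS HH)" for c
  proof
    fix s
    show "\<rho> (Phi n k c) s = c s"
    proof (cases "s \<in> {1..}")
      case True
      then show ?thesis using R(2)[OF _ grDCS_rep(1)[OF c True]] grDCS_rep(2)[OF c True] by (simp add: \<rho>_def Phi_def)
    next
      case False
      \<comment> \<open>Index 0 carries no component: both families take the default value
        \<open>undefined\<close> there, which is needed for equality as functions.\<close>
      have "c \<in> (\<Pi>\<^sub>E s\<in>{1..}. carrier (grp HH s))" using c by (simp add: grDCS_carrier)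
      from PiE_arb[OF this False] have "c s = undefined" .
      then show ?thesis using False by (simp add: \<rho>_def)
    qed
  qed
  ultimately show ?thesis by blast
qed

end

text \<open>The composite consists of induced maps, so its existence is part of the claim: the first
  four conjuncts supply the arrows and the independence of representatives that the choice inside
  \<open>Phi\<close> presupposes.\<close>

theorem theorem7p1:
  fixes n k :: nat
  assumes "3 \<le> n" and "2 \<le> k" and "k \<le> n"
  shows "Theta n k \<in> hom (Hgrp n k) (PSigma n)
    \<and> (\<forall>s \<ge> 1. Theta n k ` Gam (Hgrp n k) s \<subseteq> Gam (PSigma n) s)
    \<and> (\<forall>s \<ge> 1. Gam (PSigma n) s \<subseteq> J n s)
    \<and> (\<forall>s \<ge> 1. \<forall>h \<in> Gam (Hgrp n k) s. \<forall>h' \<in> Gam (Hgrp n k) s.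
          h' \<in> Gam (Hgrp n k) (Suc s) #>\<^bsub>Hgrp n k\<^esub> h
          \<longrightarrow> tau n s (Theta n k h') = tau n s (Theta n k h))
    \<and> Phi n k \<in> hom (grDCS (Hgrp n k)) (DerL n)
    \<and> (\<forall>c \<in> carrier (grDCS (Hgrp n k)). \<forall>d \<in> carrier (grDCS (Hgrp n k)).
          Phi n k (grbr (Hgrp n k) c d) = derbr (Phi n k c) (Phi n k d))
    \<and> inj_on (Phi n k) (carrier (grDCS (Hgrp n k)))
    \<and> (\<exists>\<rho> \<in> hom (DerL n) (grDCS (Hgrp n k)).
          \<forall>c \<in> carrier (grDCS (Hgrp n k)). \<rho> (Phi n k c) = c)"
proof -
  note kn = assms(2,3)
  have "inj_on (Phi n k) (carrier (grDCS (Hgrp n k)))"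
    using Phi_split[OF kn] by (metis inj_onI)
  then show ?thesis
    using Theta_hom[OF kn] Theta_Gam[OF kn] Gam_PSigma_subset_J JT_coset[OF kn] Phi_hom[OF kn] Phi_grbr[OF kn] Phi_split[OF kn]
    by (auto simp: Suc_le_eq)
qed

end
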